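(* Let $A[1..N]$ be an array of anchors satisfying the Equal Match Length property ($I.b-I.a=I.d-I.c$ for every anchor $I$). Then the values $\max_{S}\mathtt{coverage}(S)$, where $S$ ranges over all chains ending at $A[i]$, can be computed for all $i$, $1\le i\le N$, in $O(N\log^2 N)$ time.
   Context: An anchor is an interval pair $I=([I.a..I.b],[I.c..I.d])$ with positive integer endpoints, $I.a\le I.b$, $I.c\le I.d$. Precedence: $I'\prec I$ iff $I'.a<I.a$, $I'.b<I.b$, $I'.c<I.c$ and $I'.d<I.d$. A chain ending at $A[i]$ is a sequence $S[1..n]$ ($n\ge1$) of anchors from $A$ with $S[j-1]\prec S[j]$ for all $1<j\le n$ and $S[n]=A[i]$. Its symmetric ordered coverage is \[ \mathtt{coverage}(S)=\sum_{j=1}^{n-1}\min\Big(\min(S[j+1].a,S[j].b+1)-S[j].a,\ \min(S[j+1].c,S[j].d+1)-S[j].c\Big)+\min\big(S[n].b-S[n].a+1,\ S[n].d-S[n].c+1\big). \] Anchors may overlap in both dimensions within a chain. *)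

theory Defs
  imports Complex_Main "HOL-Library.Landau_Symbols"
begin

section \<open>Anchors, chains and symmetric ordered coverage\<close>

datatype anchor = Anchor (end_a: int) (end_b: int) (end_c: int) (end_d: int)

definition valid_anchor :: "anchor \<Rightarrow> bool" where
  "valid_anchor I \<longleftrightarrow>
     1 \<le> end_a I \<and> end_a I \<le> end_b I \<and> 1 \<le> end_c I \<and> end_c I \<le> end_d I"

definition equal_match_length :: "anchor \<Rightarrow> bool" where
  "equal_match_length I \<longleftrightarrow> end_b I - end_a I = end_d I - end_c I"

definition precedes :: "anchor \<Rightarrow> anchor \<Rightarrow> bool" (infix "\<prec>" 50) where
  "I' \<prec> I \<longleftrightarrow>
     end_a I' < end_a I \<and> end_b I' < end_b I \<and> end_c I' < end_c I \<and> end_d I' < end_d I"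

text \<open>Arrays and sequences are lists, so indices start at 0.\<close>

definition chains_ending_at :: "anchor list \<Rightarrow> nat \<Rightarrow> anchor list set" where
  "chains_ending_at A i =
     {S. S \<noteq> [] \<and> set S \<subseteq> set A \<and>
         (\<forall>j. Suc j < length S \<longrightarrow> S ! j \<prec> S ! Suc j) \<and>
         S ! (length S - 1) = A ! i}"

text \<open>Only meaningful for nonempty sequences.\<close>

definition coverage :: "anchor list \<Rightarrow> int" where
  "coverage S =
     (\<Sum>j<length S - 1.
        min (min (end_a (S ! Suc j)) (end_b (S ! j) + 1) - end_a (S ! j))
            (min (end_c (S ! Suc j)) (end_d (S ! j) + 1) - end_c (S ! j)))
     + (let L = S ! (length S - 1)
        in min (end_b L - end_a L + 1) (end_d L - end_c L + 1))"

text \<open>The maximum below ranges over a finite nonempty set.\<close>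

lemma finite_chains_ending_at: "finite (chains_ending_at A i)"
proof -
  have "distinct S" if "\<forall>j. Suc j < length S \<longrightarrow> S ! j \<prec> S ! Suc j" for S
  proof -
    have "sorted_wrt (\<prec>) S"
      using that by (subst sorted_wrt_iff_nth_Suc_transp) (auto simp: transp_def precedes_def)
    then show ?thesis
      unfolding distinct_conv_nth sorted_wrt_iff_nth_less precedes_def
      by (metis less_irrefl linorder_neqE_nat)
  qed
  then have "chains_ending_at A i \<subseteq> {S. set S \<subseteq> set A \<and> distinct S}"
    unfolding chains_ending_at_def by blast
  then show ?thesis
    by (rule finite_subset) (simp add: finite_subset_distinct)
qed

lemma chains_ending_at_nonempty: "i < length A \<Longrightarrow> chains_ending_at A i \<noteq> {}"
  by (rule ex_in_conv[THEN iffD1], rule exI[of _ "[A ! i]"]) (simp add: chains_ending_at_def)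

definition max_coverage :: "anchor list \<Rightarrow> nat \<Rightarrow> int" where
  "max_coverage A i = Max (coverage ` chains_ending_at A i)"


section \<open>A random access machine with uniform cost\<close>

text \<open>
  Running time is measured on a random access machine given by structured programs: finitely many
  integer registers and finitely many integer arrays (a program mentions only finitely many names)
  with indirect addressing, and one time unit per elementary operation. The arithmetic is addition
  and subtraction only; since words are unbounded, unit-cost multiplication, division or shifts
  would allow computing with very long numbers at unrealistically low cost.
\<close>

datatype exp =
    Const int
  | Reg string
  | Load string exp
  | Plus exp exp
  | Minus exp exp

datatype test =
    Less exp exp
  | Not test
  | And test test

datatype prog =
    Skip
  | Assign string exp
  | Store string exp exp
  | Seq prog prog
  | If test prog prog
  | While test prog

record state =
  regs :: "string \<Rightarrow> int"
  arrays :: "string \<Rightarrow> int \<Rightarrow> int"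

primrec exp_val :: "exp \<Rightarrow> state \<Rightarrow> int" where
  "exp_val (Const k) s = k"
| "exp_val (Reg x) s = regs s x"
| "exp_val (Load X e) s = arrays s X (exp_val e s)"
| "exp_val (Plus e e') s = exp_val e s + exp_val e' s"
| "exp_val (Minus e e') s = exp_val e s - exp_val e' s"

primrec exp_cost :: "exp \<Rightarrow> nat" where
  "exp_cost (Const k) = 1"
| "exp_cost (Reg x) = 1"
| "exp_cost (Load X e) = 1 + exp_cost e"
| "exp_cost (Plus e e') = 1 + exp_cost e + exp_cost e'"
| "exp_cost (Minus e e') = 1 + exp_cost e + exp_cost e'"

primrec test_val :: "test \<Rightarrow> state \<Rightarrow> bool" where
  "test_val (Less e e') s \<longleftrightarrow> exp_val e s < exp_val e' s"
| "test_val (Not p) s \<longleftrightarrow> \<not> test_val p s"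
| "test_val (And p q) s \<longleftrightarrow> test_val p s \<and> test_val q s"

primrec test_cost :: "test \<Rightarrow> nat" where
  "test_cost (Less e e') = 1 + exp_cost e + exp_cost e'"
| "test_cost (Not p) = 1 + test_cost p"
| "test_cost (And p q) = 1 + test_cost p + test_cost q"

text \<open>\<open>exec P s t s'\<close>: started in state \<open>s\<close>, program \<open>P\<close> halts in state \<open>s'\<close> after \<open>t\<close> time units.\<close>

inductive exec :: "prog \<Rightarrow> state \<Rightarrow> nat \<Rightarrow> state \<Rightarrow> bool" where
  Skip: "exec Skip s 1 s"
| Assign: "exec (Assign x e) s (1 + exp_cost e) (s\<lparr>regs := (regs s)(x := exp_val e s)\<rparr>)"
| Store: "exec (Store X e e') s (1 + exp_cost e + exp_cost e')
    (s\<lparr>arrays := (arrays s)(X := (arrays s X)(exp_val e s := exp_val e' s))\<rparr>)"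
| Seq: "exec P s t s' \<Longrightarrow> exec Q s' u s'' \<Longrightarrow> exec (Seq P Q) s (t + u) s''"
| IfTrue: "test_val p s \<Longrightarrow> exec P s t s' \<Longrightarrow> exec (If p P Q) s (1 + test_cost p + t) s'"
| IfFalse: "\<not> test_val p s \<Longrightarrow> exec Q s t s' \<Longrightarrow> exec (If p P Q) s (1 + test_cost p + t) s'"
| WhileFalse: "\<not> test_val p s \<Longrightarrow> exec (While p P) s (1 + test_cost p) s"
| WhileTrue: "test_val p s \<Longrightarrow> exec P s t s' \<Longrightarrow> exec (While p P) s' u s'' \<Longrightarrow>
    exec (While p P) s (1 + test_cost p + t + u) s''"

inductive_cases exec_SkipE: "exec Skip s t s'"
  and exec_AssignE: "exec (Assign x e) s t s'"
  and exec_StoreE: "exec (Store X e e') s t s'"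
  and exec_SeqE: "exec (Seq P Q) s t s'"
  and exec_IfE: "exec (If p P Q) s t s'"
  and exec_WhileE: "exec (While p P) s t s'"

lemma exec_deterministic: "exec P s t s' \<Longrightarrow> exec P s u s'' \<Longrightarrow> u = t \<and> s'' = s'"
proof (induction arbitrary: u s'' rule: exec.induct)
  case (Seq P s t s1 Q v s2)
  from Seq.prems obtain t' v' s3 where "u = t' + v'" "exec P s t' s3" "exec Q s3 v' s''"
    by (rule exec_SeqE)
  with Seq.IH show ?case by metis
next
  case (IfTrue p s P t s1 Q)
  then obtain t' where "u = 1 + test_cost p + t'" "exec P s t' s''"
    by (auto elim: exec_IfE)
  with IfTrue.IH show ?case by metis
next
  case (IfFalse p s Q t s1 P)
  then obtain t' where "u = 1 + test_cost p + t'" "exec Q s t' s''"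
    by (auto elim: exec_IfE)
  with IfFalse.IH show ?case by metis
next
  case (WhileFalse p s P)
  from WhileFalse.prems WhileFalse.hyps show ?case
    by (auto elim: exec_WhileE)
next
  case (WhileTrue p s P t s1 v s2)
  from WhileTrue.prems WhileTrue.hyps(1) obtain t' s3 v'
    where "u = 1 + test_cost p + t' + v'" "exec P s t' s3" "exec (While p P) s3 v' s''"
    by (auto elim: exec_WhileE[of p P s u s''])
  with WhileTrue.IH show ?case by metis
qed (auto elim: exec_SkipE exec_AssignE exec_StoreE)

text \<open>
  Initially register \<open>n\<close> holds the number of anchors, cells \<open>0, \<dots>, n - 1\<close> of the arrays
  \<open>a\<close>, \<open>b\<close>, \<open>c\<close>, \<open>d\<close> hold their endpoints, and everything else is 0.
\<close>

definition endpoint_array :: "(anchor \<Rightarrow> int) \<Rightarrow> anchor list \<Rightarrow> int \<Rightarrow> int" where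
  "endpoint_array f A k = (if 0 \<le> k \<and> k < int (length A) then f (A ! nat k) else 0)"

definition input_state :: "anchor list \<Rightarrow> state" where
  "input_state A =
     \<lparr>regs = (\<lambda>_. 0)(''n'' := int (length A)),
      arrays = (\<lambda>_ _. 0)
        (''a'' := endpoint_array end_a A,
         ''b'' := endpoint_array end_b A,
         ''c'' := endpoint_array end_c A,
         ''d'' := endpoint_array end_d A)\<rparr>"

end

theory Submission
  imports Defs
begin

text \<open>
  With \<open>U\<close> denoting the best coverage of a chain ending at an anchor minus the length of that anchor,
  \<open>U j\<close> is the maximum of \<open>0\<close> and of \<open>U i + min (a j - a i) (c j - c i) (len i)\<close> over all \<open>i\<close> that
  precede \<open>j\<close>. The maximum does not change if \<open>i\<close> ranges over all anchors with \<open>b i < b j\<close> and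
  \<open>d i < d j\<close>. By the equal match length property, \<open>a - c = b - d\<close> is the diagonal of an anchor, and
  which argument of the minimum counts is decided as follows: it is \<open>len i\<close> if \<open>b i < a j\<close> and
  \<open>d i < c j\<close>; it is \<open>a j - a i\<close> if the diagonal of \<open>i\<close> is at least that of \<open>j\<close> and
  \<open>a j \<le> b i < b j\<close>; and it is \<open>c j - c i\<close> if the diagonal of \<open>i\<close> is at most that of \<open>j\<close> and
  \<open>c j \<le> d i < d j\<close>. So if the anchors are processed in the order of \<open>b\<close>, each value is the
  result of three orthogonal range maximum queries in the plane.

  Each of them is answered by a two-dimensional segment tree over ranks in \<open>O(log\<^sup>2 N)\<close> steps. The
  trees occupy a quadratic address range, but only the cells that are visited cost time, and memory
  is initially \<open>0\<close>, which stands for an empty cell. Ranks and order are found by a tournament sort of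
  all endpoints and diagonals. Divisions by two and row addresses come from precomputed tables,
  because the machine only adds and subtracts.
\<close>


section \<open>A recurrence for the maximum coverage\<close>

text \<open>Precedence compares four coordinates, while the data structure handles rectangles in the
  plane. The gap closes because, by equal match length, each of the three rectangles already implies
  both strict inequalities between right ends. So the sweep order never has to cut off a candidate:
  it only guarantees that the values of all anchors with smaller \<open>b\<close> are available.
  Anchors with equal \<open>b\<close> may come in any order, and nothing is ever deleted from a
  tree.

  Deciding beforehand which argument of the minimum counts has a second purpose. On each rectangle
  the candidate value splits into a summand that depends on \<open>i\<close> only, which can be
  stored once and for all, and a summand that depends on \<open>j\<close> only, which is added after
  the query. A range maximum could not handle a minimum that mixes \<open>i\<close> and
  \<open>j\<close>.

  The queries compare \<open>b\<close> with \<open>a\<close> and \<open>d\<close> with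
  \<open>c\<close>, that is, keys of different kinds. This is why all keys are ranked by one common
  sort.\<close>

definition len :: "anchor \<Rightarrow> int" where
  "len I = end_b I - end_a I + 1"

text \<open>This is the summand of \<open>coverage\<close> under equal match length: the two
  cut-offs at \<open>b + 1\<close> and \<open>d + 1\<close> merge into the single bound
  \<open>len I\<close>.\<close>

definition gain :: "anchor \<Rightarrow> anchor \<Rightarrow> int" where
  "gain I J = min (min (end_a J - end_a I) (end_c J - end_c I)) (len I)"

text \<open>The former last anchor loses its closing term \<open>len (last S)\<close> and
  contributes a \<open>gain\<close> instead; all earlier summands see the same neighbours as
  before.\<close>

lemma coverage_snoc:
  assumes "S \<noteq> []" "equal_match_length (last S)" "equal_match_length x"
  shows "coverage (S @ [x]) = coverage S - len (last S) + gain (last S) x + len x"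
proof -
  have l: "length S = Suc (length S - 1)" using assms by (cases S) auto
  have e: "last S = S ! (length S - 1)" using assms by (simp add: last_conv_nth)
  let ?f = "\<lambda>S j. min (min (end_a (S ! Suc j)) (end_b (S ! j) + 1) - end_a (S ! j))
            (min (end_c (S ! Suc j)) (end_d (S ! j) + 1) - end_c (S ! j))"
  have "(\<Sum>j<length S. ?f (S @ [x]) j) = (\<Sum>j<length S - 1. ?f (S @ [x]) j) + ?f (S @ [x]) (length S - 1)"
    by (subst l) (rule sum.lessThan_Suc)
  also have "(\<Sum>j<length S - 1. ?f (S @ [x]) j) = (\<Sum>j<length S - 1. ?f S j)"
    by (rule sum.cong) (auto simp: nth_append)
  also have "?f (S @ [x]) (length S - 1) = gain (last S) x"
    using l assms by (simp add: nth_append e gain_def len_def equal_match_length_def) linarith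
  finally show ?thesis using assms
    by (simp add: coverage_def Let_def nth_append e len_def equal_match_length_def)
qed

lemma coverage_single: "equal_match_length x \<Longrightarrow> coverage [x] = len x"
  by (simp add: coverage_def len_def equal_match_length_def)

text \<open>Chains are indexed by a position in the array, whereas the last element of
  \<open>S\<close> is a bare anchor that may occur at several positions; hence the existential
  \<open>i\<close>.\<close>

lemma chain_snoc_iff:
  assumes "S \<noteq> []"
  shows "S @ [x] \<in> chains_ending_at A j \<longleftrightarrow>
    (\<exists>i<length A. S \<in> chains_ending_at A i \<and> A ! i = last S) \<and> x = A ! j \<and> x \<in> set A \<and> last S \<prec> x"
    (is "?l \<longleftrightarrow> ?r")
proof -
  have e: "last S = S ! (length S - 1)" using assms by (simp add: last_conv_nth)
  have l: "length S = Suc (length S - 1)" using assms by (cases S) auto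
  have c: "(\<forall>i. Suc i < length (S @ [x]) \<longrightarrow> (S @ [x]) ! i \<prec> (S @ [x]) ! Suc i) \<longleftrightarrow>
    (\<forall>i. Suc i < length S \<longrightarrow> S ! i \<prec> S ! Suc i) \<and> last S \<prec> x" (is "?a \<longleftrightarrow> ?b")
  proof
    assume a: ?a
    show ?b
    proof (intro conjI allI impI)
      fix i assume "Suc i < length S"
      then show "S ! i \<prec> S ! Suc i" using a[rule_format, of i] by (simp add: nth_append)
    next
      show "last S \<prec> x" using a[rule_format, of "length S - 1"] l by (simp add: nth_append e)
    qed
  next
    assume ?b
    then show ?a
      using l by (auto simp: nth_append e) (metis Suc_lessI diff_Suc_1 not_less_eq)
  qed
  show ?thesis
  proof
    assume ?l
    then have "set S \<subseteq> set A" "x \<in> set A" "x = A ! j" and "last S \<prec> x"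
      "\<forall>i. Suc i < length S \<longrightarrow> S ! i \<prec> S ! Suc i"
      unfolding chains_ending_at_def using c by auto
    moreover obtain i where "i < length A" "A ! i = last S"
      using \<open>set S \<subseteq> set A\<close> assms by (metis in_set_conv_nth last_in_set subsetD)
    ultimately show ?r using assms e by (auto simp: chains_ending_at_def)
  next
    assume ?r
    then show ?l unfolding chains_ending_at_def using c by auto
  qed
qed

text \<open>The \<open>U\<close> of the overview. Without the closing term of the last anchor,
  appending an anchor to a chain adds exactly one \<open>gain\<close>.\<close>

definition score :: "anchor list \<Rightarrow> nat \<Rightarrow> int" where
  "score A i = max_coverage A i - len (A ! i)"

locale equal_length_anchors =
  fixes A :: "anchor list"
  assumes valid: "I \<in> set A \<Longrightarrow> valid_anchor I"
    and eml: "I \<in> set A \<Longrightarrow> equal_match_length I"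
begin

abbreviation "\<alpha> i \<equiv> end_a (A ! i)"
abbreviation "\<beta> i \<equiv> end_b (A ! i)"
abbreviation "\<gamma> i \<equiv> end_c (A ! i)"
abbreviation "\<delta> i \<equiv> end_d (A ! i)"

lemma eml_nth: "i < length A \<Longrightarrow> \<beta> i - \<alpha> i = \<delta> i - \<gamma> i"
  using eml[of "A ! i"] by (simp add: equal_match_length_def)

lemma valid_nth: "i < length A \<Longrightarrow> 1 \<le> \<alpha> i \<and> \<alpha> i \<le> \<beta> i \<and> 1 \<le> \<gamma> i \<and> \<gamma> i \<le> \<delta> i"
  using valid[of "A ! i"] by (simp add: valid_anchor_def)

lemma coverage_le: "S \<in> chains_ending_at A i \<Longrightarrow> coverage S \<le> max_coverage A i"
  unfolding max_coverage_def by (rule Max_ge) (auto simp: finite_chains_ending_at)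

lemma coverage_attained:
  assumes "i < length A" shows "\<exists>S \<in> chains_ending_at A i. coverage S = max_coverage A i"
proof -
  have "max_coverage A i \<in> coverage ` chains_ending_at A i"
    unfolding max_coverage_def using chains_ending_at_nonempty[OF assms]
    by (intro Max_in) (auto simp: finite_chains_ending_at)
  then show ?thesis by force
qed

lemma score_nonneg:
  assumes "i < length A" shows "0 \<le> score A i"
proof -
  have "[A ! i] \<in> chains_ending_at A i" using assms by (simp add: chains_ending_at_def)
  from coverage_le[OF this] show ?thesis
    using assms eml by (simp add: score_def coverage_single)
qed

lemma score_step:
  assumes "i < length A" "j < length A" "A ! i \<prec> A ! j"
  shows "score A i + gain (A ! i) (A ! j) \<le> score A j"
proof -
  obtain S where S: "S \<in> chains_ending_at A i" "coverage S = max_coverage A i"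
    using coverage_attained assms by blast
  have ne: "S \<noteq> []" and l: "last S = A ! i"
    using S by (auto simp: chains_ending_at_def last_conv_nth)
  have "S @ [A ! j] \<in> chains_ending_at A j"
    unfolding chain_snoc_iff[OF ne] using S assms l by auto
  from coverage_le[OF this] show ?thesis
    using coverage_snoc[OF ne] l eml assms S by (simp add: score_def)
qed

lemma score_cases:
  assumes "j < length A"
  shows "score A j = 0 \<or>
    (\<exists>i<length A. A ! i \<prec> A ! j \<and> score A j = score A i + gain (A ! i) (A ! j))"
proof -
  obtain S where S: "S \<in> chains_ending_at A j" "coverage S = max_coverage A j"
    using coverage_attained assms by blast
  then have ne: "S \<noteq> []" and l: "last S = A ! j"
    by (auto simp: chains_ending_at_def last_conv_nth)
  define R where "R = butlast S"
  have SR: "S = R @ [A ! j]" using ne l by (metis R_def append_butlast_last_id)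
  show ?thesis
  proof (cases "R = []")
    case True
    then show ?thesis using S SR eml assms by (simp add: score_def coverage_single)
  next
    case False
    obtain i where i: "i < length A" "R \<in> chains_ending_at A i" "A ! i = last R" "last R \<prec> A ! j"
      using S(1) SR chain_snoc_iff[OF False] by metis
    have "score A j = coverage R - len (A ! i) + gain (A ! i) (A ! j)"
      using coverage_snoc[OF False, of "A ! j"] S(2) SR i(1) i(3)[symmetric] eml assms
      by (simp add: score_def)
    also have "\<dots> \<le> score A i + gain (A ! i) (A ! j)"
      using coverage_le[OF i(2)] by (simp add: score_def)
    \<comment> \<open>The optimal chain gives one inequality and \<open>score_step\<close> the
      other, so the chain without its last anchor is itself optimal.\<close>
    finally show ?thesis using score_step[of i j] i assms by force
  qed
qed

text \<open>
  If \<open>A ! i\<close> does not start before \<open>A ! j\<close>, then the gain is not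
  positive, and the predecessor of \<open>A ! i\<close> in an optimal chain does at least as well.
\<close>

lemma score_step_right_ends:
  assumes "i < length A" "j < length A" "\<beta> i < \<beta> j" "\<delta> i < \<delta> j"
  shows "score A i + gain (A ! i) (A ! j) \<le> score A j"
  using assms(1,3,4)
proof (induction "nat (\<beta> i)" arbitrary: i rule: less_induct)
  case less
  show ?case
  proof (cases "\<alpha> i < \<alpha> j \<and> \<gamma> i < \<gamma> j")
    case True
    then show ?thesis using score_step[of i j] less.prems assms(2) by (simp add: precedes_def)
  next
    case False
    \<comment> \<open>One of the two differences is at most 0 while every length is at least 1, so
      the length is not the active argument of the minimum.\<close>
    then have g: "gain (A ! i) (A ! j) = min (\<alpha> j - \<alpha> i) (\<gamma> j - \<gamma> i)"
      and g0: "gain (A ! i) (A ! j) \<le> 0"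
      using valid_nth[OF less.prems(1)] by (auto simp: gain_def len_def)
    from score_cases[OF less.prems(1)] show ?thesis
    proof
      assume "score A i = 0"
      then show ?thesis using g0 score_nonneg[OF assms(2)] by simp
    next
      assume "\<exists>k<length A. A ! k \<prec> A ! i \<and> score A i = score A k + gain (A ! k) (A ! i)"
      then obtain k where k: "k < length A" "A ! k \<prec> A ! i"
        "score A i = score A k + gain (A ! k) (A ! i)" by blast
      have "score A k + gain (A ! k) (A ! j) \<le> score A j"
        using k less.prems valid_nth[OF k(1)] by (intro less.hyps) (auto simp: precedes_def)
      \<comment> \<open>The differences in \<open>a\<close> and in \<open>c\<close> telescope, and
        the bound by the length of \<open>A ! k\<close> survives because the second gain is at most
        0.\<close>
      moreover have "gain (A ! k) (A ! i) + gain (A ! i) (A ! j) \<le> gain (A ! k) (A ! j)"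
        using g g0 by (auto simp: gain_def)
      ultimately show ?thesis using k by simp
    qed
  qed
qed

end

text \<open>
  Memory cells are initially 0, so the queries return \<open>0\<close> instead of the maximum of an empty set.
\<close>

definition is_max0 :: "int set \<Rightarrow> int \<Rightarrow> bool" where
  "is_max0 V q \<longleftrightarrow> 0 \<le> q \<and> (\<forall>v\<in>V. v \<le> q) \<and> (q = 0 \<or> q \<in> V)"

context equal_length_anchors begin

text \<open>For the upper bound on the queries, each rectangle fixes the value of
  \<open>gain\<close> and forces smaller right ends, so \<open>score_step_right_ends\<close>
  applies. For the converse, an optimal predecessor lies in at least one rectangle. The shift
  \<open>B\<close> turns the default result 0 of an empty query into a contribution of at most 0,
  below the nonnegative score.\<close>

lemma score_eq_queries:
  assumes j: "j < length A" and D: "D \<subseteq> {..<length A}" "\<And>i. i < length A \<Longrightarrow> \<beta> i < \<beta> j \<Longrightarrow> i \<in> D"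
    and B: "\<alpha> j \<le> B" "\<gamma> j \<le> B"
    and q1: "is_max0 {score A i - \<alpha> i + B |i. i \<in> D \<and> \<alpha> j - \<gamma> j \<le> \<alpha> i - \<gamma> i \<and> \<alpha> j \<le> \<beta> i \<and> \<beta> i < \<beta> j} q1"
    and q2: "is_max0 {score A i - \<gamma> i + B |i. i \<in> D \<and> \<alpha> i - \<gamma> i \<le> \<alpha> j - \<gamma> j \<and> \<gamma> j \<le> \<delta> i \<and> \<delta> i < \<delta> j} q2"
    and q3: "is_max0 {score A i + len (A ! i) |i. i \<in> D \<and> \<beta> i < \<alpha> j \<and> \<delta> i < \<gamma> j} q3"
  shows "score A j = max (max (q1 + \<alpha> j - B) (q2 + \<gamma> j - B)) q3"
proof (rule antisym)
  have V: "\<beta> i - \<alpha> i = \<delta> i - \<gamma> i \<and> 1 \<le> \<alpha> i \<and> \<alpha> i \<le> \<beta> i \<and> 1 \<le> \<gamma> i \<and> \<gamma> i \<le> \<delta> i"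
    if "i < length A" for i using that eml_nth valid_nth by auto
  note Vj = V[OF j]
  show "max (max (q1 + \<alpha> j - B) (q2 + \<gamma> j - B)) q3 \<le> score A j"
  proof (intro max.boundedI)
    show "q1 + \<alpha> j - B \<le> score A j"
    proof (cases "q1 = 0")
      case True then show ?thesis using score_nonneg[OF j] B by simp
    next
      case False
      with q1 obtain i where i: "i \<in> D" "q1 = score A i - \<alpha> i + B" "\<alpha> j - \<gamma> j \<le> \<alpha> i - \<gamma> i"
        "\<alpha> j \<le> \<beta> i" "\<beta> i < \<beta> j" by (auto simp: is_max0_def)
      have il: "i < length A" using i D by auto
      have "gain (A ! i) (A ! j) = \<alpha> j - \<alpha> i" using i V[OF il] by (auto simp: gain_def len_def)
      \<comment> \<open>Equal match length gives \<delta> = \<beta> - (\<alpha> - \<gamma>): a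
        smaller \<open>b\<close> on a diagonal that is at least as large means a smaller
        \<open>d\<close>.\<close>
      moreover have "\<delta> i < \<delta> j" using i V[OF il] Vj by linarith
      ultimately show ?thesis using score_step_right_ends[OF il j i(5)] i by simp
    qed
    show "q2 + \<gamma> j - B \<le> score A j"
    proof (cases "q2 = 0")
      case True then show ?thesis using score_nonneg[OF j] B by simp
    next
      case False
      with q2 obtain i where i: "i \<in> D" "q2 = score A i - \<gamma> i + B" "\<alpha> i - \<gamma> i \<le> \<alpha> j - \<gamma> j"
        "\<gamma> j \<le> \<delta> i" "\<delta> i < \<delta> j" by (auto simp: is_max0_def)
      have il: "i < length A" using i D by auto
      have "gain (A ! i) (A ! j) = \<gamma> j - \<gamma> i" using i V[OF il] by (auto simp: gain_def len_def)
      moreover have "\<beta> i < \<beta> j" using i V[OF il] Vj by linarith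
      ultimately show ?thesis using score_step_right_ends[OF il j _ i(5)] i by simp
    qed
    show "q3 \<le> score A j"
    proof (cases "q3 = 0")
      case True then show ?thesis using score_nonneg[OF j] by simp
    next
      case False
      with q3 obtain i where i: "i \<in> D" "q3 = score A i + len (A ! i)" "\<beta> i < \<alpha> j" "\<delta> i < \<gamma> j"
        by (auto simp: is_max0_def)
      have il: "i < length A" using i D by auto
      have "gain (A ! i) (A ! j) = len (A ! i)" using i V[OF il] by (auto simp: gain_def len_def)
      moreover have "\<beta> i < \<beta> j" "\<delta> i < \<delta> j" using i Vj by linarith+
      ultimately show ?thesis using score_step_right_ends[OF il j] i by simp
    qed
  qed
  show "score A j \<le> max (max (q1 + \<alpha> j - B) (q2 + \<gamma> j - B)) q3"
    using score_cases[OF j]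
  proof
    assume "score A j = 0"
    then show ?thesis using q3 by (auto simp: is_max0_def le_max_iff_disj)
  next
    assume "\<exists>i<length A. A ! i \<prec> A ! j \<and> score A j = score A i + gain (A ! i) (A ! j)"
    then obtain i where i: "i < length A" "A ! i \<prec> A ! j"
      "score A j = score A i + gain (A ! i) (A ! j)" by blast
    have iD: "i \<in> D" using D(2)[OF i(1)] i(2) by (simp add: precedes_def)
    note p = i(2)[unfolded precedes_def]
    note Vi = V[OF i(1)]
    \<comment> \<open>If the anchors overlap in some coordinate, the diagonals tell in which one.
      Suppose the diagonal of \<open>i\<close> is at least that of \<open>j\<close>; then \<beta> i
      < \<alpha> j together with \<gamma> j \<le> \<delta> i would make \<beta> i - \<delta> i
      smaller than \<alpha> j - \<gamma> j, so the overlap is in the first coordinate. The other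
      case is symmetric.\<close>
    consider "\<beta> i < \<alpha> j \<and> \<delta> i < \<gamma> j"
      | "\<alpha> j - \<gamma> j \<le> \<alpha> i - \<gamma> i \<and> \<alpha> j \<le> \<beta> i"
      | "\<alpha> i - \<gamma> i \<le> \<alpha> j - \<gamma> j \<and> \<gamma> j \<le> \<delta> i" using Vi by linarith
    then show ?thesis
    proof cases
      case 1
      then have "score A i + len (A ! i) \<le> q3" using q3 iD by (auto simp: is_max0_def)
      then show ?thesis using i(3) by (auto simp: gain_def)
    next
      case 2
      then have "score A i - \<alpha> i + B \<le> q1" using q1 iD p by (auto simp: is_max0_def)
      then show ?thesis using i(3) by (auto simp: gain_def)
    next
      case 3
      then have "score A i - \<gamma> i + B \<le> q2" using q2 iD p by (auto simp: is_max0_def)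
      then show ?thesis using i(3) by (auto simp: gain_def)
    qed
  qed
qed

end


section \<open>Reasoning about programs with running time\<close>

notation Seq (infixr ";;" 60)

section \<open>Frame conditions and timed total correctness\<close>

primrec regs_of :: "prog \<Rightarrow> string set" where
  "regs_of Skip = {}"
| "regs_of (Assign x e) = {x}"
| "regs_of (Store X e e') = {}"
| "regs_of (Seq P Q) = regs_of P \<union> regs_of Q"
| "regs_of (If p P Q) = regs_of P \<union> regs_of Q"
| "regs_of (While p P) = regs_of P"

primrec arrays_of :: "prog \<Rightarrow> string set" where
  "arrays_of Skip = {}"
| "arrays_of (Assign x e) = {}"
| "arrays_of (Store X e e') = {X}"
| "arrays_of (Seq P Q) = arrays_of P \<union> arrays_of Q"
| "arrays_of (If p P Q) = arrays_of P \<union> arrays_of Q"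
| "arrays_of (While p P) = arrays_of P"

definition same_outside :: "prog \<Rightarrow> state \<Rightarrow> state \<Rightarrow> bool" where
  "same_outside c s s' \<longleftrightarrow> (\<forall>x. x \<notin> regs_of c \<longrightarrow> regs s' x = regs s x) \<and>
     (\<forall>X. X \<notin> arrays_of c \<longrightarrow> arrays s' X = arrays s X)"

lemma exec_same_outside: "exec c s t s' \<Longrightarrow> same_outside c s s'"
  by (induction rule: exec.induct) (auto simp: same_outside_def)

text \<open>Execution is deterministic, so one terminating run within the bound is a statement about
  the run. As \<open>t\<close> is only an upper bound, costs can be rounded up at every
  composition.\<close>

definition run :: "prog \<Rightarrow> state \<Rightarrow> nat \<Rightarrow> (state \<Rightarrow> bool) \<Rightarrow> bool" where
  "run c s t Q \<longleftrightarrow> (\<exists>t' s'. exec c s t' s' \<and> t' \<le> t \<and> Q s')"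

text \<open>The new postcondition receives the frame condition for free. This is how specifications
  can stay silent about everything that a program does not write.\<close>

lemma run_conseq:
  assumes "run c s t Q" "\<And>s'. Q s' \<Longrightarrow> same_outside c s s' \<Longrightarrow> R s'" "t \<le> u"
  shows "run c s u R"
  using assms exec_same_outside unfolding run_def by (meson order_trans)

lemma run_seq:
  assumes "run P s t (\<lambda>s'. run Q s' u R)"
  shows "run (P ;; Q) s (t + u) R"
  using assms unfolding run_def by (meson exec.Seq add_mono)

lemma run_seq_le:
  assumes "run P s t (\<lambda>s'. run Q s' u R)" "t + u \<le> v"
  shows "run (P ;; Q) s v R"
  using run_conseq[OF run_seq[OF assms(1)]] assms(2) by blast

text \<open>The index of the invariant is a variant: it bounds the number of remaining rounds, and a
  round may decrease it by more than one. The summand after the product pays for the last, failing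
  test.\<close>

lemma run_while:
  assumes step: "\<And>n s. I n s \<Longrightarrow> test_val p s \<Longrightarrow> \<exists>m<n. run c s t (I m)"
    and I: "I n s"
  shows "run (While p c) s (n * (1 + test_cost p + t) + 1 + test_cost p)
    (\<lambda>s'. \<not> test_val p s' \<and> (\<exists>m. I m s'))"
  using I
proof (induction n arbitrary: s rule: less_induct)
  case (less n)
  show ?case
  proof (cases "test_val p s")
    case True
    obtain m t1 s1 where m: "m < n" "exec c s t1 s1" "t1 \<le> t" "I m s1"
      using step[OF less.prems True] unfolding run_def by blast
    obtain t2 s2 where e: "exec (While p c) s1 t2 s2" "t2 \<le> m * (1 + test_cost p + t) + 1 + test_cost p"
      "\<not> test_val p s2" "\<exists>m. I m s2"
      using less.IH[OF m(1,4)] unfolding run_def by blast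
    have "Suc m * (1 + test_cost p + t) \<le> n * (1 + test_cost p + t)"
      using m(1) by (intro mult_le_mono1) simp
    then have "1 + test_cost p + t1 + t2 \<le> n * (1 + test_cost p + t) + 1 + test_cost p"
      using m(3) e(2) by simp
    then show ?thesis using exec.WhileTrue[OF True m(2) e(1)] e unfolding run_def by blast
  next
    case False
    then show ?thesis using exec.WhileFalse[OF False] less.prems unfolding run_def
      by (intro exI[of _ "1 + test_cost p"] exI[of _ s]) auto
  qed
qed

lemma same_outside_refl: "same_outside c s s"
  by (simp add: same_outside_def)

lemma same_outside_trans: "same_outside c s s' \<Longrightarrow> same_outside c s' s'' \<Longrightarrow> same_outside c s s''"
  by (simp add: same_outside_def)

text \<open>The frame condition relative to the entry of the loop is itself invariant. Conjoined
  with \<open>I\<close>, it leaves to \<open>I\<close> only what the body changes.\<close>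

lemma run_while_inv:
  assumes I: "I n s"
    and step: "\<And>n s'. I n s' \<Longrightarrow> test_val p s' \<Longrightarrow> same_outside c s s' \<Longrightarrow> \<exists>m<n. run c s' t (I m)"
    and exit: "\<And>m s'. I m s' \<Longrightarrow> \<not> test_val p s' \<Longrightarrow> same_outside c s s' \<Longrightarrow> Q s'"
    and T: "n * (1 + test_cost p + t) + 1 + test_cost p \<le> T"
  shows "run (While p c) s T Q"
proof -
  let ?I = "\<lambda>n s'. I n s' \<and> same_outside c s s'"
  have "\<exists>m<n. run c s' t (?I m)" if i: "?I n s'" and p: "test_val p s'" for n s'
  proof -
    obtain m where "m < n" "run c s' t (I m)" using step i p by blast
    moreover from this(2) have "run c s' t (?I m)"
      by (rule run_conseq) (use i same_outside_trans in blast)+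
    ultimately show ?thesis by blast
  qed
  from run_while[where I = ?I, OF this, of p n s] I
  have "run (While p c) s (n * (1 + test_cost p + t) + 1 + test_cost p)
    (\<lambda>s'. \<not> test_val p s' \<and> (\<exists>m. ?I m s'))"
    by (simp add: same_outside_refl)
  then show ?thesis by (rule run_conseq) (use exit T in blast)+
qed

text \<open>
  On loops, \<open>result\<close> and \<open>max_cost\<close> below have junk values.
\<close>

primrec loop_free :: "prog \<Rightarrow> bool" where
  "loop_free Skip = True"
| "loop_free (Assign x e) = True"
| "loop_free (Store X e e') = True"
| "loop_free (Seq P Q) = (loop_free P \<and> loop_free Q)"
| "loop_free (If p P Q) = (loop_free P \<and> loop_free Q)"
| "loop_free (While p P) = False"

primrec result :: "prog \<Rightarrow> state \<Rightarrow> state" where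
  "result Skip s = s"
| "result (Assign x e) s = s\<lparr>regs := (regs s)(x := exp_val e s)\<rparr>"
| "result (Store X e e') s = s\<lparr>arrays := (arrays s)(X := (arrays s X)(exp_val e s := exp_val e' s))\<rparr>"
| "result (Seq P Q) s = result Q (result P s)"
| "result (If p P Q) s = (if test_val p s then result P s else result Q s)"
| "result (While p P) s = s"

primrec max_cost :: "prog \<Rightarrow> nat" where
  "max_cost Skip = 1"
| "max_cost (Assign x e) = 1 + exp_cost e"
| "max_cost (Store X e e') = 1 + exp_cost e + exp_cost e'"
| "max_cost (Seq P Q) = max_cost P + max_cost Q"
| "max_cost (If p P Q) = 1 + test_cost p + max_cost P + max_cost Q"
| "max_cost (While p P) = 0"

lemma exec_loop_free: "loop_free c \<Longrightarrow> \<exists>t. exec c s t (result c s) \<and> t \<le> max_cost c"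
proof (induction c arbitrary: s)
  case (Seq P Q)
  then obtain t u where "exec P s t (result P s)" "t \<le> max_cost P"
    "exec Q (result P s) u (result Q (result P s))" "u \<le> max_cost Q" by fastforce
  then show ?case using exec.Seq by fastforce
next
  case (If p P Q)
  then obtain t u where "exec P s t (result P s)" "t \<le> max_cost P"
    "exec Q s u (result Q s)" "u \<le> max_cost Q" by fastforce
  then show ?case using exec.IfTrue[of p s P t "result P s" Q] exec.IfFalse[of p s Q u "result Q s" P]
    by (cases "test_val p s") fastforce+
qed (auto intro: exec.intros)

lemma run_loop_free:
  assumes "loop_free c" "Q (result c s)" "max_cost c \<le> t"
  shows "run c s t Q"
  using exec_loop_free[OF assms(1), of s] assms(2,3) unfolding run_def by (meson order_trans)

lemma run_loop_free_seq:
  assumes "loop_free c" "run P (result c s) u Q" "max_cost c + u \<le> t"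
  shows "run (c ;; P) s t Q"
  by (rule run_seq_le[where t = "max_cost c" and u = u], rule run_loop_free) (use assms in auto)

lemma run_if:
  assumes "test_val p s \<Longrightarrow> run P s t R" "\<not> test_val p s \<Longrightarrow> run Q s t R" "1 + test_cost p + t \<le> u"
  shows "run (If p P Q) s u R"
proof (cases "test_val p s")
  case True
  then obtain t' s' where "exec P s t' s'" "t' \<le> t" "R s'" using assms(1) unfolding run_def by blast
  then show ?thesis using exec.IfTrue[OF True] assms(3) unfolding run_def
    by (intro exI[of _ "1 + test_cost p + t'"] exI[of _ s']) auto
next
  case False
  then obtain t' s' where "exec Q s t' s'" "t' \<le> t" "R s'" using assms(2) unfolding run_def by blast
  then show ?thesis using exec.IfFalse[OF False] assms(3) unfolding run_def
    by (intro exI[of _ "1 + test_cost p + t'"] exI[of _ s']) auto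
qed


section \<open>Segment trees\<close>

text \<open>Halving must reach \<open>2 * 2 ^ L\<close>, the largest exclusive right end in
  \<open>decompose\<close>; the index after it comes along because the tables are filled in pairs.
  \<open>row u\<close> is the address of row \<open>u\<close> in a matrix of width
  \<open>2 * 2 ^ L\<close>, so a pair of nodes has a unique cell.\<close>

definition tables :: "nat \<Rightarrow> state \<Rightarrow> bool" where
  "tables L s \<longleftrightarrow> regs s ''z'' = 2 ^ L \<and>
     (\<forall>u. 0 \<le> u \<and> u \<le> 2 * 2 ^ L + 1 \<longrightarrow>
        arrays s ''half'' u = u div 2 \<and> arrays s ''row'' u = u * (2 * 2 ^ L))"

lemma tables_same_outside:
  "tables L s \<Longrightarrow> same_outside c s s' \<Longrightarrow> ''z'' \<notin> regs_of c \<Longrightarrow> ''half'' \<notin> arrays_of c \<Longrightarrow>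
    ''row'' \<notin> arrays_of c \<Longrightarrow> tables L s'"
  by (simp add: tables_def same_outside_def)

text \<open>
  Nodes are numbered as in a binary heap, so leaf \<open>x\<close> of the tree of height \<open>L\<close> is node \<open>2 ^ L + x\<close>.
\<close>

definition path :: "nat \<Rightarrow> int \<Rightarrow> int set" where
  "path L x = {u. 1 \<le> u \<and> (\<exists>k::nat. u = (2 ^ L + x) div 2 ^ k)}"

definition nodes :: "string \<Rightarrow> string \<Rightarrow> state \<Rightarrow> int set" where
  "nodes X m s = arrays s X ` {0..<regs s m}"

lemma ivl_Suc: "0 \<le> j \<Longrightarrow> {0..<j + 1} = insert j {0..<j}" for j :: int
  by auto

lemma div_div_2: "(a div 2 ^ k) div 2 = a div 2 ^ Suc k" for a :: int
  by (metis div_mult2_eq' power_Suc2 zero_le_numeral zdiv_zmult2_eq)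

lemma div_mult_le: "a div 2 ^ k * 2 ^ k \<le> a" for a :: int
proof -
  have "0 \<le> a mod 2 ^ k" by simp
  then show ?thesis using minus_mod_eq_div_mult[of a "2 ^ k"] by linarith
qed

lemma less_Suc_div_mult: "a < (a div 2 ^ k + 1) * 2 ^ k" for a :: int
proof -
  have "a mod 2 ^ k < 2 ^ k" by simp
  then show ?thesis using minus_mod_eq_div_mult[of a "2 ^ k"] unfolding distrib_right by linarith
qed

text \<open>The bounds on \<open>u * 2 ^ k\<close> say that \<open>u\<close> is a node
  \<open>k\<close> levels above the leaves. If \<open>u\<close> were reached from the leaf by a
  different number of halvings, the numbers below \<open>u\<close> after that many doublings would
  lie entirely beyond the leaves or entirely before them.\<close>

lemma path_level_unique:
  assumes "2 ^ L \<le> u * 2 ^ k" "u * 2 ^ k < 2 * 2 ^ L" "u \<in> path L x" "0 \<le> x" "x < 2 ^ L"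
  shows "u = (2 ^ L + x) div 2 ^ k"
proof -
  define y where "y = 2 ^ L + x"
  have y: "2 ^ L \<le> y" "y < 2 * 2 ^ L" using assms by (auto simp: y_def)
  obtain k' where k': "u = y div 2 ^ k'" and u: "1 \<le> u" using assms by (auto simp: path_def y_def)
  have le: "u * 2 ^ k' \<le> y" "y < (u + 1) * 2 ^ k'"
    using div_mult_le[of y k'] less_Suc_div_mult[of y k'] k' by simp_all
  have "\<not> k < k'"
  proof
    assume "k < k'"
    then have "(2::int) ^ Suc k \<le> 2 ^ k'" by (intro power_increasing) auto
    then have "u * 2 ^ Suc k \<le> u * 2 ^ k'" using u by (intro mult_left_mono) auto
    then show False using assms(1) le y by simp
  qed
  moreover have "\<not> k' < k"
  proof
    assume "k' < k"
    then have "(2::int) ^ Suc k' \<le> 2 ^ k" by (intro power_increasing) auto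
    then have "u * 2 ^ Suc k' \<le> u * 2 ^ k" using u by (intro mult_left_mono) auto
    then have lt: "u * 2 ^ k' < 2 ^ L" using assms(2) by simp
    have "1 * 2 ^ k' \<le> u * 2 ^ k'" using u by (intro mult_right_mono) auto
    then have "(2::int) ^ k' < 2 ^ L" using lt by linarith
    then have "k' < L" by simp
    \<comment> \<open>Both \<open>u * 2 ^ k'\<close> and \<open>2 ^ L\<close> are multiples of
      \<open>2 ^ k'\<close>, so the strict inequality between them leaves room for a whole further
      block.\<close>
    then have e: "(2::int) ^ L = 2 ^ (L - k') * 2 ^ k'" by (simp flip: power_add)
    then have "u < 2 ^ (L - k')" using lt by simp
    then have "(u + 1) * 2 ^ k' \<le> 2 ^ (L - k') * 2 ^ k'" by (intro mult_right_mono) auto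
    then show False using e le y by linarith
  qed
  ultimately have "k = k'" by simp
  then show ?thesis using k' by (simp add: y_def)
qed

lemma path_bounds:
  assumes "0 \<le> x" "x < 2 ^ L" "u \<in> path L x" shows "1 \<le> u" "u < 2 * 2 ^ L"
proof -
  obtain k where k: "u = (2 ^ L + x) div 2 ^ k" "1 \<le> u" using assms by (auto simp: path_def)
  then show "1 \<le> u" by simp
  have "u * 1 \<le> u * 2 ^ k" using k by (intro mult_left_mono) auto
  also have "\<dots> \<le> 2 ^ L + x"
    using div_mult_le k by simp
  finally show "u < 2 * 2 ^ L" using assms by simp
qed

section \<open>Ancestors of a leaf and decomposition of an interval\<close>

definition ancestors :: "string \<Rightarrow> string \<Rightarrow> prog" where
  "ancestors X m =
     Assign m (Const 0) ;;
     While (Less (Const 0) (Reg ''u''))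
       (Store X (Reg m) (Reg ''u'') ;;
        Assign m (Plus (Reg m) (Const 1)) ;;
        Assign ''u'' (Load ''half'' (Reg ''u'')))"

lemma run_ancestors:
  assumes T: "tables L s" and u: "regs s ''u'' = 2 ^ L + x" and x: "0 \<le> x" "x < 2 ^ L"
    and m: "m \<notin> {''u'', ''z''}" and X: "X \<notin> {''half'', ''row''}"
  shows "run (ancestors X m) s (20 * (L + 2))
    (\<lambda>s'. nodes X m s' = path L x \<and> 0 \<le> regs s' m \<and> regs s' m \<le> int L + 1)"
proof -
  have m': "''u'' \<noteq> m" "''z'' \<noteq> m" "m \<noteq> ''u''" "m \<noteq> ''z''" using m by auto
  have X': "''half'' \<noteq> X" "''row'' \<noteq> X" "X \<noteq> ''half''" "X \<noteq> ''row''" using X by auto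
  \<comment> \<open>The bound \<open>2 ^ n\<close> on the current node makes \<open>n\<close> the
    number of halvings after which it has passed the root and become 0.\<close>
  define I where "I n s' \<longleftrightarrow> (\<exists>k. regs s' m = int k \<and> k + n = L + 1 \<and>
     regs s' ''u'' = (2 ^ L + x) div 2 ^ k \<and> regs s' ''u'' < 2 ^ n \<and>
     (\<forall>j<k. arrays s' X (int j) = (2 ^ L + x) div 2 ^ j \<and> 0 < arrays s' X (int j)) \<and> tables L s')" for n s'
  show ?thesis
    unfolding ancestors_def
  proof (rule run_loop_free_seq, simp, rule run_while_inv[where I = I and n = "L + 1" and t = 11])
    show "I (L + 1) (result (Assign m (Const 0)) s)"
      using T u x m' by (simp add: I_def tables_def)
  next
    fix n s'
    assume i: "I n s'" and t: "test_val (Less (Const 0) (Reg ''u'')) s'"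
    then obtain k where k: "regs s' m = int k" "k + n = L + 1" "regs s' ''u'' = (2 ^ L + x) div 2 ^ k"
      "regs s' ''u'' < 2 ^ n" "\<And>j. j < k \<Longrightarrow> arrays s' X (int j) = (2 ^ L + x) div 2 ^ j"
      "\<And>j. j < k \<Longrightarrow> 0 < arrays s' X (int j)" "tables L s'"
      using i unfolding I_def by blast
    let ?u = "regs s' ''u''"
    have u0: "0 < ?u" using t by simp
    obtain n' where n': "n = Suc n'" using k(4) u0 by (cases n) auto
    have "(2::int) ^ n \<le> 2 ^ (L + 1)" using k(2) by (intro power_increasing) auto
    then have half: "arrays s' ''half'' ?u = ?u div 2"
      using k(7,4) u0 by (auto simp: tables_def)
    show "\<exists>na<n. run (Store X (Reg m) (Reg ''u'') ;; Assign m (Plus (Reg m) (Const 1)) ;;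
      Assign ''u'' (Load ''half'' (Reg ''u''))) s' 11 (I na)"
    proof (intro exI[of _ n'] conjI run_loop_free)
      show "I n' (result (Store X (Reg m) (Reg ''u'') ;; Assign m (Plus (Reg m) (Const 1)) ;;
        Assign ''u'' (Load ''half'' (Reg ''u''))) s')"
        unfolding I_def
        using k n' m' X' half u0 div_div_2[of "2 ^ L + x" k]
        by (intro exI[of _ "Suc k"]) (auto simp: less_Suc_eq tables_def)
    qed (use n' in auto)
  next
    fix n s'
    assume i: "I n s'" and t: "\<not> test_val (Less (Const 0) (Reg ''u'')) s'"
    then obtain k where k: "regs s' m = int k" "k + n = L + 1" "regs s' ''u'' = (2 ^ L + x) div 2 ^ k"
      "\<And>j. j < k \<Longrightarrow> arrays s' X (int j) = (2 ^ L + x) div 2 ^ j"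
      "\<And>j. j < k \<Longrightarrow> 0 < arrays s' X (int j)"
      using i unfolding I_def by blast
    have z: "(2 ^ L + x) div 2 ^ k \<le> 0" using t k by simp
    have z': "(2 ^ L + x) div 2 ^ j \<le> 0" if "k \<le> j" for j
    proof -
      have "(2 ^ L + x) div 2 ^ j \<le> (2 ^ L + x) div 2 ^ k"
        using x that by (intro zdiv_mono2) (auto intro: power_increasing)
      then show ?thesis using z by simp
    qed
    have "nodes X m s' = (\<lambda>j. (2 ^ L + x) div 2 ^ j) ` {..<k}"
    proof -
      have "{0..<int k} = int ` {..<k}" by (simp add: image_atLeastZeroLessThan_int)
      then show ?thesis unfolding nodes_def k(1) image_image using k(4) by (simp add: image_image cong: image_cong_simp)
    qed
    also have "\<dots> = path L x"
    proof (intro set_eqI iffI)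
      fix u assume "u \<in> (\<lambda>j. (2 ^ L + x) div 2 ^ j) ` {..<k}"
      then obtain j where j: "j < k" "u = (2 ^ L + x) div 2 ^ j" by blast
      then have "1 \<le> u" using k(4,5)[of j] by simp
      then show "u \<in> path L x" using j unfolding path_def by blast
    next
      fix u assume "u \<in> path L x"
      then obtain j where j: "1 \<le> u" "u = (2 ^ L + x) div 2 ^ j" unfolding path_def by blast
      then have "j < k" using z'[of j] by force
      then show "u \<in> (\<lambda>j. (2 ^ L + x) div 2 ^ j) ` {..<k}" using j by blast
    qed
    finally show "nodes X m s' = path L x \<and> 0 \<le> regs s' m \<and> regs s' m \<le> int L + 1"
      using k by simp
  qed (rule order_refl, simp)
qed

text \<open>The bottom-up decomposition of a half-open interval of leaves. An odd \<open>l\<close>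
  is a right child whose sibling is outside, so it is taken by itself; for odd \<open>r\<close> the
  same holds for the left child \<open>r - 1\<close>. Comparing twice the half with the number is
  the parity test available without division.\<close>

definition decompose :: "string \<Rightarrow> string \<Rightarrow> prog" where
  "decompose X m =
     Assign m (Const 0) ;;
     While (Less (Reg ''l'') (Reg ''r''))
       (If (Less (Plus (Load ''half'' (Reg ''l'')) (Load ''half'' (Reg ''l''))) (Reg ''l''))
          (Store X (Reg m) (Reg ''l'') ;;
           Assign m (Plus (Reg m) (Const 1)) ;;
           Assign ''l'' (Plus (Reg ''l'') (Const 1)))
          Skip ;;
        If (Less (Plus (Load ''half'' (Reg ''r'')) (Load ''half'' (Reg ''r''))) (Reg ''r''))
          (Assign ''r'' (Minus (Reg ''r'') (Const 1)) ;;
           Store X (Reg m) (Reg ''r'') ;;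
           Assign m (Plus (Reg m) (Const 1)))
          Skip ;;
        Assign ''l'' (Load ''half'' (Reg ''l'')) ;;
        Assign ''r'' (Load ''half'' (Reg ''r'')))"

text \<open>The formula only asks whether a collected node lies above a leaf, not how many do:
  reading a value twice does not change a maximum.\<close>

definition covers :: "nat \<Rightarrow> int set \<Rightarrow> int \<Rightarrow> int \<Rightarrow> bool" where
  "covers L U p q \<longleftrightarrow> U \<subseteq> {1..<2 * 2 ^ L} \<and>
     (\<forall>x. 0 \<le> x \<and> x < 2 ^ L \<longrightarrow> (U \<inter> path L x \<noteq> {} \<longleftrightarrow> p \<le> x \<and> x < q))"

lemma run_decompose:
  assumes T: "tables L s" and l: "regs s ''l'' = 2 ^ L + p" and r: "regs s ''r'' = 2 ^ L + q"
    and p: "0 \<le> p" "p < 2 ^ L" and q: "0 \<le> q" "q \<le> 2 ^ L"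
    and m: "m \<notin> {''l'', ''r'', ''z''}" and X: "X \<notin> {''half'', ''row''}"
  shows "run (decompose X m) s (70 * (L + 2))
    (\<lambda>s'. covers L (nodes X m s') p q \<and> 0 \<le> regs s' m \<and> regs s' m \<le> 2 * (int L + 1))"
proof -
  have m': "''l'' \<noteq> m" "''r'' \<noteq> m" "''z'' \<noteq> m" "m \<noteq> ''l''" "m \<noteq> ''r''" "m \<noteq> ''z''" using m by auto
  have X': "''half'' \<noteq> X" "''row'' \<noteq> X" "X \<noteq> ''half''" "X \<noteq> ''row''" using X by auto
  \<comment> \<open>A leaf is in the interval iff a collected node lies above it or its ancestor on
    the current level \<open>k\<close> is still in the range from \<open>l\<close> to
    \<open>r\<close>. The first two conjuncts keep that range within level \<open>k\<close>, as
    \<open>path_level_unique\<close> requires.\<close>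
  define J where "J U k l r \<longleftrightarrow> 2 ^ L \<le> l * 2 ^ k \<and> r * 2 ^ k \<le> 2 * 2 ^ L \<and> U \<subseteq> {1..<2 * 2 ^ L} \<and> (\<forall>x. 0 \<le> x \<and> x < 2 ^ L \<longrightarrow>
     (p \<le> x \<and> x < q \<longleftrightarrow> U \<inter> path L x \<noteq> {} \<or> l \<le> (2 ^ L + x) div 2 ^ k \<and> (2 ^ L + x) div 2 ^ k < r))"
     for U k l r
  \<comment> \<open>Each round stores at most two nodes. When \<open>n\<close> is 0, the bounds give
    \<open>r \<le> 1 \<le> l\<close>, so the loop must have ended.\<close>
  define I where "I n s' \<longleftrightarrow> (\<exists>k. J (nodes X m s') k (regs s' ''l'') (regs s' ''r'')) \<and>
     0 \<le> regs s' m \<and> regs s' m + 2 * int n \<le> 2 * (int L + 1) \<and> tables L s' \<and>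
     1 \<le> regs s' ''l'' \<and> regs s' ''r'' \<le> 2 ^ n" for n s'
  have step: "J (U \<union> (if l div 2 + l div 2 < l then {l} else {}) \<union> (if r div 2 + r div 2 < r then {r - 1} else {}))
      (Suc k) ((if l div 2 + l div 2 < l then l + 1 else l) div 2) ((if r div 2 + r div 2 < r then r - 1 else r) div 2)"
      (is "J ?U _ ?l ?r")
    if J: "J U k l r" and lr: "1 \<le> l" "l < r" "r \<le> 2 * 2 ^ L" for U k l r
    unfolding J_def
  proof (intro conjI allI impI)
    show "?U \<subseteq> {1..<2 * 2 ^ L}" using J lr unfolding J_def by auto
    have "l \<le> ?l * 2" "?r * 2 \<le> r" by auto
    then have "l * 2 ^ k \<le> ?l * 2 * 2 ^ k" "?r * 2 * 2 ^ k \<le> r * 2 ^ k"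
      by (intro mult_right_mono; simp)+
    then show "2 ^ L \<le> ?l * 2 ^ Suc k" "?r * 2 ^ Suc k \<le> 2 * 2 ^ L"
      using J unfolding J_def by (simp_all only: power_Suc mult.assoc) linarith+
  next
    fix x :: int assume x: "0 \<le> x \<and> x < 2 ^ L"
    define h where "h = (2 ^ L + x) div 2 ^ k"
    have h: "(2 ^ L + x) div 2 ^ Suc k = h div 2" using div_div_2 by (simp add: h_def)
    \<comment> \<open>After the odd ends have been split off, the range consists of complete sibling
      pairs, so membership can be tested at the parent.\<close>
    have eq: "l \<le> h \<and> h < r \<longleftrightarrow> l div 2 + l div 2 < l \<and> h = l \<or> r div 2 + r div 2 < r \<and> h = r - 1
      \<or> ?l \<le> h div 2 \<and> h div 2 < ?r"
      using lr by (cases "even l"; cases "even r") (auto elim!: evenE oddE)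
    have path: "h \<in> path L x" if "1 \<le> h" using that h_def by (auto simp: path_def)
    show "p \<le> x \<and> x < q \<longleftrightarrow> ?U \<inter> path L x \<noteq> {} \<or>
      ?l \<le> (2 ^ L + x) div 2 ^ Suc k \<and> (2 ^ L + x) div 2 ^ Suc k < ?r" (is "?in \<longleftrightarrow> _")
    proof -
      have old: "?in \<longleftrightarrow> U \<inter> path L x \<noteq> {} \<or> l \<le> h \<and> h < r"
        using J x unfolding J_def h_def by blast
      \<comment> \<open>Within the range, the only node above the leaf is its ancestor on level
        \<open>k\<close>; thus adding an end to \<open>U\<close> accounts for exactly the leaves
        below that end.\<close>
      have "u \<in> path L x \<longleftrightarrow> h = u" if u: "l \<le> u" "u < r" for u
      proof
        assume "u \<in> path L x"
        moreover have "l * 2 ^ k \<le> u * 2 ^ k" "u * 2 ^ k < r * 2 ^ k"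
          using u by simp_all
        ultimately show "h = u"
          using path_level_unique[of L u k x] J x unfolding J_def h_def by linarith
      qed (use path u lr in auto)
      then have "l \<in> path L x \<longleftrightarrow> h = l" "r - 1 \<in> path L x \<longleftrightarrow> h = r - 1" using lr by auto
      then show ?thesis unfolding old eq h by (auto split: if_splits)
    qed
  qed
  show ?thesis
    unfolding decompose_def
  proof (rule run_loop_free_seq, simp, rule run_while_inv[where I = I and n = "L + 1" and t = 60])
    show "I (L + 1) (result (Assign m (Const 0)) s)"
      using T l r p q m' unfolding I_def
      by (auto simp: J_def nodes_def tables_def intro!: exI[of _ 0])
  next
    fix n s'
    assume i: "I n s'" and t: "test_val (Less (Reg ''l'') (Reg ''r'')) s'"
    let ?c = "If (Less (Plus (Load ''half'' (Reg ''l'')) (Load ''half'' (Reg ''l''))) (Reg ''l''))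
          (Store X (Reg m) (Reg ''l'') ;;
           Assign m (Plus (Reg m) (Const 1)) ;;
           Assign ''l'' (Plus (Reg ''l'') (Const 1)))
          Skip ;;
        If (Less (Plus (Load ''half'' (Reg ''r'')) (Load ''half'' (Reg ''r''))) (Reg ''r''))
          (Assign ''r'' (Minus (Reg ''r'') (Const 1)) ;;
           Store X (Reg m) (Reg ''r'') ;;
           Assign m (Plus (Reg m) (Const 1)))
          Skip ;;
        Assign ''l'' (Load ''half'' (Reg ''l'')) ;;
        Assign ''r'' (Load ''half'' (Reg ''r''))"
    obtain k where k: "J (nodes X m s') k (regs s' ''l'') (regs s' ''r'')"
      "0 \<le> regs s' m" "regs s' m + 2 * int n \<le> 2 * (int L + 1)" "tables L s'"
      "1 \<le> regs s' ''l''" "regs s' ''r'' \<le> 2 ^ n"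
      using i by (auto simp: I_def)
    have lr: "regs s' ''l'' < regs s' ''r''" using t by simp
    obtain n' where n': "n = Suc n'" using k(5,6) lr by (cases n) auto
    have "(2::int) ^ n \<le> 2 ^ (L + 1)" using k(2,3) by (intro power_increasing) auto
    then have r: "regs s' ''r'' \<le> 2 * 2 ^ L" using k by simp
    have half: "arrays s' ''half'' u = u div 2" if "0 \<le> u" "u \<le> 2 * 2 ^ L + 1" for u
      using k(4) that by (simp add: tables_def)
    show "\<exists>na<n. run ?c s' 60 (I na)"
    proof (intro exI[of _ n'] conjI run_loop_free)
      show "n' < n" using n' by simp
      let ?s = "result ?c s'"
      let ?l = "regs s' ''l''" and ?r = "regs s' ''r''"
      have "nodes X m ?s = nodes X m s' \<union> (if ?l div 2 + ?l div 2 < ?l then {?l} else {}) \<union>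
        (if ?r div 2 + ?r div 2 < ?r then {?r - 1} else {})"
      proof -
        have "{0..<regs s' m + 1} \<inter> {x. x \<noteq> regs s' m} = {0..<regs s' m}"
          "{0..<2 + regs s' m} \<inter> {x. x \<noteq> regs s' m + 1} \<inter> {x. x \<noteq> regs s' m} = {0..<regs s' m}"
          by auto
        then show ?thesis
          using k(2,5) m' X' half r lr by (simp add: nodes_def insert_commute)
      qed
      moreover have "regs ?s ''l'' = (if ?l div 2 + ?l div 2 < ?l then ?l + 1 else ?l) div 2"
        "regs ?s ''r'' = (if ?r div 2 + ?r div 2 < ?r then ?r - 1 else ?r) div 2"
        using k(5) m' X' half r lr by auto
      ultimately have "J (nodes X m ?s) (Suc k) (regs ?s ''l'') (regs ?s ''r'')"
        using step[OF k(1,5) lr r] by (simp only:)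
      moreover have "0 \<le> regs ?s m" "regs ?s m + 2 * int n' \<le> 2 * (int L + 1)"
        using k m' X' half r lr n' by auto
      moreover have "tables L ?s" using k(4) m' X' by (auto simp: tables_def)
      moreover have "1 \<le> regs ?s ''l''" "regs ?s ''r'' \<le> 2 ^ n'"
        using k(5,6) m' X' half r lr n' by auto
      ultimately show "I n' ?s" unfolding I_def by blast
    qed simp_all
  next
    fix n s'
    assume i: "I n s'" and t: "\<not> test_val (Less (Reg ''l'') (Reg ''r'')) s'"
    then show "covers L (nodes X m s') p q \<and> 0 \<le> regs s' m \<and> regs s' m \<le> 2 * (int L + 1)"
      by (auto simp: covers_def I_def J_def)
  qed (rule order_refl, simp)
qed

section \<open>Raising and reading the cells of pairs of nodes\<close>

lemma is_max0_empty [simp]: "is_max0 {} q \<longleftrightarrow> q = 0"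
  by (auto simp: is_max0_def)

lemma is_max0_insert: "is_max0 V q \<Longrightarrow> is_max0 (insert a V) (max q a)"
  by (auto simp: is_max0_def max_def)

definition raise :: "(int \<Rightarrow> int) \<Rightarrow> int set \<Rightarrow> int \<Rightarrow> int \<Rightarrow> int" where
  "raise F B w = (\<lambda>a. if a \<in> B then max (F a) w else F a)"

lemma raise_raise: "raise (raise F A w) B w = raise F (A \<union> B) w"
  by (auto simp: raise_def)

lemma raise_empty [simp]: "raise F {} w = F"
  by (simp add: raise_def)

definition cells :: "(int \<Rightarrow> int) \<Rightarrow> int set \<Rightarrow> int set \<Rightarrow> int set" where
  "cells R U V = (\<lambda>(u, v). R u + v) ` (U \<times> V)"

lemma cells_empty [simp]: "cells R {} V = {}"
  by (simp add: cells_def)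

lemma cells_insert: "cells R (insert u U) V = cells R U V \<union> (+) (R u) ` V"
  by (auto simp: cells_def)

definition update :: "string \<Rightarrow> prog" where
  "update X =
     Assign ''i'' (Const 0) ;;
     While (Less (Reg ''i'') (Reg ''mp''))
       (Assign ''base'' (Load ''row'' (Load ''P'' (Reg ''i''))) ;;
        Assign ''j'' (Const 0) ;;
        While (Less (Reg ''j'') (Reg ''mq''))
          (Assign ''k'' (Plus (Reg ''base'') (Load ''Q'' (Reg ''j''))) ;;
           If (Less (Load X (Reg ''k'')) (Reg ''v'')) (Store X (Reg ''k'') (Reg ''v'')) Skip ;;
           Assign ''j'' (Plus (Reg ''j'') (Const 1))) ;;
        Assign ''i'' (Plus (Reg ''i'') (Const 1)))"

text \<open>Raising two sets of cells to the same value amounts to raising their union. Both loops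
  can therefore describe their effect as one \<open>raise\<close> of the original array over the
  cells visited so far, in any order and with repetitions.\<close>

lemma run_update:
  assumes p: "0 \<le> regs s ''mp''" "regs s ''mp'' \<le> 2 * (int L + 1)"
    and q: "0 \<le> regs s ''mq''" "regs s ''mq'' \<le> 2 * (int L + 1)"
    and X: "X \<notin> {''P'', ''Q'', ''row''}"
  shows "run (update X) s (400 * (L + 2) * (L + 2))
    (\<lambda>s'. arrays s' X = raise (arrays s X)
       (cells (arrays s ''row'') (nodes ''P'' ''mp'' s) (nodes ''Q'' ''mq'' s)) (regs s ''v''))"
proof -
  have X': "X \<noteq> ''P''" "X \<noteq> ''Q''" "X \<noteq> ''row''" "''P'' \<noteq> X" "''Q'' \<noteq> X" "''row'' \<noteq> X"
    using X by auto
  let ?in = "Assign ''k'' (Plus (Reg ''base'') (Load ''Q'' (Reg ''j''))) ;;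
           If (Less (Load X (Reg ''k'')) (Reg ''v'')) (Store X (Reg ''k'') (Reg ''v'')) Skip ;;
           Assign ''j'' (Plus (Reg ''j'') (Const 1))"
  let ?F = "arrays s X" and ?R = "arrays s ''row''" and ?P = "arrays s ''P''" and ?Q = "arrays s ''Q''"
    and ?v = "regs s ''v''" and ?mp = "regs s ''mp''" and ?mq = "regs s ''mq''"
  define M where "M = 2 * (L + 1)"
  have mp: "nat ?mp \<le> M" and mq: "nat ?mq \<le> M" using p q by (auto simp: M_def)
  define c where "c = ?in"
  have inner: "run (While (Less (Reg ''j'') (Reg ''mq'')) c) s1 (M * 25 + 4)
    (\<lambda>s'. arrays s' X = raise (arrays s1 X) ((+) (regs s1 ''base'') ` (?Q ` {0..<?mq})) ?v)"
    if s1: "regs s1 ''j'' = 0" "regs s1 ''mq'' = ?mq" "arrays s1 ''Q'' = ?Q" "regs s1 ''v'' = ?v" for s1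
  proof (rule run_while_inv[where t = 20 and n = "nat ?mq" and I = "\<lambda>n s'. regs s' ''j'' + int n = ?mq \<and>
      0 \<le> regs s' ''j'' \<and>
      arrays s' X = raise (arrays s1 X) ((+) (regs s1 ''base'') ` (?Q ` {0..<regs s' ''j''})) ?v"])
    fix n s'
    assume i: "regs s' ''j'' + int n = ?mq \<and> 0 \<le> regs s' ''j'' \<and>
      arrays s' X = raise (arrays s1 X) ((+) (regs s1 ''base'') ` (?Q ` {0..<regs s' ''j''})) ?v"
      and t: "test_val (Less (Reg ''j'') (Reg ''mq'')) s'" and o: "same_outside c s1 s'"
    show "\<exists>m<n. run c s' 20 (\<lambda>s'. regs s' ''j'' + int m = ?mq \<and> 0 \<le> regs s' ''j'' \<and>
      arrays s' X = raise (arrays s1 X) ((+) (regs s1 ''base'') ` (?Q ` {0..<regs s' ''j''})) ?v)"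
    proof (intro exI[of _ "n - 1"] conjI run_loop_free)
      have o': "regs s' ''base'' = regs s1 ''base''" "regs s' ''mq'' = ?mq" "arrays s' ''Q'' = ?Q" "regs s' ''v'' = ?v"
        using o s1 X' by (auto simp: same_outside_def c_def)
      show "n - 1 < n" using i t o' by auto
      have j: "regs (result c s') ''j'' = regs s' ''j'' + 1" by (simp add: c_def)
      show "regs (result c s') ''j'' + int (n - 1) = ?mq" "0 \<le> regs (result c s') ''j''"
        using i t o' unfolding j by auto
      have "arrays (result c s') X = raise (arrays s' X) {regs s1 ''base'' + ?Q (regs s' ''j'')} ?v"
        using o' X' by (simp add: c_def raise_def fun_eq_iff max_def)
      also have "\<dots> = raise (arrays s1 X) ((+) (regs s1 ''base'') ` ?Q ` {0..<regs s' ''j'' + 1}) ?v"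
        using i by (simp add: raise_raise ivl_Suc)
      finally show "arrays (result c s') X =
        raise (arrays s1 X) ((+) (regs s1 ''base'') ` ?Q ` {0..<regs (result c s') ''j''}) ?v"
        unfolding j .
    qed (simp_all add: c_def)
  next
    fix n s'
    assume i: "regs s' ''j'' + int n = ?mq \<and> 0 \<le> regs s' ''j'' \<and>
      arrays s' X = raise (arrays s1 X) ((+) (regs s1 ''base'') ` (?Q ` {0..<regs s' ''j''})) ?v"
      and t: "\<not> test_val (Less (Reg ''j'') (Reg ''mq'')) s'" and o: "same_outside c s1 s'"
    have "regs s' ''mq'' = ?mq" using o s1 by (simp add: same_outside_def c_def)
    then have "regs s' ''j'' = ?mq" using i t by simp
    then show "arrays s' X = raise (arrays s1 X) ((+) (regs s1 ''base'') ` (?Q ` {0..<?mq})) ?v"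
      using i by simp
  qed (use s1 q mq in simp_all)
  define d where "d = Assign ''base'' (Load ''row'' (Load ''P'' (Reg ''i''))) ;;
        Assign ''j'' (Const 0) ;;
        While (Less (Reg ''j'') (Reg ''mq'')) c ;;
        Assign ''i'' (Plus (Reg ''i'') (Const 1))"
  define I where "I n s' \<longleftrightarrow> regs s' ''i'' + int n = ?mp \<and> 0 \<le> regs s' ''i'' \<and>
    arrays s' X = raise ?F (cells ?R (?P ` {0..<regs s' ''i''}) (?Q ` {0..<?mq})) ?v" for n and s' :: state
  show ?thesis
    unfolding update_def c_def[symmetric] d_def[symmetric]
  proof (rule run_loop_free_seq, simp, rule run_while_inv[where I = I and n = "nat ?mp" and t = "M * 25 + 20"])
    fix n s'
    assume i: "I n s'" and t: "test_val (Less (Reg ''i'') (Reg ''mp'')) s'"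
      and o: "same_outside d (result (Assign ''i'' (Const 0)) s) s'"
    have o': "regs s' ''mp'' = ?mp" "regs s' ''mq'' = ?mq" "regs s' ''v'' = ?v"
      "arrays s' ''P'' = ?P" "arrays s' ''Q'' = ?Q" "arrays s' ''row'' = ?R"
      using o X' by (auto simp: same_outside_def d_def c_def)
    have "run d s' (M * 25 + 20) (I (n - 1))"
      unfolding d_def
    proof (rule run_loop_free_seq, simp, rule run_loop_free_seq, simp,
        rule run_seq_le, rule run_conseq[OF inner _ order_refl])
      fix s2
      let ?s1 = "result (Assign ''j'' (Const 0)) (result (Assign ''base'' (Load ''row'' (Load ''P'' (Reg ''i'')))) s')"
      assume a: "arrays s2 X = raise (arrays ?s1 X) ((+) (regs ?s1 ''base'') ` ?Q ` {0..<?mq}) ?v"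
        and o2: "same_outside (While (Less (Reg ''j'') (Reg ''mq'')) c) ?s1 s2"
      have "regs s2 ''i'' = regs s' ''i''" using o2 by (simp add: same_outside_def c_def)
      then show "run (Assign ''i'' (Plus (Reg ''i'') (Const 1))) s2 4 (I (n - 1))"
        using i t a o' X' unfolding I_def
        by (intro run_loop_free) (simp_all add: ivl_Suc cells_insert raise_raise)
    qed (use o' in auto)
    then show "\<exists>m<n. run d s' (M * 25 + 20) (I m)"
      using i t o' unfolding I_def by (intro exI[of _ "n - 1"]) auto
  next
    show "I (nat ?mp) (result (Assign ''i'' (Const 0)) s)"
      using p by (simp add: I_def raise_def)
  next
    fix n s'
    assume i: "I n s'" and t: "\<not> test_val (Less (Reg ''i'') (Reg ''mp'')) s'"
      and o: "same_outside d (result (Assign ''i'' (Const 0)) s) s'"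
    then show "arrays s' X = raise ?F (cells ?R (nodes ''P'' ''mp'' s) (nodes ''Q'' ''mq'' s)) ?v"
    proof -
      have "regs s' ''mp'' = ?mp" using o by (simp add: same_outside_def d_def c_def)
      then have "regs s' ''i'' = ?mp" using i t by (simp add: I_def)
      then show ?thesis using i by (simp add: I_def nodes_def)
    qed
  next
    show "max_cost (Assign ''i'' (Const 0)) + (M * (M * 25 + 24) + 4) \<le> 400 * (L + 2) * (L + 2)"
      by (simp add: M_def algebra_simps)
  next
    have "nat ?mp * (24 + M * 25) \<le> M * (M * 25 + 24)" using mp by (intro mult_le_mono) simp_all
    then show "nat ?mp * (1 + test_cost (Less (Reg ''i'') (Reg ''mp'')) + (M * 25 + 20)) + 1 +
      test_cost (Less (Reg ''i'') (Reg ''mp'')) \<le> M * (M * 25 + 24) + 4" by simp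
  qed
qed

definition lookup :: "string \<Rightarrow> prog" where
  "lookup X =
     Assign ''q'' (Const 0) ;;
     Assign ''i'' (Const 0) ;;
     While (Less (Reg ''i'') (Reg ''mp''))
       (Assign ''base'' (Load ''row'' (Load ''P'' (Reg ''i''))) ;;
        Assign ''j'' (Const 0) ;;
        While (Less (Reg ''j'') (Reg ''mq''))
          (Assign ''k'' (Plus (Reg ''base'') (Load ''Q'' (Reg ''j''))) ;;
           If (Less (Reg ''q'') (Load X (Reg ''k''))) (Assign ''q'' (Load X (Reg ''k''))) Skip ;;
           Assign ''j'' (Plus (Reg ''j'') (Const 1))) ;;
        Assign ''i'' (Plus (Reg ''i'') (Const 1)))"

lemma run_lookup:
  assumes p: "0 \<le> regs s ''mp''" "regs s ''mp'' \<le> 2 * (int L + 1)"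
    and q: "0 \<le> regs s ''mq''" "regs s ''mq'' \<le> 2 * (int L + 1)"
  shows "run (lookup X) s (400 * (L + 2) * (L + 2))
    (\<lambda>s'. is_max0 (arrays s X ` cells (arrays s ''row'') (nodes ''P'' ''mp'' s) (nodes ''Q'' ''mq'' s))
       (regs s' ''q''))"
proof -
  let ?F = "arrays s X" and ?R = "arrays s ''row''" and ?P = "arrays s ''P''" and ?Q = "arrays s ''Q''"
    and ?mp = "regs s ''mp''" and ?mq = "regs s ''mq''"
  define M where "M = 2 * (L + 1)"
  have mp: "nat ?mp \<le> M" and mq: "nat ?mq \<le> M" using p q by (auto simp: M_def)
  define c where "c = Assign ''k'' (Plus (Reg ''base'') (Load ''Q'' (Reg ''j''))) ;;
           If (Less (Reg ''q'') (Load X (Reg ''k''))) (Assign ''q'' (Load X (Reg ''k''))) Skip ;;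
           Assign ''j'' (Plus (Reg ''j'') (Const 1))"
  \<comment> \<open>The register \<open>q\<close> is not reset between rows. The set
    \<open>V\<close> stands for the values seen in earlier rows, so that the outer loop can reuse
    this fact.\<close>
  have inner: "run (While (Less (Reg ''j'') (Reg ''mq'')) c) s1 (M * 25 + 4)
    (\<lambda>s'. is_max0 (V \<union> ?F ` (+) (regs s1 ''base'') ` ?Q ` {0..<?mq}) (regs s' ''q''))"
    if s1: "regs s1 ''j'' = 0" "regs s1 ''mq'' = ?mq" "arrays s1 = arrays s" "is_max0 V (regs s1 ''q'')" for s1 V
  proof (rule run_while_inv[where t = 20 and n = "nat ?mq" and I = "\<lambda>n s'. regs s' ''j'' + int n = ?mq \<and>
      0 \<le> regs s' ''j'' \<and>
      is_max0 (V \<union> ?F ` (+) (regs s1 ''base'') ` ?Q ` {0..<regs s' ''j''}) (regs s' ''q'')"])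
    fix n s'
    assume i: "regs s' ''j'' + int n = ?mq \<and> 0 \<le> regs s' ''j'' \<and>
      is_max0 (V \<union> ?F ` (+) (regs s1 ''base'') ` ?Q ` {0..<regs s' ''j''}) (regs s' ''q'')"
      and t: "test_val (Less (Reg ''j'') (Reg ''mq'')) s'" and o: "same_outside c s1 s'"
    have o': "arrays s' = arrays s" "regs s' ''base'' = regs s1 ''base''" "regs s' ''mq'' = ?mq"
      using o s1 by (auto simp: same_outside_def c_def)
    have m: "is_max0 (insert (?F (regs s1 ''base'' + ?Q (regs s' ''j'')))
        (V \<union> ?F ` (+) (regs s1 ''base'') ` ?Q ` {0..<regs s' ''j''}))
      (max (regs s' ''q'') (?F (regs s1 ''base'' + ?Q (regs s' ''j''))))"
      using i by (intro is_max0_insert) simp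
    show "\<exists>m<n. run c s' 20 (\<lambda>s'. regs s' ''j'' + int m = ?mq \<and> 0 \<le> regs s' ''j'' \<and>
      is_max0 (V \<union> ?F ` (+) (regs s1 ''base'') ` ?Q ` {0..<regs s' ''j''}) (regs s' ''q''))"
    proof (intro exI[of _ "n - 1"] conjI)
      show "n - 1 < n" using i t o' by auto
      show "run c s' 20 (\<lambda>s'. regs s' ''j'' + int (n - 1) = ?mq \<and> 0 \<le> regs s' ''j'' \<and>
        is_max0 (V \<union> ?F ` (+) (regs s1 ''base'') ` ?Q ` {0..<regs s' ''j''}) (regs s' ''q''))"
      proof (intro run_loop_free conjI)
        have j: "regs (result c s') ''j'' = regs s' ''j'' + 1" by (simp add: c_def)
        show "regs (result c s') ''j'' + int (n - 1) = ?mq" "0 \<le> regs (result c s') ''j''"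
          using i t o' unfolding j by auto
        have "regs (result c s') ''q'' = max (regs s' ''q'') (?F (regs s1 ''base'' + ?Q (regs s' ''j'')))"
          using o' by (simp add: c_def max_def)
        then show "is_max0 (V \<union> ?F ` (+) (regs s1 ''base'') ` ?Q ` {0..<regs (result c s') ''j''}) (regs (result c s') ''q'')"
          using m i unfolding j by (simp add: ivl_Suc)
      qed (simp_all add: c_def)
    qed
  next
    fix n s'
    assume i: "regs s' ''j'' + int n = ?mq \<and> 0 \<le> regs s' ''j'' \<and>
      is_max0 (V \<union> ?F ` (+) (regs s1 ''base'') ` ?Q ` {0..<regs s' ''j''}) (regs s' ''q'')"
      and t: "\<not> test_val (Less (Reg ''j'') (Reg ''mq'')) s'" and o: "same_outside c s1 s'"
    have "regs s' ''mq'' = ?mq" using o s1 by (simp add: same_outside_def c_def)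
    then have "regs s' ''j'' = ?mq" using i t by simp
    then show "is_max0 (V \<union> ?F ` (+) (regs s1 ''base'') ` ?Q ` {0..<?mq}) (regs s' ''q'')"
      using i by simp
  qed (use s1 q mq in simp_all)
  define d where "d = Assign ''base'' (Load ''row'' (Load ''P'' (Reg ''i''))) ;;
        Assign ''j'' (Const 0) ;;
        While (Less (Reg ''j'') (Reg ''mq'')) c ;;
        Assign ''i'' (Plus (Reg ''i'') (Const 1))"
  define I where "I n s' \<longleftrightarrow> regs s' ''i'' + int n = ?mp \<and> 0 \<le> regs s' ''i'' \<and>
    is_max0 (?F ` cells ?R (?P ` {0..<regs s' ''i''}) (?Q ` {0..<?mq})) (regs s' ''q'')" for n and s' :: state
  have "run (Assign ''i'' (Const 0) ;; While (Less (Reg ''i'') (Reg ''mp'')) d)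
    (result (Assign ''q'' (Const 0)) s) (M * (M * 25 + 24) + 6)
    (\<lambda>s'. is_max0 (?F ` cells ?R (nodes ''P'' ''mp'' s) (nodes ''Q'' ''mq'' s)) (regs s' ''q''))"
    (is "run _ ?s0 _ _")
  proof (rule run_loop_free_seq, simp, rule run_while_inv[where I = I and n = "nat ?mp" and t = "M * 25 + 20"])
    fix n s'
    assume i: "I n s'" and t: "test_val (Less (Reg ''i'') (Reg ''mp'')) s'"
      and o: "same_outside d (result (Assign ''i'' (Const 0)) ?s0) s'"
    have o': "regs s' ''mp'' = ?mp" "regs s' ''mq'' = ?mq" "arrays s' = arrays s"
      using o by (auto simp: same_outside_def d_def c_def)
    have "run d s' (M * 25 + 20) (I (n - 1))"
      unfolding d_def
    proof (rule run_loop_free_seq, simp, rule run_loop_free_seq, simp,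
        rule run_seq_le, rule run_conseq[OF inner _ order_refl])
      fix s2
      let ?s1 = "result (Assign ''j'' (Const 0)) (result (Assign ''base'' (Load ''row'' (Load ''P'' (Reg ''i'')))) s')"
      assume a: "is_max0 (?F ` cells ?R (?P ` {0..<regs s' ''i''}) (?Q ` {0..<?mq}) \<union>
          ?F ` (+) (regs ?s1 ''base'') ` ?Q ` {0..<?mq}) (regs s2 ''q'')"
        and o2: "same_outside (While (Less (Reg ''j'') (Reg ''mq'')) c) ?s1 s2"
      have "regs s2 ''i'' = regs s' ''i''" using o2 by (simp add: same_outside_def c_def)
      then show "run (Assign ''i'' (Plus (Reg ''i'') (Const 1))) s2 4 (I (n - 1))"
        using i t a o' unfolding I_def
        by (intro run_loop_free) (simp_all add: ivl_Suc cells_insert image_Un)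
    qed (use o' i in \<open>auto simp: I_def\<close>)
    then show "\<exists>m<n. run d s' (M * 25 + 20) (I m)"
      using i t o' unfolding I_def by (intro exI[of _ "n - 1"]) auto
  next
    show "I (nat ?mp) (result (Assign ''i'' (Const 0)) ?s0)"
      using p by (simp add: I_def)
  next
    fix n s'
    assume i: "I n s'" and t: "\<not> test_val (Less (Reg ''i'') (Reg ''mp'')) s'"
      and o: "same_outside d (result (Assign ''i'' (Const 0)) ?s0) s'"
    then show "is_max0 (?F ` cells ?R (nodes ''P'' ''mp'' s) (nodes ''Q'' ''mq'' s)) (regs s' ''q'')"
    proof -
      have "regs s' ''mp'' = ?mp" using o by (simp add: same_outside_def d_def c_def)
      then have "regs s' ''i'' = ?mp" using i t by (simp add: I_def)
      then show ?thesis using i by (simp add: I_def nodes_def)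
    qed
  next
    have "nat ?mp * (24 + M * 25) \<le> M * (M * 25 + 24)" using mp by (intro mult_le_mono) simp_all
    then show "nat ?mp * (1 + test_cost (Less (Reg ''i'') (Reg ''mp'')) + (M * 25 + 20)) + 1 +
      test_cost (Less (Reg ''i'') (Reg ''mp'')) \<le> M * (M * 25 + 24) + 4" by simp
  qed simp
  then show ?thesis
    unfolding lookup_def c_def[symmetric] d_def[symmetric]
    by (rule run_loop_free_seq[rotated]) (auto simp: M_def algebra_simps)
qed

lemma written_ancestors [simp]:
  "regs_of (ancestors X m) = {m, ''u''}" "arrays_of (ancestors X m) = {X}"
  by (auto simp: ancestors_def)

lemma written_decompose [simp]:
  "regs_of (decompose X m) = {m, ''l'', ''r''}" "arrays_of (decompose X m) = {X}"
  by (auto simp: decompose_def)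

lemma written_update [simp]:
  "regs_of (update X) = {''i'', ''base'', ''j'', ''k''}" "arrays_of (update X) = {X}"
  by (auto simp: update_def)

lemma written_lookup [simp]:
  "regs_of (lookup X) = {''q'', ''i'', ''base'', ''j'', ''k''}" "arrays_of (lookup X) = {}"
  by (auto simp: lookup_def)

text \<open>A pair of nodes stands for a product of two dyadic intervals of ranks, and its cell
  holds the maximum over the points of \<open>S\<close> in that product. With the default 0 for the
  empty set, untouched memory already represents the empty tree.\<close>

definition stores :: "nat \<Rightarrow> (int \<Rightarrow> int) \<Rightarrow> (int \<times> int \<times> int) set \<Rightarrow> bool" where
  "stores L F S \<longleftrightarrow> S \<subseteq> {0..<2 ^ L} \<times> {0..<2 ^ L} \<times> UNIV \<and>
     (\<forall>u\<in>{1..<2 * 2 ^ L}. \<forall>v\<in>{1..<2 * 2 ^ L}.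
        is_max0 {w. \<exists>x y. (x, y, w) \<in> S \<and> u \<in> path L x \<and> v \<in> path L y} (F (u * (2 * 2 ^ L) + v)))"

lemma stores_empty: "stores L (\<lambda>_. 0) {}"
  by (simp add: stores_def)

lemma row_cell_inj:
  fixes u v u' v' m :: int
  assumes "u * m + v = u' * m + v'" "0 \<le> v" "v < m" "0 \<le> v'" "v' < m"
  shows "u = u' \<and> v = v'"
proof -
  have "u = (u * m + v) div m" "u' = (u' * m + v') div m" using assms(2-) by simp_all
  then have "u = u'" using assms(1) by metis
  then show ?thesis using assms(1) by simp
qed

lemma path_subset: "0 \<le> x \<Longrightarrow> x < 2 ^ L \<Longrightarrow> path L x \<subseteq> {1..<2 * 2 ^ L}"
  using path_bounds by auto

lemma cells_cong: "(\<And>u. u \<in> U \<Longrightarrow> R u = R' u) \<Longrightarrow> cells R U V = cells R' U V"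
  unfolding cells_def by (intro image_cong) auto

text \<open>The new point matters exactly for the pairs of an ancestor of \<open>x\<close> and an
  ancestor of \<open>y\<close>; injectivity of the addressing ensures that no other pair is
  affected.\<close>

lemma stores_raise:
  assumes S: "stores L F S" and x: "0 \<le> x" "x < 2 ^ L" and y: "0 \<le> y" "y < 2 ^ L"
  shows "stores L (raise F (cells (\<lambda>u. u * (2 * 2 ^ L)) (path L x) (path L y)) w) (insert (x, y, w) S)"
  unfolding stores_def
proof (intro conjI ballI)
  show "insert (x, y, w) S \<subseteq> {0..<2 ^ L} \<times> {0..<2 ^ L} \<times> UNIV"
    using S x y by (auto simp: stores_def)
  fix u v :: int assume u: "u \<in> {1..<2 * 2 ^ L}" and v: "v \<in> {1..<2 * 2 ^ L}"
  let ?c = "u * (2 * 2 ^ L) + v"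
  let ?V = "\<lambda>S. {w. \<exists>x y. (x, y, w) \<in> S \<and> u \<in> path L x \<and> v \<in> path L y}"
  have old: "is_max0 (?V S) (F ?c)" using S u v unfolding stores_def by blast
  have c: "?c \<in> cells (\<lambda>u. u * (2 * 2 ^ L)) (path L x) (path L y) \<longleftrightarrow> u \<in> path L x \<and> v \<in> path L y"
  proof
    assume "?c \<in> cells (\<lambda>u. u * (2 * 2 ^ L)) (path L x) (path L y)"
    then obtain u' v' where e: "?c = u' * (2 * 2 ^ L) + v'" "u' \<in> path L x" "v' \<in> path L y"
      by (auto simp: cells_def)
    then have "u = u' \<and> v = v'"
      using v path_bounds[OF y e(3)] by (intro row_cell_inj[where m = "2 * 2 ^ L"]) auto
    then show "u \<in> path L x \<and> v \<in> path L y" using e by simp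
  qed (auto simp: cells_def)
  show "is_max0 (?V (insert (x, y, w) S))
    (raise F (cells (\<lambda>u. u * (2 * 2 ^ L)) (path L x) (path L y)) w ?c)"
  proof (cases "u \<in> path L x \<and> v \<in> path L y")
    case True
    then have "?V (insert (x, y, w) S) = insert w (?V S)" by auto
    then show ?thesis using True c is_max0_insert[OF old] by (simp add: raise_def)
  next
    case False
    then have "?V (insert (x, y, w) S) = ?V S" by auto
    then show ?thesis using c old unfolding raise_def if_not_P[OF False[folded c]] by simp
  qed
qed

text \<open>Every point of the rectangle lies below some pair of collected nodes, so its value is
  read. Conversely, a nonzero result is the value of a point below such a pair, and
  \<open>covers\<close> places that point inside the rectangle.\<close>

lemma stores_lookup:
  assumes S: "stores L F S" and U: "covers L U p q" and V: "covers L V p' q'"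
    and m: "is_max0 (F ` cells (\<lambda>u. u * (2 * 2 ^ L)) U V) r"
  shows "is_max0 {w. \<exists>x y. (x, y, w) \<in> S \<and> p \<le> x \<and> x < q \<and> p' \<le> y \<and> y < q'} r"
proof -
  have bounds: "0 \<le> x \<and> x < 2 ^ L \<and> 0 \<le> y \<and> y < 2 ^ L" if "(x, y, w) \<in> S" for x y w
    using S that by (auto simp: stores_def)
  have old: "is_max0 {w. \<exists>x y. (x, y, w) \<in> S \<and> u \<in> path L x \<and> v \<in> path L y} (F (u * (2 * 2 ^ L) + v))"
    if "u \<in> U" "v \<in> V" for u v
    using S U V that unfolding stores_def covers_def by blast
  have in_cells: "F (u * (2 * 2 ^ L) + v) \<in> F ` cells (\<lambda>u. u * (2 * 2 ^ L)) U V"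
    if "u \<in> U" "v \<in> V" for u v using that by (force simp: cells_def)
  show ?thesis
    unfolding is_max0_def
  proof (intro conjI ballI)
    show "0 \<le> r" using m by (simp add: is_max0_def)
  next
    fix w assume "w \<in> {w. \<exists>x y. (x, y, w) \<in> S \<and> p \<le> x \<and> x < q \<and> p' \<le> y \<and> y < q'}"
    then obtain x y where xy: "(x, y, w) \<in> S" "p \<le> x" "x < q" "p' \<le> y" "y < q'" by blast
    then obtain u v where uv: "u \<in> U" "u \<in> path L x" "v \<in> V" "v \<in> path L y"
      using U V bounds[OF xy(1)] unfolding covers_def by blast
    then have "w \<le> F (u * (2 * 2 ^ L) + v)" using old[OF uv(1,3)] xy(1) unfolding is_max0_def by blast
    also have "\<dots> \<le> r" using m in_cells[OF uv(1,3)] unfolding is_max0_def by blast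
    finally show "w \<le> r" .
  next
    show "r = 0 \<or> r \<in> {w. \<exists>x y. (x, y, w) \<in> S \<and> p \<le> x \<and> x < q \<and> p' \<le> y \<and> y < q'}"
    proof (cases "r = 0")
      case False
      then obtain u v where uv: "u \<in> U" "v \<in> V" "r = F (u * (2 * 2 ^ L) + v)"
        using m by (auto simp: is_max0_def cells_def)
      then obtain x y where xy: "(x, y, r) \<in> S" "u \<in> path L x" "v \<in> path L y"
        using old[OF uv(1,2)] False by (auto simp: is_max0_def)
      then show ?thesis using U V uv bounds[OF xy(1)] unfolding covers_def by blast
    qed simp
  qed
qed

lemma tables_row: "tables L s \<Longrightarrow> U \<subseteq> {1..<2 * 2 ^ L} \<Longrightarrow>
    cells (arrays s ''row'') U V = cells (\<lambda>u. u * (2 * 2 ^ L)) U V"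
  by (rule cells_cong) (auto simp: tables_def)

definition tree_insert :: "string \<Rightarrow> prog" where
  "tree_insert X =
     Assign ''u'' (Plus (Reg ''z'') (Reg ''p1'')) ;;
     ancestors ''P'' ''mp'' ;;
     Assign ''u'' (Plus (Reg ''z'') (Reg ''p2'')) ;;
     ancestors ''Q'' ''mq'' ;;
     update X"

lemma run_tree_insert:
  assumes T: "tables L s" and S: "stores L (arrays s X) S"
    and p1: "0 \<le> regs s ''p1''" "regs s ''p1'' < 2 ^ L"
    and p2: "0 \<le> regs s ''p2''" "regs s ''p2'' < 2 ^ L"
    and X: "X \<notin> {''P'', ''Q'', ''half'', ''row''}"
  shows "run (tree_insert X) s (600 * (L + 2) * (L + 2))
    (\<lambda>s'. stores L (arrays s' X) (insert (regs s ''p1'', regs s ''p2'', regs s ''v'') S))"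
proof -
  let ?x = "regs s ''p1''" and ?y = "regs s ''p2''" and ?v = "regs s ''v''"
  have z: "regs s ''z'' = 2 ^ L" using T by (simp add: tables_def)
  have X': "X \<noteq> ''P''" "X \<noteq> ''Q''" using X by auto
  have bound: "20 * (L + 2) + (20 * (L + 2) + 400 * (L + 2) * (L + 2)) + 8 \<le> 600 * (L + 2) * (L + 2)"
    by (simp add: algebra_simps)
  let ?s0 = "result (Assign ''u'' (Plus (Reg ''z'') (Reg ''p1''))) s"
  have "run (ancestors ''P'' ''mp'') ?s0 (20 * (L + 2))
    (\<lambda>s1. nodes ''P'' ''mp'' s1 = path L ?x \<and> 0 \<le> regs s1 ''mp'' \<and> regs s1 ''mp'' \<le> int L + 1)"
    using T p1 z by (intro run_ancestors) (auto simp: tables_def)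
  then have "run (ancestors ''P'' ''mp'' ;; Assign ''u'' (Plus (Reg ''z'') (Reg ''p2'')) ;;
     ancestors ''Q'' ''mq'' ;; update X) ?s0
     (20 * (L + 2) + (4 + (20 * (L + 2) + 400 * (L + 2) * (L + 2))))
     (\<lambda>s'. stores L (arrays s' X) (insert (?x, ?y, ?v) S))"
  proof (intro run_seq, elim run_conseq)
    fix s1 :: state
    assume n1: "nodes ''P'' ''mp'' s1 = path L ?x \<and> 0 \<le> regs s1 ''mp'' \<and> regs s1 ''mp'' \<le> int L + 1"
      and o1: "same_outside (ancestors ''P'' ''mp'') ?s0 s1"
    have T1: "tables L s1" by (rule tables_same_outside[OF _ o1]) (use T in \<open>auto simp: tables_def\<close>)
    have o1': "regs s1 ''z'' = 2 ^ L" "regs s1 ''p2'' = ?y" "regs s1 ''v'' = ?v" "arrays s1 X = arrays s X"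
      using o1 z X' by (simp_all add: same_outside_def)
    let ?s1 = "result (Assign ''u'' (Plus (Reg ''z'') (Reg ''p2''))) s1"
    have "run (ancestors ''Q'' ''mq'') ?s1 (20 * (L + 2))
      (\<lambda>s2. nodes ''Q'' ''mq'' s2 = path L ?y \<and> 0 \<le> regs s2 ''mq'' \<and> regs s2 ''mq'' \<le> int L + 1)"
      using T1 p2 o1' by (intro run_ancestors) (auto simp: tables_def)
    then have "run (ancestors ''Q'' ''mq'' ;; update X) ?s1 (20 * (L + 2) + 400 * (L + 2) * (L + 2))
       (\<lambda>s'. stores L (arrays s' X) (insert (?x, ?y, ?v) S))"
    proof (intro run_seq, elim run_conseq)
      fix s2 :: state
      assume n2: "nodes ''Q'' ''mq'' s2 = path L ?y \<and> 0 \<le> regs s2 ''mq'' \<and> regs s2 ''mq'' \<le> int L + 1"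
        and o2: "same_outside (ancestors ''Q'' ''mq'') ?s1 s2"
      have T2: "tables L s2" by (rule tables_same_outside[OF _ o2]) (use T1 in \<open>auto simp: tables_def\<close>)
      have o2': "regs s2 ''v'' = ?v" "arrays s2 X = arrays s X" "regs s2 ''mp'' = regs s1 ''mp''"
        "nodes ''P'' ''mp'' s2 = path L ?x"
        using o2 o1' X' n1 by (simp_all add: same_outside_def nodes_def)
      show "run (update X) s2 (400 * (L + 2) * (L + 2))
        (\<lambda>s'. stores L (arrays s' X) (insert (?x, ?y, ?v) S))"
      proof (rule run_conseq[OF run_update _ order_refl])
        fix s3 :: state
        assume "arrays s3 X = raise (arrays s2 X)
          (cells (arrays s2 ''row'') (nodes ''P'' ''mp'' s2) (nodes ''Q'' ''mq'' s2)) (regs s2 ''v'')"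
        then show "stores L (arrays s3 X) (insert (?x, ?y, ?v) S)"
          using stores_raise[OF S p1 p2, of ?v] n2 o2' tables_row[OF T2 path_subset[OF p1]] by simp
      qed (use n1 n2 o2' X in auto)
    qed simp
    then show "run (Assign ''u'' (Plus (Reg ''z'') (Reg ''p2'')) ;; ancestors ''Q'' ''mq'' ;; update X) s1
      (4 + (20 * (L + 2) + 400 * (L + 2) * (L + 2))) (\<lambda>s'. stores L (arrays s' X) (insert (?x, ?y, ?v) S))"
      by (rule run_loop_free_seq[rotated]) auto
  qed simp
  then show ?thesis unfolding tree_insert_def
    by (rule run_loop_free_seq[rotated]) (use bound in auto)
qed

definition tree_query :: "string \<Rightarrow> prog" where
  "tree_query X =
     (Assign ''l'' (Plus (Reg ''z'') (Reg ''p1'')) ;; Assign ''r'' (Plus (Reg ''z'') (Reg ''q1''))) ;;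
     decompose ''P'' ''mp'' ;;
     (Assign ''l'' (Plus (Reg ''z'') (Reg ''p2'')) ;; Assign ''r'' (Plus (Reg ''z'') (Reg ''q2''))) ;;
     decompose ''Q'' ''mq'' ;;
     lookup X"

lemma run_tree_query:
  assumes T: "tables L s" and S: "stores L (arrays s X) S"
    and p1: "0 \<le> regs s ''p1''" "regs s ''p1'' < 2 ^ L"
    and q1: "0 \<le> regs s ''q1''" "regs s ''q1'' \<le> 2 ^ L"
    and p2: "0 \<le> regs s ''p2''" "regs s ''p2'' < 2 ^ L"
    and q2: "0 \<le> regs s ''q2''" "regs s ''q2'' \<le> 2 ^ L"
    and X: "X \<notin> {''P'', ''Q''}"
  shows "run (tree_query X) s (600 * (L + 2) * (L + 2))
    (\<lambda>s'. is_max0 {w. \<exists>x y. (x, y, w) \<in> S \<and> regs s ''p1'' \<le> x \<and> x < regs s ''q1'' \<and>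
       regs s ''p2'' \<le> y \<and> y < regs s ''q2''} (regs s' ''q''))"
    (is "run _ _ _ ?post")
proof -
  let ?p1 = "regs s ''p1''" and ?q1 = "regs s ''q1''" and ?p2 = "regs s ''p2''" and ?q2 = "regs s ''q2''"
  have z: "regs s ''z'' = 2 ^ L" using T by (simp add: tables_def)
  have X': "X \<noteq> ''P''" "X \<noteq> ''Q''" using X by auto
  \<comment> \<open>As \<open>L + 2\<close> is at least 2, the linear cost of both decompositions
    fits into the gap between 400 and 600 times the square.\<close>
  have bound: "70 * (L + 2) + (70 * (L + 2) + 400 * (L + 2) * (L + 2)) + 16 \<le> 600 * (L + 2) * (L + 2)"
    by (simp add: algebra_simps)
  let ?a1 = "Assign ''l'' (Plus (Reg ''z'') (Reg ''p1'')) ;; Assign ''r'' (Plus (Reg ''z'') (Reg ''q1''))"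
  let ?a2 = "Assign ''l'' (Plus (Reg ''z'') (Reg ''p2'')) ;; Assign ''r'' (Plus (Reg ''z'') (Reg ''q2''))"
  let ?s0 = "result ?a1 s"
  have "run (decompose ''P'' ''mp'') ?s0 (70 * (L + 2))
    (\<lambda>s1. covers L (nodes ''P'' ''mp'' s1) ?p1 ?q1 \<and> 0 \<le> regs s1 ''mp'' \<and> regs s1 ''mp'' \<le> 2 * (int L + 1))"
    using T p1 q1 z by (intro run_decompose) (auto simp: tables_def)
  then have "run (decompose ''P'' ''mp'' ;; ?a2 ;; decompose ''Q'' ''mq'' ;; lookup X) ?s0
     (70 * (L + 2) + (8 + (70 * (L + 2) + 400 * (L + 2) * (L + 2)))) ?post"
  proof (intro run_seq, elim run_conseq)
    fix s1 :: state
    assume n1: "covers L (nodes ''P'' ''mp'' s1) ?p1 ?q1 \<and> 0 \<le> regs s1 ''mp'' \<and> regs s1 ''mp'' \<le> 2 * (int L + 1)"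
      and o1: "same_outside (decompose ''P'' ''mp'') ?s0 s1"
    have T1: "tables L s1" by (rule tables_same_outside[OF _ o1]) (use T in \<open>auto simp: tables_def\<close>)
    have o1': "regs s1 ''z'' = 2 ^ L" "regs s1 ''p2'' = ?p2" "regs s1 ''q2'' = ?q2" "arrays s1 X = arrays s X"
      using o1 z X' by (simp_all add: same_outside_def)
    let ?s1 = "result ?a2 s1"
    have "run (decompose ''Q'' ''mq'') ?s1 (70 * (L + 2))
      (\<lambda>s2. covers L (nodes ''Q'' ''mq'' s2) ?p2 ?q2 \<and> 0 \<le> regs s2 ''mq'' \<and> regs s2 ''mq'' \<le> 2 * (int L + 1))"
      using T1 p2 q2 o1' by (intro run_decompose) (auto simp: tables_def)
    then have "run (decompose ''Q'' ''mq'' ;; lookup X) ?s1 (70 * (L + 2) + 400 * (L + 2) * (L + 2)) ?post"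
    proof (intro run_seq, elim run_conseq)
      fix s2 :: state
      assume n2: "covers L (nodes ''Q'' ''mq'' s2) ?p2 ?q2 \<and> 0 \<le> regs s2 ''mq'' \<and> regs s2 ''mq'' \<le> 2 * (int L + 1)"
        and o2: "same_outside (decompose ''Q'' ''mq'') ?s1 s2"
      have T2: "tables L s2" by (rule tables_same_outside[OF _ o2]) (use T1 in \<open>auto simp: tables_def\<close>)
      have o2': "arrays s2 X = arrays s X" "regs s2 ''mp'' = regs s1 ''mp''"
        "nodes ''P'' ''mp'' s2 = nodes ''P'' ''mp'' s1"
        using o2 o1' X' n1 by (simp_all add: same_outside_def nodes_def)
      have U: "nodes ''P'' ''mp'' s1 \<subseteq> {1..<2 * 2 ^ L}" using n1 by (simp add: covers_def)
      show "run (lookup X) s2 (400 * (L + 2) * (L + 2)) ?post"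
      proof (rule run_conseq[OF run_lookup _ order_refl])
        fix s3 :: state
        assume "is_max0 (arrays s2 X ` cells (arrays s2 ''row'') (nodes ''P'' ''mp'' s2) (nodes ''Q'' ''mq'' s2))
          (regs s3 ''q'')"
        then show "?post s3"
          using n1 n2 o2' tables_row[OF T2 U] by (intro stores_lookup[OF S]) auto
      qed (use n1 n2 o2' in auto)
    qed simp
    then show "run (?a2 ;; decompose ''Q'' ''mq'' ;; lookup X) s1
      (8 + (70 * (L + 2) + 400 * (L + 2) * (L + 2))) ?post"
      by (rule run_loop_free_seq[rotated]) auto
  qed simp
  then show ?thesis unfolding tree_query_def
    by (rule run_loop_free_seq[rotated]) (use bound in auto)
qed

lemma written_tree_insert [simp]:
  "regs_of (tree_insert X) = {''u'', ''mp'', ''mq'', ''i'', ''base'', ''j'', ''k''}"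
  "arrays_of (tree_insert X) = {X, ''P'', ''Q''}"
  by (auto simp: tree_insert_def)

lemma written_tree_query [simp]:
  "regs_of (tree_query X) = {''l'', ''r'', ''mp'', ''mq'', ''q'', ''i'', ''base'', ''j'', ''k''}"
  "arrays_of (tree_query X) = {''P'', ''Q''}"
  by (auto simp: tree_query_def)


section \<open>Tournament sort\<close>

text \<open>
  A node holds the index of the winner plus one, where \<open>0\<close> means that no leaf below it is occupied.
\<close>

definition better :: "(int \<Rightarrow> int) \<Rightarrow> int \<Rightarrow> int \<Rightarrow> int" where
  "better K x y = (if 0 < x then if 0 < y \<and> K (y - 1) < K (x - 1) then y else x else y)"

definition tournament :: "nat \<Rightarrow> (int \<Rightarrow> int) \<Rightarrow> (int \<Rightarrow> int) \<Rightarrow> int set \<Rightarrow> bool" where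
  "tournament L K W B \<longleftrightarrow> B \<subseteq> {0..<2 ^ L} \<and>
     (\<forall>i\<in>{0..<2 ^ L}. W (2 ^ L + i) = (if i \<in> B then i + 1 else 0)) \<and>
     (\<forall>u\<in>{1..<2 ^ L}. W u = better K (W (2 * u)) (W (2 * u + 1)))"

lemma tournament_empty: "tournament L K (\<lambda>_. 0) {}"
  by (simp add: tournament_def better_def)

text \<open>Inner nodes copy an entry from one of their children, so the induction runs from the
  leaves, which have the largest numbers, to the root.\<close>

lemma tournament_winner_mem:
  assumes T: "tournament L K W B" and u: "1 \<le> u" "u < 2 * 2 ^ L"
  shows "W u = 0 \<or> W u - 1 \<in> B"
  using u
proof (induction "nat (2 * 2 ^ L - u)" arbitrary: u rule: less_induct)
  case less
  show ?case
  proof (cases "u < 2 ^ L")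
    case True
    have "W (2 * u) = 0 \<or> W (2 * u) - 1 \<in> B" "W (2 * u + 1) = 0 \<or> W (2 * u + 1) - 1 \<in> B"
      using less.prems True by (intro less.hyps; simp)+
    moreover have "W u = better K (W (2 * u)) (W (2 * u + 1))"
      using T less.prems True by (simp add: tournament_def)
    ultimately show ?thesis by (auto simp: better_def)
  next
    case False
    then have "u - 2 ^ L \<in> {0..<2 ^ L}" using less.prems by auto
    then have "W (2 ^ L + (u - 2 ^ L)) = (if u - 2 ^ L \<in> B then u - 2 ^ L + 1 else 0)"
      using T unfolding tournament_def by blast
    then show ?thesis by (auto split: if_splits)
  qed
qed

text \<open>On the way from a node to its parent the winning key can only decrease, and an occupied
  node makes its parent occupied.\<close>

lemma tournament_winner_le:
  assumes T: "tournament L K W B" and v: "1 \<le> v" "v < 2 * 2 ^ L" "0 < W v"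
  shows "0 < W 1 \<and> K (W 1 - 1) \<le> K (W v - 1)"
  using v
proof (induction "nat v" arbitrary: v rule: less_induct)
  case less
  show ?case
  proof (cases "v = 1")
    case False
    let ?u = "v div 2"
    have u: "1 \<le> ?u" "?u < 2 ^ L" using False less.prems by auto
    then have "W ?u = better K (W (2 * ?u)) (W (2 * ?u + 1))" using T by (simp add: tournament_def)
    moreover have "v = 2 * ?u \<or> v = 2 * ?u + 1" by presburger
    ultimately have w: "0 < W ?u \<and> K (W ?u - 1) \<le> K (W v - 1)"
      using less.prems(3) by (auto simp: better_def)
    have "0 < W 1 \<and> K (W 1 - 1) \<le> K (W ?u - 1)"
      using u w less.prems by (intro less.hyps) auto
    then show ?thesis using w by simp
  qed (use less.prems in simp)
qed

lemma tournament_root: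
  assumes T: "tournament L K W B" and B: "i \<in> B"
  shows "0 < W 1" "W 1 - 1 \<in> B" "K (W 1 - 1) \<le> K i"
proof -
  have "i \<in> {0..<2 ^ L}" using T B by (auto simp: tournament_def)
  moreover from this have W: "W (2 ^ L + i) = i + 1" using T B by (auto simp: tournament_def)
  moreover have "(1::int) \<le> 2 ^ L" by simp
  ultimately have "0 < W 1 \<and> K (W 1 - 1) \<le> K (W (2 ^ L + i) - 1)"
    by (intro tournament_winner_le[OF T]) auto
  then show "0 < W 1" "K (W 1 - 1) \<le> K i" using W by auto
  moreover have "(1::int) < 2 * 2 ^ L" using \<open>1 \<le> 2 ^ L\<close> by linarith
  ultimately show "W 1 - 1 \<in> B" using tournament_winner_mem[OF T, of 1] by force
qed

section \<open>Changing one leaf of the tournament\<close>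

definition replay :: prog where
  "replay = While (Less (Const 0) (Reg ''u''))
     (Assign ''f'' (Load ''w'' (Plus (Reg ''u'') (Reg ''u''))) ;;
      Assign ''g'' (Load ''w'' (Plus (Plus (Reg ''u'') (Reg ''u'')) (Const 1))) ;;
      If (Less (Const 0) (Reg ''f''))
        (If (And (Less (Const 0) (Reg ''g''))
               (Less (Load ''K'' (Minus (Reg ''g'') (Const 1))) (Load ''K'' (Minus (Reg ''f'') (Const 1)))))
           (Store ''w'' (Reg ''u'') (Reg ''g''))
           (Store ''w'' (Reg ''u'') (Reg ''f'')))
        (Store ''w'' (Reg ''u'') (Reg ''g'')) ;;
      Assign ''u'' (Load ''half'' (Reg ''u'')))"

text \<open>At any time the equation for inner nodes may fail at the current node only. Recomputing
  it moves the possible defect to the parent; once \<open>u\<close> is 0, which is not a node, the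
  equation holds everywhere.\<close>

lemma run_replay:
  assumes T: "tables L s" and u: "0 \<le> regs s ''u''" "regs s ''u'' < 2 ^ L"
    and c: "\<And>v. v \<in> {1..<2 ^ L} \<Longrightarrow> v \<noteq> regs s ''u'' \<Longrightarrow>
      arrays s ''w'' v = better (arrays s ''K'') (arrays s ''w'' (2 * v)) (arrays s ''w'' (2 * v + 1))"
  shows "run replay s (60 * (L + 2)) (\<lambda>s'.
    (\<forall>a \<ge> 2 ^ L. arrays s' ''w'' a = arrays s ''w'' a) \<and>
    (\<forall>v\<in>{1..<2 ^ L}. arrays s' ''w'' v =
      better (arrays s ''K'') (arrays s' ''w'' (2 * v)) (arrays s' ''w'' (2 * v + 1))))"
proof -
  let ?K = "arrays s ''K''"
  define I where "I n s' \<longleftrightarrow> 0 \<le> regs s' ''u'' \<and> regs s' ''u'' < 2 ^ n \<and> n \<le> L \<and>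
    (\<forall>a \<ge> 2 ^ L. arrays s' ''w'' a = arrays s ''w'' a) \<and>
    (\<forall>v\<in>{1..<2 ^ L}. v \<noteq> regs s' ''u'' \<longrightarrow> arrays s' ''w'' v =
      better ?K (arrays s' ''w'' (2 * v)) (arrays s' ''w'' (2 * v + 1)))" for n and s' :: state
  show ?thesis
    unfolding replay_def
  proof (rule run_while_inv[where I = I and n = L and t = 50])
    show "I L s" using u c by (simp add: I_def)
  next
    fix n and s' :: state
    let ?c = "Assign ''f'' (Load ''w'' (Plus (Reg ''u'') (Reg ''u''))) ;;
      Assign ''g'' (Load ''w'' (Plus (Plus (Reg ''u'') (Reg ''u'')) (Const 1))) ;;
      If (Less (Const 0) (Reg ''f''))
        (If (And (Less (Const 0) (Reg ''g''))
               (Less (Load ''K'' (Minus (Reg ''g'') (Const 1))) (Load ''K'' (Minus (Reg ''f'') (Const 1)))))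
           (Store ''w'' (Reg ''u'') (Reg ''g''))
           (Store ''w'' (Reg ''u'') (Reg ''f'')))
        (Store ''w'' (Reg ''u'') (Reg ''g'')) ;;
      Assign ''u'' (Load ''half'' (Reg ''u''))"
    assume i: "I n s'" and t: "test_val (Less (Const 0) (Reg ''u'')) s'" and o: "same_outside ?c s s'"
    let ?u = "regs s' ''u''" and ?W = "arrays s' ''w''" and ?s = "result ?c s'"
    have K: "arrays s' ''K'' = ?K" "arrays s' ''half'' = arrays s ''half''" using o by (simp_all add: same_outside_def)
    have u0: "0 < ?u" using t by simp
    obtain n' where n': "n = Suc n'" using i u0 by (cases n) (auto simp: I_def)
    have "(2::int) ^ n \<le> 2 ^ L" using i by (intro power_increasing) (auto simp: I_def)
    moreover have "?u < 2 ^ n" using i by (simp add: I_def)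
    ultimately have uL: "?u < 2 ^ L" by linarith
    then have half: "arrays s' ''half'' ?u = ?u div 2" using T u0 K(2) by (simp add: tables_def)
    have W: "arrays ?s ''w'' = ?W(?u := better ?K (?W (2 * ?u)) (?W (2 * ?u + 1)))"
      by (simp add: better_def K)
    have U: "regs ?s ''u'' = ?u div 2" using half by simp
    show "\<exists>m<n. run ?c s' 50 (I m)"
    proof (intro exI[of _ n'] conjI run_loop_free)
      show "I n' ?s"
        unfolding I_def W U
      proof (intro conjI allI ballI impI)
        fix v assume v: "v \<in> {1..<2 ^ L}" "v \<noteq> ?u div 2"
        let ?W' = "?W(?u := better ?K (?W (2 * ?u)) (?W (2 * ?u + 1)))"
        \<comment> \<open>Only the parent of the changed node reads it as a child, and the invariant
          exempts that parent in the next round.\<close>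
        have ne: "2 * v \<noteq> ?u" "2 * v + 1 \<noteq> ?u" using v by auto
        show "?W' v = better ?K (?W' (2 * v)) (?W' (2 * v + 1))"
          using i v u0 ne unfolding I_def by (cases "v = ?u") auto
      qed (use i n' uL u0 in \<open>auto simp: I_def\<close>)
    qed (use n' in simp_all)
  next
    fix n and s' :: state
    assume "I n s'" "\<not> test_val (Less (Const 0) (Reg ''u'')) s'"
    then show "(\<forall>a \<ge> 2 ^ L. arrays s' ''w'' a = arrays s ''w'' a) \<and>
      (\<forall>v\<in>{1..<2 ^ L}. arrays s' ''w'' v =
        better ?K (arrays s' ''w'' (2 * v)) (arrays s' ''w'' (2 * v + 1)))"
      by (auto simp: I_def)
  qed simp
qed

definition set_leaf :: prog where
  "set_leaf =
     (Store ''w'' (Plus (Reg ''z'') (Reg ''x'')) (Reg ''y'') ;;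
      Assign ''u'' (Load ''half'' (Plus (Reg ''z'') (Reg ''x'')))) ;;
     replay"

lemma written_replay [simp]:
  "regs_of replay = {''u'', ''f'', ''g''}" "arrays_of replay = {''w''}"
  by (auto simp: replay_def)

lemma written_set_leaf [simp]:
  "regs_of set_leaf = {''u'', ''f'', ''g''}" "arrays_of set_leaf = {''w''}"
  by (auto simp: set_leaf_def)

text \<open>Entering and removing are the same operation: \<open>B\<close> and \<open>B'\<close> may
  differ at the leaf \<open>x\<close> only, and the value \<open>y\<close> says whether that leaf is
  occupied afterwards.\<close>

lemma run_set_leaf:
  assumes T: "tables L s" and W: "tournament L (arrays s ''K'') (arrays s ''w'') B"
    and x: "0 \<le> regs s ''x''" "regs s ''x'' < 2 ^ L"
    and y: "regs s ''y'' = (if regs s ''x'' \<in> B' then regs s ''x'' + 1 else 0)"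
    and B': "B' \<subseteq> {0..<2 ^ L}" "B - {regs s ''x''} = B' - {regs s ''x''}"
  shows "run set_leaf s (80 * (L + 2)) (\<lambda>s'. tournament L (arrays s ''K'') (arrays s' ''w'') B')"
proof -
  let ?x = "regs s ''x''" and ?W = "arrays s ''w''" and ?K = "arrays s ''K''"
  let ?a = "Store ''w'' (Plus (Reg ''z'') (Reg ''x'')) (Reg ''y'') ;;
      Assign ''u'' (Load ''half'' (Plus (Reg ''z'') (Reg ''x'')))"
  have z: "regs s ''z'' = 2 ^ L" "arrays s ''half'' (2 ^ L + ?x) = (2 ^ L + ?x) div 2"
    using T x by (simp_all add: tables_def)
  define W1 where "W1 = ?W(2 ^ L + ?x := regs s ''y'')"
  have a: "arrays (result ?a s) ''w'' = W1" "regs (result ?a s) ''u'' = (2 ^ L + ?x) div 2"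
    "arrays (result ?a s) ''K'' = ?K" "tables L (result ?a s)"
    using z T by (simp_all add: W1_def tables_def)
  have pos: "(1::int) \<le> 2 ^ L" by simp
  have "run replay (result ?a s) (60 * (L + 2)) (\<lambda>s'.
    (\<forall>a \<ge> 2 ^ L. arrays s' ''w'' a = W1 a) \<and>
    (\<forall>v\<in>{1..<2 ^ L}. arrays s' ''w'' v =
      better ?K (arrays s' ''w'' (2 * v)) (arrays s' ''w'' (2 * v + 1))))"
  proof (rule run_replay[of L "result ?a s", unfolded a])
    fix v :: int assume v: "v \<in> {1..<2 ^ L}" "v \<noteq> (2 ^ L + ?x) div 2"
    then have "v \<noteq> 2 ^ L + ?x" "2 * v \<noteq> 2 ^ L + ?x" "2 * v + 1 \<noteq> 2 ^ L + ?x" using x by auto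
    then show "W1 v = better ?K (W1 (2 * v)) (W1 (2 * v + 1))"
      using W v by (simp add: W1_def tournament_def)
  qed (use a x pos in auto)
  then have "run replay (result ?a s) (60 * (L + 2)) (\<lambda>s'. tournament L ?K (arrays s' ''w'') B')"
  proof (rule run_conseq)
    fix s' :: state
    assume s': "(\<forall>a \<ge> 2 ^ L. arrays s' ''w'' a = W1 a) \<and>
      (\<forall>v\<in>{1..<2 ^ L}. arrays s' ''w'' v =
        better ?K (arrays s' ''w'' (2 * v)) (arrays s' ''w'' (2 * v + 1)))"
    have "arrays s' ''w'' (2 ^ L + i) = (if i \<in> B' then i + 1 else 0)" if i: "i \<in> {0..<2 ^ L}" for i
    proof (cases "i = ?x")
      case True
      then show ?thesis using s' y i by (simp add: W1_def)
    next
      case False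
      then have "i \<in> B \<longleftrightarrow> i \<in> B'" using B' by blast
      then show ?thesis using s' i False W by (simp add: W1_def tournament_def)
    qed
    then show "tournament L ?K (arrays s' ''w'') B'"
      using s' B' unfolding tournament_def by blast
  qed simp
  then show ?thesis unfolding set_leaf_def by (rule run_loop_free_seq[rotated]) auto
qed

text \<open>\<open>y\<close> is read after \<open>i\<close> has been incremented, which yields the
  index plus one, the encoding of an occupied leaf.\<close>

definition enter_all :: prog where
  "enter_all =
     Assign ''i'' (Const 0) ;;
     While (Less (Reg ''i'') (Reg ''m''))
       ((Assign ''x'' (Reg ''i'') ;;
         Assign ''i'' (Plus (Reg ''i'') (Const 1)) ;;
         Assign ''y'' (Reg ''i'')) ;;
        set_leaf)"

lemma written_enter_all [simp]:
  "regs_of enter_all = {''i'', ''x'', ''y'', ''u'', ''f'', ''g''}" "arrays_of enter_all = {''w''}"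
  by (auto simp: enter_all_def)

lemma run_enter_all:
  assumes T: "tables L s" and W: "arrays s ''w'' = (\<lambda>_. 0)"
    and m: "regs s ''m'' = int M" "int M < 2 ^ L"
  shows "run enter_all s ((M + 1) * (100 * (L + 2)))
    (\<lambda>s'. tournament L (arrays s ''K'') (arrays s' ''w'') {0..<int M})"
proof -
  let ?K = "arrays s ''K''"
  let ?a = "Assign ''x'' (Reg ''i'') ;; Assign ''i'' (Plus (Reg ''i'') (Const 1)) ;; Assign ''y'' (Reg ''i'')"
  let ?i0 = "Assign ''i'' (Const 0)"
  define I where "I n s' \<longleftrightarrow> regs s' ''i'' + int n = int M \<and> 0 \<le> regs s' ''i'' \<and>
    tournament L ?K (arrays s' ''w'') {0..<regs s' ''i''}" for n and s' :: state
  show ?thesis unfolding enter_all_def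
  proof (rule run_loop_free_seq, simp, rule run_while_inv[where I = I and n = M and t = "80 * (L + 2) + 10"])
    show "I M (result ?i0 s)" using W by (simp add: I_def tournament_empty)
  next
    fix n and s' :: state
    assume i: "I n s'" and t: "test_val (Less (Reg ''i'') (Reg ''m'')) s'"
      and o: "same_outside (?a ;; set_leaf) (result ?i0 s) s'"
    let ?s = "result ?a s'"
    have o': "regs s' ''m'' = int M" "arrays s' ''K'' = ?K" "tables L s'"
      using o m T by (simp_all add: same_outside_def tables_def)
    have lt: "regs s' ''i'' < int M" using t o' by simp
    then have lt': "regs s' ''i'' < 2 ^ L" "regs s' ''i'' + 1 \<le> 2 ^ L" using m(2) by linarith+
    have "run set_leaf ?s (80 * (L + 2))
      (\<lambda>s2. tournament L (arrays ?s ''K'') (arrays s2 ''w'') {0..<regs s' ''i'' + 1})"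
      by (rule run_set_leaf[where B = "{0..<regs s' ''i''}"])
        (use i o' lt' in \<open>auto simp: I_def tables_def\<close>)
    then have "run set_leaf ?s (80 * (L + 2)) (I (n - 1))"
      by (rule run_conseq) (use i o' lt in \<open>auto simp: I_def same_outside_def of_nat_diff\<close>)
    then have "run (?a ;; set_leaf) s' (80 * (L + 2) + 10) (I (n - 1))"
      by (rule run_loop_free_seq[rotated]) auto
    then show "\<exists>m<n. run (?a ;; set_leaf) s' (80 * (L + 2) + 10) (I m)"
      using i lt by (intro exI[of _ "n - 1"]) (auto simp: I_def)
  next
    fix n and s' :: state
    assume i: "I n s'" and t: "\<not> test_val (Less (Reg ''i'') (Reg ''m'')) s'"
      and o: "same_outside (?a ;; set_leaf) (result ?i0 s) s'"
    have "regs s' ''m'' = int M" using o m by (simp add: same_outside_def)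
    then have "regs s' ''i'' = int M" using i t by (simp add: I_def)
    then show "tournament L ?K (arrays s' ''w'') {0..<int M}" using i by (simp add: I_def)
  next
    have "max_cost ?i0 + (M * (80 * (L + 2) + 14) + 4) \<le> (M + 1) * (80 * (L + 2) + 14)"
      by simp
    also have "\<dots> \<le> (M + 1) * (100 * (L + 2))" by (intro mult_le_mono) auto
    finally show "max_cost ?i0 + (M * (80 * (L + 2) + 14) + 4) \<le> (M + 1) * (100 * (L + 2))" .
  qed simp
qed

text \<open>\<open>E\<close> holds the indices extracted so far, \<open>k\<close> and
  \<open>r\<close> the key and the rank of the latest one. For empty \<open>E\<close> the formula is
  vacuous, so \<open>k\<close> and \<open>r\<close> may start with any values; for nonempty
  \<open>E\<close> the key \<open>k\<close> is attained, which places it below every later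
  key.\<close>

definition ranked :: "int set \<Rightarrow> (int \<Rightarrow> int) \<Rightarrow> (int \<Rightarrow> int) \<Rightarrow> int \<Rightarrow> int \<Rightarrow> bool" where
  "ranked E K rk k r \<longleftrightarrow>
     (\<forall>x\<in>E. K x \<le> k \<and> 0 \<le> rk x \<and> rk x \<le> r \<and> (K x < k \<longleftrightarrow> rk x < r)) \<and>
     (\<forall>x\<in>E. \<forall>y\<in>E. K x < K y \<longleftrightarrow> rk x < rk y) \<and> (E \<noteq> {} \<longrightarrow> (\<exists>x\<in>E. K x = k))"

text \<open>The new key is at least \<open>k\<close>. If it is larger, the new rank exceeds all old
  ranks, as the new key exceeds all old keys; if it equals \<open>k\<close>, the rank is
  shared.\<close>

lemma ranked_step:
  assumes R: "ranked E K rk k r" and x: "x \<notin> E" "\<And>e. e \<in> E \<Longrightarrow> K e \<le> K x" and r: "0 \<le> r"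
    and r': "r' = (if k < K x then r + 1 else r)"
  shows "ranked (insert x E) K (rk(x := r')) (K x) r'"
proof -
  have k: "k \<le> K x" if "E \<noteq> {}" using that R x(2) by (auto simp: ranked_def)
  have e: "K e \<le> K x \<and> 0 \<le> rk e \<and> rk e \<le> r' \<and> (K e < K x \<longleftrightarrow> rk e < r')" if "e \<in> E" for e
  proof -
    have "K e \<le> k \<and> 0 \<le> rk e \<and> rk e \<le> r \<and> (K e < k \<longleftrightarrow> rk e < r)"
      using R that by (auto simp: ranked_def)
    then show ?thesis using k that r' x(2)[OF that] by (cases "k < K x") auto
  qed
  have x': "\<not> K x < K y \<and> (K y < K x \<longleftrightarrow> rk y < r') \<and> \<not> r' < rk y \<and> y \<noteq> x" if "y \<in> E" for y
    using e[OF that] that x(1) by auto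
  show ?thesis
    unfolding ranked_def
  proof (intro conjI ballI)
    fix y z assume yz: "y \<in> insert x E" "z \<in> insert x E"
    show "K y < K z \<longleftrightarrow> (rk(x := r')) y < (rk(x := r')) z"
    proof (cases "y = x \<or> z = x")
      case True
      then show ?thesis using yz x' by fastforce
    next
      case False
      then show ?thesis using yz R by (simp add: ranked_def)
    qed
  next
    fix y assume y: "y \<in> insert x E"
    show "K y \<le> K x" "0 \<le> (rk(x := r')) y" "(rk(x := r')) y \<le> r'"
      "K y < K x \<longleftrightarrow> (rk(x := r')) y < r'"
      using y e r r' by auto
  qed simp
qed

text \<open>\<open>p\<close> lists the indices in the order of their keys, and \<open>rk\<close>
  reflects strict comparison, so equal keys have equal ranks. The bound on ranks includes
  \<open>M\<close> because ranks may start at 1.\<close>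

definition sorts :: "nat \<Rightarrow> (int \<Rightarrow> int) \<Rightarrow> (int \<Rightarrow> int) \<Rightarrow> (int \<Rightarrow> int) \<Rightarrow> bool" where
  "sorts M K p rk \<longleftrightarrow> p ` {0..<int M} = {0..<int M} \<and>
     (\<forall>k k'. 0 \<le> k \<longrightarrow> k \<le> k' \<longrightarrow> k' < int M \<longrightarrow> K (p k) \<le> K (p k')) \<and>
     (\<forall>x\<in>{0..<int M}. 0 \<le> rk x \<and> rk x \<le> int M) \<and>
     (\<forall>x\<in>{0..<int M}. \<forall>y\<in>{0..<int M}. K x < K y \<longleftrightarrow> rk x < rk y)"

text \<open>
  The start value of \<open>prev\<close> is irrelevant: it only decides whether the ranks start at 0 or at 1.
\<close>

definition extract_all :: prog where
  "extract_all =
     (Assign ''i'' (Const 0) ;; Assign ''rank'' (Const 0) ;; Assign ''prev'' (Const 0) ;; Assign ''y'' (Const 0)) ;;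
     While (Less (Const 0) (Load ''w'' (Const 1)))
       ((Assign ''x'' (Minus (Load ''w'' (Const 1)) (Const 1)) ;;
         Store ''p'' (Reg ''i'') (Reg ''x'') ;;
         If (Less (Reg ''prev'') (Load ''K'' (Reg ''x'')))
           (Assign ''rank'' (Plus (Reg ''rank'') (Const 1))) Skip ;;
         Assign ''prev'' (Load ''K'' (Reg ''x'')) ;;
         Store ''rk'' (Reg ''x'') (Reg ''rank'') ;;
         Assign ''i'' (Plus (Reg ''i'') (Const 1))) ;;
        set_leaf)"

lemma written_extract_all [simp]:
  "regs_of extract_all = {''i'', ''rank'', ''prev'', ''x'', ''y'', ''u'', ''f'', ''g''}"
  "arrays_of extract_all = {''p'', ''rk'', ''w''}"
  by (auto simp: extract_all_def)

lemma run_extract_all: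
  assumes T: "tables L s" and W: "tournament L (arrays s ''K'') (arrays s ''w'') {0..<int M}"
    and M: "int M < 2 ^ L"
  shows "run extract_all s ((M + 1) * (200 * (L + 2)))
    (\<lambda>s'. sorts M (arrays s ''K'') (arrays s' ''p'') (arrays s' ''rk''))"
proof -
  let ?K = "arrays s ''K''"
  let ?i0 = "Assign ''i'' (Const 0) ;; Assign ''rank'' (Const 0) ;; Assign ''prev'' (Const 0) ;; Assign ''y'' (Const 0)"
  let ?a = "Assign ''x'' (Minus (Load ''w'' (Const 1)) (Const 1)) ;;
         Store ''p'' (Reg ''i'') (Reg ''x'') ;;
         If (Less (Reg ''prev'') (Load ''K'' (Reg ''x'')))
           (Assign ''rank'' (Plus (Reg ''rank'') (Const 1))) Skip ;;
         Assign ''prev'' (Load ''K'' (Reg ''x'')) ;;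
         Store ''rk'' (Reg ''x'') (Reg ''rank'') ;;
         Assign ''i'' (Plus (Reg ''i'') (Const 1))"
  \<comment> \<open>\<open>E\<close> has been extracted and \<open>B\<close> is still in the
    tournament. The cardinality says that each round removes a new index, which bounds the number of
    rounds and fixes the final value of \<open>i\<close>.\<close>
  define J where "J i p rk w k r \<longleftrightarrow> (let E = p ` {0..<i}; B = {0..<int M} - E in
      E \<subseteq> {0..<int M} \<and> tournament L ?K w B \<and> ranked E ?K rk k r \<and> 0 \<le> r \<and> r \<le> i \<and>
      (\<forall>x\<in>E. \<forall>y\<in>B. ?K x \<le> ?K y) \<and>
      (\<forall>k k'. 0 \<le> k \<longrightarrow> k \<le> k' \<longrightarrow> k' < i \<longrightarrow> ?K (p k) \<le> ?K (p k')) \<and>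
      card B + nat i = M \<and> 0 \<le> i)" for i p rk w k r
  define I where "I n s' \<longleftrightarrow> J (regs s' ''i'') (arrays s' ''p'') (arrays s' ''rk'') (arrays s' ''w'')
      (regs s' ''prev'') (regs s' ''rank'') \<and> nat (regs s' ''i'') + n = M" for n and s' :: state
  show ?thesis unfolding extract_all_def
  proof (rule run_loop_free_seq, simp, rule run_while_inv[where I = I and n = M and t = "80 * (L + 2) + 50"])
    show "I M (result ?i0 s)" using W by (simp add: I_def J_def ranked_def)
  next
    fix n and s' :: state
    assume i: "I n s'" and t: "test_val (Less (Const 0) (Load ''w'' (Const 1))) s'"
      and o: "same_outside (?a ;; set_leaf) (result ?i0 s) s'"
    define s1 where "s1 = result ?a s'"
    let ?i = "regs s' ''i''" and ?p = "arrays s' ''p''"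
    define x where "x = arrays s' ''w'' 1 - 1"
    define r where "r = (if regs s' ''prev'' < ?K x then regs s' ''rank'' + 1 else regs s' ''rank'')"
    define E where "E = ?p ` {0..<?i}"
    define B where "B = {0..<int M} - E"
    \<comment> \<open>\<open>y\<close> is set to 0 before the loop and never written in the body, so
      every call of \<open>set_leaf\<close> empties a leaf.\<close>
    have o': "arrays s' ''K'' = ?K" "tables L s'" "regs s' ''y'' = 0"
      using o T by (simp_all add: same_outside_def tables_def)
    have j: "E \<subseteq> {0..<int M}" "tournament L ?K (arrays s' ''w'') B"
      "ranked E ?K (arrays s' ''rk'') (regs s' ''prev'') (regs s' ''rank'')"
      "0 \<le> regs s' ''rank''" "regs s' ''rank'' \<le> ?i"
      "\<And>x y. x \<in> E \<Longrightarrow> y \<in> B \<Longrightarrow> ?K x \<le> ?K y"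
      "\<And>k k'. 0 \<le> k \<Longrightarrow> k \<le> k' \<Longrightarrow> k' < ?i \<Longrightarrow> ?K (?p k) \<le> ?K (?p k')"
      "card B + nat ?i = M" "0 \<le> ?i" "nat ?i + n = M"
      using i unfolding I_def J_def Let_def E_def[symmetric] B_def[symmetric] by blast+
    have pos: "(1::int) \<le> 2 ^ L" by simp
    have xB: "x \<in> B" using tournament_winner_mem[OF j(2), of 1] t pos by (auto simp: x_def)
    have xle: "?K x \<le> ?K y" if "y \<in> B" for y using tournament_root(3)[OF j(2) that] by (simp add: x_def)
    have xM: "0 \<le> x" "x < int M" "x \<notin> E" using xB by (auto simp: B_def)
    have E': "(?p(?i := x)) ` {0..<?i + 1} = insert x E"
      using j(9) by (auto simp: E_def ivl_Suc)
    have B': "{0..<int M} - insert x E = B - {x}" by (auto simp: B_def)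
    have "finite B" by (simp add: B_def)
    then have cB: "0 < card B" using xB by (auto simp: card_gt_0_iff)
    then have n: "0 < n" using j(8,10) by linarith
    have s: "regs s1 ''x'' = x" "regs s1 ''y'' = 0" "regs s1 ''i'' = ?i + 1" "regs s1 ''rank'' = r"
      "regs s1 ''prev'' = ?K x" "arrays s1 ''p'' = ?p(?i := x)" "arrays s1 ''rk'' = (arrays s' ''rk'')(x := r)"
      "arrays s1 ''w'' = arrays s' ''w''" "arrays s1 ''K'' = ?K" "tables L s1"
      using o' unfolding s1_def by (simp_all add: x_def r_def tables_def)
    have BL: "B \<subseteq> {0..<2 ^ L}" using j(2) by (simp add: tournament_def)
    then have xL: "0 \<le> x" "x < 2 ^ L" using xB by auto
    have "run set_leaf s1 (80 * (L + 2)) (\<lambda>s2. tournament L (arrays s1 ''K'') (arrays s2 ''w'') (B - {x}))"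
      by (rule run_set_leaf[where B = B]) (use j(2) xB xL BL s in auto)
    then have "run set_leaf s1 (80 * (L + 2)) (I (n - 1))"
    proof (rule run_conseq)
      fix s2 :: state
      assume w: "tournament L (arrays s1 ''K'') (arrays s2 ''w'') (B - {x})" and o2: "same_outside set_leaf s1 s2"
      have s2: "regs s2 ''i'' = ?i + 1" "regs s2 ''rank'' = r" "regs s2 ''prev'' = ?K x"
        "arrays s2 ''p'' = ?p(?i := x)" "arrays s2 ''rk'' = (arrays s' ''rk'')(x := r)"
        using o2 s by (auto simp: same_outside_def)
      show "I (n - 1) s2"
        unfolding I_def J_def Let_def s2 E' B'
      proof (intro conjI)
        show "ranked (insert x E) ?K ((arrays s' ''rk'')(x := r)) (?K x) r"
          by (rule ranked_step[OF j(3) xM(3) _ j(4)]) (use j(6) xB r_def in auto)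
        show "\<forall>xa\<in>insert x E. \<forall>y\<in>B - {x}. ?K xa \<le> ?K y" using j(6) xle by auto
        show "\<forall>k k'. 0 \<le> k \<longrightarrow> k \<le> k' \<longrightarrow> k' < ?i + 1 \<longrightarrow> ?K ((?p(?i := x)) k) \<le> ?K ((?p(?i := x)) k')"
          using j(7) j(6)[OF _ xB] by (auto simp: E_def)
        have "card (B - {x}) = card B - 1" using xB by simp
        then show "card (B - {x}) + nat (?i + 1) = M" using n j(8-10) by linarith
      qed (use w s(9) j(1,4,5,9,10) xM n in \<open>auto simp: r_def\<close>)
    qed simp
    then have "run (?a ;; set_leaf) s' (80 * (L + 2) + 50) (I (n - 1))"
      unfolding s1_def by (rule run_loop_free_seq[rotated]) auto
    then show "\<exists>m<n. run (?a ;; set_leaf) s' (80 * (L + 2) + 50) (I m)"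
      using n by (intro exI[of _ "n - 1"]) auto
  next
    fix n and s' :: state
    assume i: "I n s'" and t: "\<not> test_val (Less (Const 0) (Load ''w'' (Const 1))) s'"
    let ?i = "regs s' ''i''" and ?p = "arrays s' ''p''"
    define E where "E = ?p ` {0..<?i}"
    define B where "B = {0..<int M} - E"
    have j: "E \<subseteq> {0..<int M}" "tournament L ?K (arrays s' ''w'') B"
      "ranked E ?K (arrays s' ''rk'') (regs s' ''prev'') (regs s' ''rank'')"
      "regs s' ''rank'' \<le> ?i"
      "\<forall>k k'. 0 \<le> k \<longrightarrow> k \<le> k' \<longrightarrow> k' < ?i \<longrightarrow> ?K (?p k) \<le> ?K (?p k')"
      "card B + nat ?i = M" "0 \<le> ?i"
      using i unfolding I_def J_def Let_def E_def[symmetric] B_def[symmetric] by blast+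
    \<comment> \<open>A nonempty tournament has a positive root, so the failing loop test means that
      every leaf has been removed.\<close>
    have "B = {}" using tournament_root(1)[OF j(2)] t by fastforce
    then have E: "E = {0..<int M}" and iM: "?i = int M" using j(1,6,7) by (auto simp: B_def)
    show "sorts M ?K (arrays s' ''p'') (arrays s' ''rk'')"
      unfolding sorts_def
    proof (intro conjI)
      show "?p ` {0..<int M} = {0..<int M}" using E iM by (simp add: E_def)
      show "\<forall>x\<in>{0..<int M}. 0 \<le> arrays s' ''rk'' x \<and> arrays s' ''rk'' x \<le> int M"
        using j(3,4) unfolding ranked_def E iM by force
      show "\<forall>x\<in>{0..<int M}. \<forall>y\<in>{0..<int M}. ?K x < ?K y \<longleftrightarrow> arrays s' ''rk'' x < arrays s' ''rk'' y"
        using j(3) unfolding ranked_def E by blast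
    qed (use j(5) iM in simp)
  next
    have "max_cost ?i0 + (M * (80 * (L + 2) + 55) + 5) \<le> (M + 1) * (80 * (L + 2) + 55)"
      by simp
    also have "\<dots> \<le> (M + 1) * (200 * (L + 2))" by (intro mult_le_mono) auto
    finally show "max_cost ?i0 + (M * (80 * (L + 2) + 55) + 5) \<le> (M + 1) * (200 * (L + 2))" .
  qed simp
qed


section \<open>The sweep over the right endpoints\<close>

text \<open>
  The keys form five blocks of length \<open>length A\<close>: \<open>b\<close>, \<open>a\<close>, \<open>d\<close>, \<open>c\<close> and the diagonals \<open>a - c\<close>. Ranks
  of different kinds are thus comparable, and the order of the first block is the order of the sweep.
\<close>

locale sorted_anchors = equal_length_anchors +
  fixes L :: nat and K p rk :: "int \<Rightarrow> int"
  assumes sorts: "sorts (5 * length A) K p rk"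
    and size: "int (5 * length A) < 2 ^ L"
    and keys: "i < length A \<Longrightarrow> K (int i) = \<beta> i" "i < length A \<Longrightarrow> K (int (length A + i)) = \<alpha> i"
      "i < length A \<Longrightarrow> K (int (2 * length A + i)) = \<delta> i"
      "i < length A \<Longrightarrow> K (int (3 * length A + i)) = \<gamma> i"
      "i < length A \<Longrightarrow> K (int (4 * length A + i)) = \<alpha> i - \<gamma> i"
begin

definition "rank_b i = rk (int i)"
definition "rank_a i = rk (int (length A + i))"
definition "rank_d i = rk (int (2 * length A + i))"
definition "rank_c i = rk (int (3 * length A + i))"
definition "rank_s i = rk (int (4 * length A + i))"

text \<open>
  The largest key is added to stored values and subtracted from query results, so that an empty
  query contributes at most \<open>0\<close>, which is harmless.
\<close>

definition "big = K (p (int (5 * length A) - 1))"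

lemma key_le_big:
  assumes "0 \<le> x" "x < int (5 * length A)" shows "K x \<le> big"
proof -
  have "x \<in> p ` {0..<int (5 * length A)}" using sorts assms unfolding sorts_def by auto
  then obtain k where "0 \<le> k" "k < int (5 * length A)" "x = p k" by auto
  then show ?thesis using sorts unfolding sorts_def big_def by auto
qed

lemma start_le_big: "i < length A \<Longrightarrow> \<alpha> i \<le> big \<and> \<gamma> i \<le> big"
  using key_le_big[of "int (length A + i)"] key_le_big[of "int (3 * length A + i)"] keys(2,4)[of i] by simp

lemma rank_bounds:
  assumes "0 \<le> x" "x < int (5 * length A)" shows "0 \<le> rk x" "rk x < 2 ^ L"
proof -
  have "0 \<le> rk x \<and> rk x \<le> int (5 * length A)" using sorts assms unfolding sorts_def by simp
  then show "0 \<le> rk x" "rk x < 2 ^ L" using size by linarith+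
qed

lemma ranks_bounds:
  assumes "i < length A"
  shows "0 \<le> rank_a i" "rank_a i < 2 ^ L" "0 \<le> rank_b i" "rank_b i < 2 ^ L" "0 \<le> rank_c i" "rank_c i < 2 ^ L"
    "0 \<le> rank_d i" "rank_d i < 2 ^ L" "0 \<le> rank_s i" "rank_s i < 2 ^ L"
  unfolding rank_a_def rank_b_def rank_c_def rank_d_def rank_s_def
  using assms by (auto intro!: rank_bounds)

lemma rank_less:
  assumes "x < 5 * length A" "y < 5 * length A" shows "rk (int x) < rk (int y) \<longleftrightarrow> K (int x) < K (int y)"
  using sorts assms unfolding sorts_def by simp

lemma ranks_less:
  assumes i: "i < length A" and j: "j < length A"
  shows "rank_b i < rank_a j \<longleftrightarrow> \<beta> i < \<alpha> j" "rank_b i < rank_b j \<longleftrightarrow> \<beta> i < \<beta> j"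
    "rank_d i < rank_c j \<longleftrightarrow> \<delta> i < \<gamma> j" "rank_d i < rank_d j \<longleftrightarrow> \<delta> i < \<delta> j"
    "rank_s i < rank_s j \<longleftrightarrow> \<alpha> i - \<gamma> i < \<alpha> j - \<gamma> j"
  unfolding rank_a_def rank_b_def rank_c_def rank_d_def rank_s_def
  using i j by (simp_all add: rank_less keys del: of_nat_add of_nat_mult)

lemma ranks_le:
  assumes i: "i < length A" and j: "j < length A"
  shows "rank_a j \<le> rank_b i \<longleftrightarrow> \<alpha> j \<le> \<beta> i" "rank_c j \<le> rank_d i \<longleftrightarrow> \<gamma> j \<le> \<delta> i"
    "rank_s j \<le> rank_s i \<longleftrightarrow> \<alpha> j - \<gamma> j \<le> \<alpha> i - \<gamma> i"
  using ranks_less[OF i j] by linarith+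

text \<open>The weights are the summands of the recurrence that depend on \<open>i\<close> only. In
  the first two sets, \<alpha> j or \<gamma> j is added and \<open>big\<close> subtracted when the
  query result is known.\<close>

definition "points1 D = (\<lambda>i. (rank_s i, rank_b i, score A i - \<alpha> i + big)) ` D"
definition "points2 D = (\<lambda>i. (rank_s i, rank_d i, score A i - \<gamma> i + big)) ` D"
definition "points3 D = (\<lambda>i. (rank_b i, rank_d i, score A i + len (A ! i))) ` D"

definition trees :: "nat set \<Rightarrow> state \<Rightarrow> bool" where
  "trees D s \<longleftrightarrow> stores L (arrays s ''t1'') (points1 D) \<and> stores L (arrays s ''t2'') (points2 D) \<and>
     stores L (arrays s ''t3'') (points3 D)"

definition ready :: "state \<Rightarrow> bool" where
  "ready s \<longleftrightarrow> tables L s \<and> regs s ''big'' = big \<and>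
     regs s ''n'' = int (length A) \<and> regs s ''n2'' = int (2 * length A) \<and> regs s ''n3'' = int (3 * length A) \<and>
     regs s ''n4'' = int (4 * length A) \<and> regs s ''m'' = int (5 * length A) \<and>
     arrays s ''p'' = p \<and> arrays s ''rk'' = rk \<and>
     (\<forall>i<length A. arrays s ''a'' (int i) = \<alpha> i \<and> arrays s ''b'' (int i) = \<beta> i \<and>
        arrays s ''c'' (int i) = \<gamma> i \<and> arrays s ''d'' (int i) = \<delta> i)"

definition loaded :: "nat \<Rightarrow> state \<Rightarrow> bool" where
  "loaded j s \<longleftrightarrow> ready s \<and> j < length A \<and> regs s ''cur'' = int j \<and> regs s ''ra'' = rank_a j \<and>
     regs s ''rb'' = rank_b j \<and> regs s ''rc'' = rank_c j \<and> regs s ''rd'' = rank_d j \<and> regs s ''rs'' = rank_s j"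

lemma ready_same_outside:
  assumes "ready s" "same_outside c s s'"
    "regs_of c \<inter> {''z'', ''big'', ''n'', ''n2'', ''n3'', ''n4'', ''m''} = {}"
    "arrays_of c \<inter> {''half'', ''row'', ''p'', ''rk'', ''a'', ''b'', ''c'', ''d''} = {}"
  shows "ready s'"
  using assms unfolding ready_def same_outside_def tables_def by (auto simp: disjoint_iff)

lemma loaded_same_outside:
  assumes "loaded j s" "same_outside c s s'"
    "regs_of c \<inter> {''z'', ''big'', ''n'', ''n2'', ''n3'', ''n4'', ''m''} = {}"
    "regs_of c \<inter> {''cur'', ''ra'', ''rb'', ''rc'', ''rd'', ''rs''} = {}"
    "arrays_of c \<inter> {''half'', ''row'', ''p'', ''rk'', ''a'', ''b'', ''c'', ''d''} = {}"
  shows "loaded j s'"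
  using assms ready_same_outside[of s c s'] unfolding loaded_def same_outside_def
  by (auto simp: disjoint_iff)

lemma trees_same_outside:
  assumes "trees D s" "same_outside c s s'" "arrays_of c \<inter> {''t1'', ''t2'', ''t3''} = {}"
  shows "trees D s'"
  using assms unfolding trees_def same_outside_def by (auto simp: disjoint_iff)

lemma loadedD:
  assumes "loaded j s"
  shows "regs s ''z'' = 2 ^ L" "tables L s" "regs s ''big'' = big" "regs s ''cur'' = int j" "regs s ''ra'' = rank_a j"
    "regs s ''rb'' = rank_b j" "regs s ''rc'' = rank_c j" "regs s ''rd'' = rank_d j" "regs s ''rs'' = rank_s j"
    "arrays s ''a'' (int j) = \<alpha> j" "arrays s ''b'' (int j) = \<beta> j"
    "arrays s ''c'' (int j) = \<gamma> j" "arrays s ''d'' (int j) = \<delta> j" "j < length A"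
  using assms by (auto simp: loaded_def ready_def tables_def)

abbreviation (input) "cands1 D j \<equiv> {score A i - \<alpha> i + big |i. i \<in> D \<and>
   \<alpha> j - \<gamma> j \<le> \<alpha> i - \<gamma> i \<and> \<alpha> j \<le> \<beta> i \<and> \<beta> i < \<beta> j}"
abbreviation (input) "cands2 D j \<equiv> {score A i - \<gamma> i + big |i. i \<in> D \<and>
   \<alpha> i - \<gamma> i \<le> \<alpha> j - \<gamma> j \<and> \<gamma> j \<le> \<delta> i \<and> \<delta> i < \<delta> j}"
abbreviation (input) "cands3 D j \<equiv> {score A i + len (A ! i) |i. i \<in> D \<and> \<beta> i < \<alpha> j \<and> \<delta> i < \<gamma> j}"

text \<open>Ranks turn the conditions on endpoints into half-open intervals. The diagonal is bounded
  on one side only: the first query extends to the end \<open>2 ^ L\<close> of the leaves, and the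
  second has the end \<open>rank_s j + 1\<close> because equality of diagonals is allowed.\<close>

lemma cands_points:
  assumes D: "D \<subseteq> {..<length A}" and j: "j < length A"
  shows "{w. \<exists>x y. (x, y, w) \<in> points1 D \<and> rank_s j \<le> x \<and> x < 2 ^ L \<and> rank_a j \<le> y \<and> y < rank_b j} = cands1 D j"
    "{w. \<exists>x y. (x, y, w) \<in> points2 D \<and> 0 \<le> x \<and> x < rank_s j + 1 \<and> rank_c j \<le> y \<and> y < rank_d j} = cands2 D j"
    "{w. \<exists>x y. (x, y, w) \<in> points3 D \<and> 0 \<le> x \<and> x < rank_a j \<and> 0 \<le> y \<and> y < rank_c j} = cands3 D j"
proof -
  have i: "i < length A" if "i \<in> D" for i using that D by auto
  have image: "{w. \<exists>x y. (x, y, w) \<in> (\<lambda>i. (f i, g i, h i)) ` D \<and> P x y} = {h i |i. i \<in> D \<and> Q i}"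
    if "\<And>i. i \<in> D \<Longrightarrow> P (f i) (g i) \<longleftrightarrow> Q i"
    for f g h :: "nat \<Rightarrow> int" and P and Q :: "nat \<Rightarrow> bool"
    using that by blast
  show "{w. \<exists>x y. (x, y, w) \<in> points1 D \<and> rank_s j \<le> x \<and> x < 2 ^ L \<and> rank_a j \<le> y \<and> y < rank_b j} = cands1 D j"
    unfolding points1_def
  proof (rule image)
    fix k assume "k \<in> D"
    from i[OF this] show "(rank_s j \<le> rank_s k \<and> rank_s k < 2 ^ L \<and> rank_a j \<le> rank_b k \<and> rank_b k < rank_b j) =
      (\<alpha> j - \<gamma> j \<le> \<alpha> k - \<gamma> k \<and> \<alpha> j \<le> \<beta> k \<and> \<beta> k < \<beta> j)"
      using ranks_less[of k j] ranks_le[of k j] ranks_bounds[of k] j by simp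
  qed
  show "{w. \<exists>x y. (x, y, w) \<in> points2 D \<and> 0 \<le> x \<and> x < rank_s j + 1 \<and> rank_c j \<le> y \<and> y < rank_d j} = cands2 D j"
    unfolding points2_def
  proof (rule image)
    fix k assume "k \<in> D"
    from i[OF this] have k: "k < length A" .
    have "rank_s k < rank_s j + 1 \<longleftrightarrow> \<alpha> k - \<gamma> k \<le> \<alpha> j - \<gamma> j"
      using ranks_le(3)[OF j k] by auto
    then show "(0 \<le> rank_s k \<and> rank_s k < rank_s j + 1 \<and> rank_c j \<le> rank_d k \<and> rank_d k < rank_d j) =
      (\<alpha> k - \<gamma> k \<le> \<alpha> j - \<gamma> j \<and> \<gamma> j \<le> \<delta> k \<and> \<delta> k < \<delta> j)"
      using ranks_less[OF k j] ranks_le[OF k j] ranks_bounds[OF k] by simp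
  qed
  show "{w. \<exists>x y. (x, y, w) \<in> points3 D \<and> 0 \<le> x \<and> x < rank_a j \<and> 0 \<le> y \<and> y < rank_c j} = cands3 D j"
    unfolding points3_def
  proof (rule image)
    fix k assume "k \<in> D"
    from i[OF this] show "(0 \<le> rank_b k \<and> rank_b k < rank_a j \<and> 0 \<le> rank_d k \<and> rank_d k < rank_c j) =
      (\<beta> k < \<alpha> j \<and> \<delta> k < \<gamma> j)"
      using ranks_less[of k j] ranks_bounds[of k] j by simp
  qed
qed

end

section \<open>The three queries and three insertions for one anchor\<close>

definition query1 :: prog where
  "query1 =
     (Assign ''p1'' (Reg ''rs'') ;; Assign ''q1'' (Reg ''z'') ;;
      Assign ''p2'' (Reg ''ra'') ;; Assign ''q2'' (Reg ''rb'')) ;;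
     tree_query ''t1'' ;;
     Assign ''acc'' (Minus (Plus (Reg ''q'') (Load ''a'' (Reg ''cur''))) (Reg ''big''))"

definition query2 :: prog where
  "query2 =
     (Assign ''p1'' (Const 0) ;; Assign ''q1'' (Plus (Reg ''rs'') (Const 1)) ;;
      Assign ''p2'' (Reg ''rc'') ;; Assign ''q2'' (Reg ''rd'')) ;;
     tree_query ''t2'' ;;
     (Assign ''q'' (Minus (Plus (Reg ''q'') (Load ''c'' (Reg ''cur''))) (Reg ''big'')) ;;
      If (Less (Reg ''acc'') (Reg ''q'')) (Assign ''acc'' (Reg ''q'')) Skip)"

definition query3 :: prog where
  "query3 =
     (Assign ''p1'' (Const 0) ;; Assign ''q1'' (Reg ''ra'') ;;
      Assign ''p2'' (Const 0) ;; Assign ''q2'' (Reg ''rc'')) ;;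
     tree_query ''t3'' ;;
     If (Less (Reg ''acc'') (Reg ''q'')) (Assign ''acc'' (Reg ''q'')) Skip"

text \<open>Score plus length is both the answer for this anchor and its weight in the third tree.
  It is written to \<open>out\<close> here, and \<open>insert3\<close> reads it from there.\<close>

definition insert1 :: prog where
  "insert1 =
     (Store ''out'' (Reg ''cur'')
        (Plus (Minus (Plus (Reg ''acc'') (Load ''b'' (Reg ''cur''))) (Load ''a'' (Reg ''cur''))) (Const 1)) ;;
      Assign ''p1'' (Reg ''rs'') ;; Assign ''p2'' (Reg ''rb'') ;;
      Assign ''v'' (Plus (Minus (Reg ''acc'') (Load ''a'' (Reg ''cur''))) (Reg ''big''))) ;;
     tree_insert ''t1''"

definition insert2 :: prog where
  "insert2 =
     (Assign ''p1'' (Reg ''rs'') ;; Assign ''p2'' (Reg ''rd'') ;;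
      Assign ''v'' (Plus (Minus (Reg ''acc'') (Load ''c'' (Reg ''cur''))) (Reg ''big''))) ;;
     tree_insert ''t2''"

definition insert3 :: prog where
  "insert3 =
     (Assign ''p1'' (Reg ''rb'') ;; Assign ''p2'' (Reg ''rd'') ;;
      Assign ''v'' (Load ''out'' (Reg ''cur''))) ;;
     tree_insert ''t3''"

lemma written_queries [simp]:
  "regs_of query1 = {''p1'', ''q1'', ''p2'', ''q2'', ''l'', ''r'', ''mp'', ''mq'', ''q'', ''i'', ''base'', ''j'', ''k'', ''acc''}"
  "arrays_of query1 = {''P'', ''Q''}"
  "regs_of query2 = {''p1'', ''q1'', ''p2'', ''q2'', ''l'', ''r'', ''mp'', ''mq'', ''q'', ''i'', ''base'', ''j'', ''k'', ''acc''}"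
  "arrays_of query2 = {''P'', ''Q''}"
  "regs_of query3 = {''p1'', ''q1'', ''p2'', ''q2'', ''l'', ''r'', ''mp'', ''mq'', ''q'', ''i'', ''base'', ''j'', ''k'', ''acc''}"
  "arrays_of query3 = {''P'', ''Q''}"
  by (auto simp: query1_def query2_def query3_def)

lemma written_inserts [simp]:
  "regs_of insert1 = {''p1'', ''p2'', ''v'', ''u'', ''mp'', ''mq'', ''i'', ''base'', ''j'', ''k''}"
  "arrays_of insert1 = {''out'', ''t1'', ''P'', ''Q''}"
  "regs_of insert2 = {''p1'', ''p2'', ''v'', ''u'', ''mp'', ''mq'', ''i'', ''base'', ''j'', ''k''}"
  "arrays_of insert2 = {''t2'', ''P'', ''Q''}"
  "regs_of insert3 = {''p1'', ''p2'', ''v'', ''u'', ''mp'', ''mq'', ''i'', ''base'', ''j'', ''k''}"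
  "arrays_of insert3 = {''t3'', ''P'', ''Q''}"
  by (auto simp: insert1_def insert2_def insert3_def)

lemma run_query_between:
  assumes a: "loop_free a" "max_cost a \<le> 50" and b: "loop_free b" "max_cost b \<le> 50"
    and T: "tables L (result a s)" and S: "stores L (arrays (result a s) X) S"
    and p: "0 \<le> regs (result a s) ''p1''" "regs (result a s) ''p1'' < 2 ^ L"
      "0 \<le> regs (result a s) ''q1''" "regs (result a s) ''q1'' \<le> 2 ^ L"
      "0 \<le> regs (result a s) ''p2''" "regs (result a s) ''p2'' < 2 ^ L"
      "0 \<le> regs (result a s) ''q2''" "regs (result a s) ''q2'' \<le> 2 ^ L"
    and X: "X \<notin> {''P'', ''Q''}"
    and R: "\<And>s'. is_max0 {w. \<exists>x y. (x, y, w) \<in> S \<and> regs (result a s) ''p1'' \<le> x \<and> x < regs (result a s) ''q1'' \<and>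
       regs (result a s) ''p2'' \<le> y \<and> y < regs (result a s) ''q2''} (regs s' ''q'') \<Longrightarrow>
       same_outside (tree_query X) (result a s) s' \<Longrightarrow> R (result b s')"
  shows "run (a ;; tree_query X ;; b) s (700 * (L + 2) * (L + 2)) R"
proof (rule run_loop_free_seq[OF a(1)])
  show "run (tree_query X ;; b) (result a s) (600 * (L + 2) * (L + 2) + 50) R"
    by (rule run_seq, rule run_conseq[OF run_tree_query[OF T S p X] _ order_refl])
      (use b R in \<open>auto intro: run_loop_free\<close>)
  show "max_cost a + (600 * (L + 2) * (L + 2) + 50) \<le> 700 * (L + 2) * (L + 2)"
    using a(2) by (simp add: algebra_simps)
qed

context sorted_anchors begin

lemma run_query1:
  assumes l: "loaded j s" and t: "trees D s" and D: "D \<subseteq> {..<length A}"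
  shows "run query1 s (700 * (L + 2) * (L + 2))
    (\<lambda>s'. \<exists>q. is_max0 (cands1 D j) q \<and> regs s' ''acc'' = q + \<alpha> j - big)"
  unfolding query1_def
proof (rule run_query_between[where S = "points1 D"])
  note d = loadedD[OF l]
  let ?a = "Assign ''p1'' (Reg ''rs'') ;; Assign ''q1'' (Reg ''z'') ;;
      Assign ''p2'' (Reg ''ra'') ;; Assign ''q2'' (Reg ''rb'')"
  show "tables L (result ?a s)" using d(2) by (simp add: tables_def)
  show "stores L (arrays (result ?a s) ''t1'') (points1 D)" using t by (simp add: trees_def)
  fix s'
  assume "is_max0 {w. \<exists>x y. (x, y, w) \<in> points1 D \<and> regs (result ?a s) ''p1'' \<le> x \<and>
      x < regs (result ?a s) ''q1'' \<and> regs (result ?a s) ''p2'' \<le> y \<and> y < regs (result ?a s) ''q2''} (regs s' ''q'')"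
    and o: "same_outside (tree_query ''t1'') (result ?a s) s'"
  then have "is_max0 (cands1 D j) (regs s' ''q'')" using d cands_points(1)[OF D d(14)] by simp
  then show "\<exists>q. is_max0 (cands1 D j) q \<and>
    regs (result (Assign ''acc'' (Minus (Plus (Reg ''q'') (Load ''a'' (Reg ''cur''))) (Reg ''big''))) s') ''acc''
      = q + \<alpha> j - big"
    using o d by (intro exI[of _ "regs s' ''q''"]) (simp add: same_outside_def)
qed (use loadedD[OF l] ranks_bounds[OF loadedD(14)[OF l]] in \<open>simp_all add: less_imp_le\<close>)

lemma run_query2:
  assumes l: "loaded j s" and t: "trees D s" and D: "D \<subseteq> {..<length A}"
  shows "run query2 s (700 * (L + 2) * (L + 2))
    (\<lambda>s'. \<exists>q. is_max0 (cands2 D j) q \<and> regs s' ''acc'' = max (regs s ''acc'') (q + \<gamma> j - big))"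
  unfolding query2_def
proof (rule run_query_between[where S = "points2 D"])
  note d = loadedD[OF l]
  let ?a = "Assign ''p1'' (Const 0) ;; Assign ''q1'' (Plus (Reg ''rs'') (Const 1)) ;;
      Assign ''p2'' (Reg ''rc'') ;; Assign ''q2'' (Reg ''rd'')"
  show "tables L (result ?a s)" using d(2) by (simp add: tables_def)
  show "stores L (arrays (result ?a s) ''t2'') (points2 D)" using t by (simp add: trees_def)
  fix s'
  assume "is_max0 {w. \<exists>x y. (x, y, w) \<in> points2 D \<and> regs (result ?a s) ''p1'' \<le> x \<and>
      x < regs (result ?a s) ''q1'' \<and> regs (result ?a s) ''p2'' \<le> y \<and> y < regs (result ?a s) ''q2''} (regs s' ''q'')"
    and o: "same_outside (tree_query ''t2'') (result ?a s) s'"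
  then have "is_max0 (cands2 D j) (regs s' ''q'')" using d cands_points(2)[OF D d(14)] by simp
  then show "\<exists>q. is_max0 (cands2 D j) q \<and>
    regs (result (Assign ''q'' (Minus (Plus (Reg ''q'') (Load ''c'' (Reg ''cur''))) (Reg ''big'')) ;;
      If (Less (Reg ''acc'') (Reg ''q'')) (Assign ''acc'' (Reg ''q'')) Skip) s') ''acc''
      = max (regs s ''acc'') (q + \<gamma> j - big)"
    using o d by (intro exI[of _ "regs s' ''q''"]) (simp add: same_outside_def max_def)
qed (use loadedD[OF l] ranks_bounds[OF loadedD(14)[OF l]] in \<open>simp_all add: less_imp_le\<close>)

lemma run_query3:
  assumes l: "loaded j s" and t: "trees D s" and D: "D \<subseteq> {..<length A}"
  shows "run query3 s (700 * (L + 2) * (L + 2))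
    (\<lambda>s'. \<exists>q. is_max0 (cands3 D j) q \<and> regs s' ''acc'' = max (regs s ''acc'') q)"
  unfolding query3_def
proof (rule run_query_between[where S = "points3 D"])
  note d = loadedD[OF l]
  let ?a = "Assign ''p1'' (Const 0) ;; Assign ''q1'' (Reg ''ra'') ;;
      Assign ''p2'' (Const 0) ;; Assign ''q2'' (Reg ''rc'')"
  show "tables L (result ?a s)" using d(2) by (simp add: tables_def)
  show "stores L (arrays (result ?a s) ''t3'') (points3 D)" using t by (simp add: trees_def)
  fix s'
  assume "is_max0 {w. \<exists>x y. (x, y, w) \<in> points3 D \<and> regs (result ?a s) ''p1'' \<le> x \<and>
      x < regs (result ?a s) ''q1'' \<and> regs (result ?a s) ''p2'' \<le> y \<and> y < regs (result ?a s) ''q2''} (regs s' ''q'')"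
    and o: "same_outside (tree_query ''t3'') (result ?a s) s'"
  then have "is_max0 (cands3 D j) (regs s' ''q'')" using d cands_points(3)[OF D d(14)] by simp
  then show "\<exists>q. is_max0 (cands3 D j) q \<and>
    regs (result (If (Less (Reg ''acc'') (Reg ''q'')) (Assign ''acc'' (Reg ''q'')) Skip) s') ''acc''
      = max (regs s ''acc'') q"
    using o d by (intro exI[of _ "regs s' ''q''"]) (simp add: same_outside_def max_def)
qed (use loadedD[OF l] ranks_bounds[OF loadedD(14)[OF l]] in \<open>simp_all add: less_imp_le\<close>)

lemma run_insert_after:
  assumes a: "loop_free a" "max_cost a \<le> 50"
    and T: "tables L (result a s)" and S: "stores L (arrays (result a s) X) S"
    and p: "0 \<le> regs (result a s) ''p1''" "regs (result a s) ''p1'' < 2 ^ L"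
      "0 \<le> regs (result a s) ''p2''" "regs (result a s) ''p2'' < 2 ^ L"
    and X: "X \<notin> {''P'', ''Q'', ''half'', ''row''}"
    and R: "\<And>s'. stores L (arrays s' X)
        (insert (regs (result a s) ''p1'', regs (result a s) ''p2'', regs (result a s) ''v'') S) \<Longrightarrow>
       same_outside (tree_insert X) (result a s) s' \<Longrightarrow> R s'"
  shows "run (a ;; tree_insert X) s (700 * (L + 2) * (L + 2)) R"
proof (rule run_loop_free_seq[OF a(1)])
  show "run (tree_insert X) (result a s) (600 * (L + 2) * (L + 2)) R"
    by (rule run_conseq[OF run_tree_insert[OF T S p X] _ order_refl]) (use R in blast)
  show "max_cost a + 600 * (L + 2) * (L + 2) \<le> 700 * (L + 2) * (L + 2)"
    using a(2) by (simp add: algebra_simps)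
qed

lemma points_insert:
  "points1 (insert j D) = insert (rank_s j, rank_b j, score A j - \<alpha> j + big) (points1 D)"
  "points2 (insert j D) = insert (rank_s j, rank_d j, score A j - \<gamma> j + big) (points2 D)"
  "points3 (insert j D) = insert (rank_b j, rank_d j, score A j + len (A ! j)) (points3 D)"
  by (simp_all add: points1_def points2_def points3_def)

lemma run_insert1:
  assumes l: "loaded j s" and t: "stores L (arrays s ''t1'') (points1 D)" and acc: "regs s ''acc'' = score A j"
  shows "run insert1 s (700 * (L + 2) * (L + 2))
    (\<lambda>s'. stores L (arrays s' ''t1'') (points1 (insert j D)) \<and>
       arrays s' ''out'' = (arrays s ''out'')(int j := score A j + len (A ! j)))"
proof -
  note d = loadedD[OF l]
  define a where "a = Store ''out'' (Reg ''cur'')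
        (Plus (Minus (Plus (Reg ''acc'') (Load ''b'' (Reg ''cur''))) (Load ''a'' (Reg ''cur''))) (Const 1)) ;;
      Assign ''p1'' (Reg ''rs'') ;; Assign ''p2'' (Reg ''rb'') ;;
      Assign ''v'' (Plus (Minus (Reg ''acc'') (Load ''a'' (Reg ''cur''))) (Reg ''big''))"
  have c: "loop_free a" "max_cost a \<le> 50" by (simp_all add: a_def)
  have r: "regs (result a s) ''p1'' = rank_s j" "regs (result a s) ''p2'' = rank_b j"
    "regs (result a s) ''v'' = score A j - \<alpha> j + big" "arrays (result a s) ''t1'' = arrays s ''t1''"
    "arrays (result a s) ''out'' = (arrays s ''out'')(int j := score A j + len (A ! j))"
    using d(3-11) acc by (simp_all add: a_def len_def add.assoc diff_add_eq add_diff_eq[symmetric])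
  have T: "tables L (result a s)" using d(2) by (simp add: a_def tables_def)
  show ?thesis
    unfolding insert1_def a_def[symmetric]
  proof (rule run_insert_after[OF c T, of "''t1''" "points1 D", unfolded r])
    fix s' assume "stores L (arrays s' ''t1'')
        (insert (rank_s j, rank_b j, score A j - \<alpha> j + big) (points1 D))"
      "same_outside (tree_insert ''t1'') (result a s) s'"
    then show "stores L (arrays s' ''t1'') (points1 (insert j D)) \<and>
       arrays s' ''out'' = (arrays s ''out'')(int j := score A j + len (A ! j))"
      using r(5) by (simp add: points_insert same_outside_def)
  qed (use t ranks_bounds[OF d(14)] in simp_all)
qed

lemma run_insert2:
  assumes l: "loaded j s" and t: "stores L (arrays s ''t2'') (points2 D)" and acc: "regs s ''acc'' = score A j"
  shows "run insert2 s (700 * (L + 2) * (L + 2))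
    (\<lambda>s'. stores L (arrays s' ''t2'') (points2 (insert j D)))"
proof -
  note d = loadedD[OF l]
  define a where "a = Assign ''p1'' (Reg ''rs'') ;; Assign ''p2'' (Reg ''rd'') ;;
      Assign ''v'' (Plus (Minus (Reg ''acc'') (Load ''c'' (Reg ''cur''))) (Reg ''big''))"
  have c: "loop_free a" "max_cost a \<le> 50" by (simp_all add: a_def)
  have r: "regs (result a s) ''p1'' = rank_s j" "regs (result a s) ''p2'' = rank_d j"
    "regs (result a s) ''v'' = score A j - \<gamma> j + big" "arrays (result a s) ''t2'' = arrays s ''t2''"
    using d(3-13) acc by (simp_all add: a_def)
  have T: "tables L (result a s)" using d(2) by (simp add: a_def tables_def)
  show ?thesis
    unfolding insert2_def a_def[symmetric] points_insert
    by (rule run_insert_after[OF c T, of "''t2''" "points2 D", unfolded r])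
      (use t ranks_bounds[OF d(14)] in simp_all)
qed

lemma run_insert3:
  assumes l: "loaded j s" and t: "stores L (arrays s ''t3'') (points3 D)"
    and out: "arrays s ''out'' (int j) = score A j + len (A ! j)"
  shows "run insert3 s (700 * (L + 2) * (L + 2))
    (\<lambda>s'. stores L (arrays s' ''t3'') (points3 (insert j D)))"
proof -
  note d = loadedD[OF l]
  define a where "a = Assign ''p1'' (Reg ''rb'') ;; Assign ''p2'' (Reg ''rd'') ;;
      Assign ''v'' (Load ''out'' (Reg ''cur''))"
  have c: "loop_free a" "max_cost a \<le> 50" by (simp_all add: a_def)
  have r: "regs (result a s) ''p1'' = rank_b j" "regs (result a s) ''p2'' = rank_d j"
    "regs (result a s) ''v'' = score A j + len (A ! j)" "arrays (result a s) ''t3'' = arrays s ''t3''"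
    using d(3-13) out by (simp_all add: a_def)
  have T: "tables L (result a s)" using d(2) by (simp add: a_def tables_def)
  show ?thesis
    unfolding insert3_def a_def[symmetric] points_insert
    by (rule run_insert_after[OF c T, of "''t3''" "points3 D", unfolded r])
      (use t ranks_bounds[OF d(14)] in simp_all)
qed

end

definition load_ranks :: prog where
  "load_ranks =
     Assign ''rb'' (Load ''rk'' (Reg ''cur'')) ;;
     Assign ''ra'' (Load ''rk'' (Plus (Reg ''n'') (Reg ''cur''))) ;;
     Assign ''rd'' (Load ''rk'' (Plus (Reg ''n2'') (Reg ''cur''))) ;;
     Assign ''rc'' (Load ''rk'' (Plus (Reg ''n3'') (Reg ''cur''))) ;;
     Assign ''rs'' (Load ''rk'' (Plus (Reg ''n4'') (Reg ''cur'')))"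

definition visit :: prog where
  "visit = load_ranks ;; query1 ;; query2 ;; query3 ;; insert1 ;; insert2 ;; insert3"

text \<open>The loop walks through the sorted positions of all five blocks. The test against
  \<open>n\<close> selects the keys of the first block, whose indices are those of the
  anchors.\<close>

definition sweep :: prog where
  "sweep =
     Assign ''pos'' (Const 0) ;;
     While (Less (Reg ''pos'') (Reg ''m''))
       ((Assign ''cur'' (Load ''p'' (Reg ''pos'')) ;; Assign ''pos'' (Plus (Reg ''pos'') (Const 1))) ;;
        If (Less (Reg ''cur'') (Reg ''n'')) visit Skip)"

lemma written_visit:
  "regs_of visit = {''p1'', ''q1'', ''p2'', ''q2'', ''l'', ''r'', ''mp'', ''mq'', ''q'', ''i'', ''base'', ''j'',
     ''k'', ''acc'', ''v'', ''u'', ''rb'', ''ra'', ''rd'', ''rc'', ''rs''}"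
  "arrays_of visit = {''P'', ''Q'', ''out'', ''t1'', ''t2'', ''t3''}"
  unfolding visit_def load_ranks_def by auto

context sorted_anchors begin

text \<open>\<open>closed\<close> makes every possible predecessor available. The set
  \<open>D\<close> may also contain anchors whose right end ties with that of \<open>j\<close>; the
  rectangles exclude them. After the third query the accumulator is the score by
  \<open>score_eq_queries\<close>.\<close>

lemma run_visit:
  assumes r: "ready s" and t: "trees D s" and D: "D \<subseteq> {..<length A}" and j: "j < length A"
    and cur: "regs s ''cur'' = int j" and closed: "\<And>i. i < length A \<Longrightarrow> \<beta> i < \<beta> j \<Longrightarrow> i \<in> D"
  shows "run visit s (4300 * (L + 2) * (L + 2))
    (\<lambda>s'. trees (insert j D) s' \<and> arrays s' ''out'' = (arrays s ''out'')(int j := max_coverage A j))"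
proof -
  let ?s = "result load_ranks s" and ?t = "700 * (L + 2) * (L + 2)"
  let ?R = "\<lambda>s'. trees (insert j D) s' \<and> arrays s' ''out'' = (arrays s ''out'')(int j := max_coverage A j)"
  have mc: "score A j + len (A ! j) = max_coverage A j" by (simp add: score_def)
  have l0: "loaded j ?s"
    using r j cur unfolding loaded_def ready_def
    by (simp add: load_ranks_def tables_def rank_a_def rank_b_def rank_c_def rank_d_def rank_s_def)
  have t0: "trees D ?s" using t by (simp add: trees_def load_ranks_def)
  have out0: "arrays ?s ''out'' = arrays s ''out''" by (simp add: load_ranks_def)
  have "run (query1 ;; query2 ;; query3 ;; insert1 ;; insert2 ;; insert3) ?s
    (?t + (?t + (?t + (?t + (?t + ?t))))) ?R"
  proof (rule run_seq, rule run_conseq[OF run_query1[OF l0 t0 D] _ order_refl], elim exE conjE)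
    fix s1 q1
    assume q1: "is_max0 (cands1 D j) q1" "regs s1 ''acc'' = q1 + \<alpha> j - big"
      and o: "same_outside query1 ?s s1"
    have l1: "loaded j s1" and t1: "trees D s1" and out1: "arrays s1 ''out'' = arrays s ''out''"
      using loaded_same_outside[OF l0 o] trees_same_outside[OF t0 o] o out0
      by (auto simp: same_outside_def)
    show "run (query2 ;; query3 ;; insert1 ;; insert2 ;; insert3) s1 (?t + (?t + (?t + (?t + ?t)))) ?R"
    proof (rule run_seq, rule run_conseq[OF run_query2[OF l1 t1 D] _ order_refl], elim exE conjE)
      fix s2 q2
      assume q2: "is_max0 (cands2 D j) q2" "regs s2 ''acc'' = max (regs s1 ''acc'') (q2 + \<gamma> j - big)"
        and o: "same_outside query2 s1 s2"
      have l2: "loaded j s2" and t2: "trees D s2" and out2: "arrays s2 ''out'' = arrays s ''out''"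
        using loaded_same_outside[OF l1 o] trees_same_outside[OF t1 o] o out1
        by (auto simp: same_outside_def)
      show "run (query3 ;; insert1 ;; insert2 ;; insert3) s2 (?t + (?t + (?t + ?t))) ?R"
      proof (rule run_seq, rule run_conseq[OF run_query3[OF l2 t2 D] _ order_refl], elim exE conjE)
        fix s3 q3
        assume q3: "is_max0 (cands3 D j) q3" "regs s3 ''acc'' = max (regs s2 ''acc'') q3"
          and o: "same_outside query3 s2 s3"
        have l3: "loaded j s3" and t3: "trees D s3" and out3: "arrays s3 ''out'' = arrays s ''out''"
          using loaded_same_outside[OF l2 o] trees_same_outside[OF t2 o] o out2
          by (auto simp: same_outside_def)
        have acc: "regs s3 ''acc'' = score A j"
          using score_eq_queries[OF j D closed _ _ q1(1) q2(1) q3(1)] start_le_big[OF j] q1 q2 q3 by simp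
        have t3': "stores L (arrays s3 ''t1'') (points1 D)" using t3 by (simp add: trees_def)
        show "run (insert1 ;; insert2 ;; insert3) s3 (?t + (?t + ?t)) ?R"
        proof (rule run_seq, rule run_conseq[OF run_insert1[OF l3 t3' acc] _ order_refl], elim conjE)
          fix s4
          assume i1: "stores L (arrays s4 ''t1'') (points1 (insert j D))"
            "arrays s4 ''out'' = (arrays s3 ''out'')(int j := score A j + len (A ! j))"
            and o: "same_outside insert1 s3 s4"
          have l4: "loaded j s4" and t4: "stores L (arrays s4 ''t2'') (points2 D)" "stores L (arrays s4 ''t3'') (points3 D)"
            and acc4: "regs s4 ''acc'' = score A j"
            using loaded_same_outside[OF l3 o] t3 acc o by (auto simp: same_outside_def trees_def)
          show "run (insert2 ;; insert3) s4 (?t + ?t) ?R"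
          proof (rule run_seq, rule run_conseq[OF run_insert2[OF l4 t4(1) acc4] _ order_refl])
            fix s5
            assume i2: "stores L (arrays s5 ''t2'') (points2 (insert j D))"
              and o: "same_outside insert2 s4 s5"
            have l5: "loaded j s5" and t5: "stores L (arrays s5 ''t1'') (points1 (insert j D))"
              "stores L (arrays s5 ''t3'') (points3 D)"
              and out5: "arrays s5 ''out'' = (arrays s ''out'')(int j := score A j + len (A ! j))"
              using loaded_same_outside[OF l4 o] t4 i1 out3 o by (auto simp: same_outside_def)
            show "run insert3 s5 ?t ?R"
            proof (rule run_conseq[OF run_insert3[OF l5 t5(2)] _ order_refl])
              fix s6 :: state
              assume i3: "stores L (arrays s6 ''t3'') (points3 (insert j D))"
                and o: "same_outside insert3 s5 s6"
              then show "?R s6" using i2 t5(1) out5 mc by (simp add: same_outside_def trees_def)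
            qed (simp add: out5)
          qed
        qed
      qed
    qed
  qed
  then show ?thesis unfolding visit_def
    by (rule run_loop_free_seq[rotated]) (auto simp: load_ranks_def algebra_simps)
qed

lemma run_sweep:
  assumes r: "ready s" and t: "trees {} s"
  shows "run sweep s ((5 * length A + 1) * (4400 * (L + 2) * (L + 2)))
    (\<lambda>s'. \<forall>i<length A. arrays s' ''out'' (int i) = max_coverage A i)"
proof -
  let ?N = "length A"
  define visited where "visited q = {i. i < ?N \<and> int i \<in> p ` {0..<q}}" for q
  let ?i0 = "Assign ''pos'' (Const 0)"
  let ?a = "Assign ''cur'' (Load ''p'' (Reg ''pos'')) ;; Assign ''pos'' (Plus (Reg ''pos'') (Const 1))"
  let ?body = "?a ;; If (Less (Reg ''cur'') (Reg ''n'')) visit Skip"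
  let ?T = "4300 * (L + 2) * (L + 2)"
  define I where "I n s' \<longleftrightarrow> 0 \<le> regs s' ''pos'' \<and> regs s' ''pos'' + int n = int (5 * ?N) \<and>
    trees (visited (regs s' ''pos'')) s' \<and>
    (\<forall>i\<in>visited (regs s' ''pos''). arrays s' ''out'' (int i) = max_coverage A i)" for n and s' :: state
  have mem: "p q \<in> {0..<int (5 * ?N)}" if "0 \<le> q" "q < int (5 * ?N)" for q
    using sorts that unfolding sorts_def by (metis atLeastLessThan_iff imageI)
  \<comment> \<open>An anchor with a strictly smaller \<open>b\<close> that came later would
    contradict sortedness, no matter how ties are ordered.\<close>
  have closed: "i \<in> visited q" if q: "0 \<le> q" "q < int (5 * ?N)" "p q = int j" "j < ?N" "i < ?N" "\<beta> i < \<beta> j" for i j q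
  proof -
    have "int i \<in> {0..<int (5 * ?N)}" using q by simp
    then have "int i \<in> p ` {0..<int (5 * ?N)}" using sorts unfolding sorts_def by metis
    then obtain k where k: "0 \<le> k" "k < int (5 * ?N)" "int i = p k" by auto
    have "k < q"
    proof (rule ccontr)
      assume "\<not> k < q"
      then have "K (p q) \<le> K (p k)" using sorts q(1) k(2) unfolding sorts_def by simp
      then show False using q k(3)[symmetric] keys(1) by simp
    qed
    then show ?thesis using k q by (auto simp: visited_def)
  qed
  have step: "visited (q + 1) = (if p q < int ?N then insert (nat (p q)) (visited q) else visited q)"
    if "0 \<le> q" "q < int (5 * ?N)" for q
    using mem[OF that] ivl_Suc[OF that(1)] by (auto simp: visited_def)
  show ?thesis
    unfolding sweep_def
  proof (rule run_loop_free_seq, simp, rule run_while_inv[where I = I and n = "5 * ?N" and t = "?T + 20"])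
    have "visited 0 = {}" by (simp add: visited_def)
    then show "I (5 * ?N) (result ?i0 s)" using t by (simp add: I_def trees_def)
  next
    fix n and s' :: state
    assume i: "I n s'" and te: "test_val (Less (Reg ''pos'') (Reg ''m'')) s'"
      and o: "same_outside ?body (result ?i0 s) s'"
    have rd: "ready s'"
    proof (rule ready_same_outside[OF _ o])
      show "ready (result ?i0 s)" using r by (simp add: ready_def tables_def)
    qed (simp_all add: written_visit)
    let ?q = "regs s' ''pos''"
    have q: "0 \<le> ?q" "?q < int (5 * ?N)" using i te rd by (simp_all add: I_def ready_def)
    let ?s = "result ?a s'"
    have s: "regs ?s ''cur'' = p ?q" "regs ?s ''pos'' = ?q + 1" "ready ?s" "trees (visited ?q) ?s"
      "regs ?s ''n'' = int ?N" "arrays ?s = arrays s'"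
      using rd i by (simp_all add: ready_def tables_def I_def trees_def)
    have n: "0 < n" using i q by (simp add: I_def)
    have "run (If (Less (Reg ''cur'') (Reg ''n'')) visit Skip) ?s (?T + 10) (I (n - 1))"
    proof (rule run_if[where t = "?T"])
      assume "test_val (Less (Reg ''cur'') (Reg ''n'')) ?s"
      then have lt: "p ?q < int ?N" using s by simp
      define j where "j = nat (p ?q)"
      have j: "j < ?N" "p ?q = int j" using lt mem[OF q] by (auto simp: j_def)
      have "run visit ?s ?T (\<lambda>s2. trees (insert j (visited ?q)) s2 \<and>
        arrays s2 ''out'' = (arrays ?s ''out'')(int j := max_coverage A j))"
        by (rule run_visit[OF s(3,4)]) (use j s closed[OF q j(2,1)] in \<open>auto simp: visited_def\<close>)
      then show "run visit ?s ?T (I (n - 1))"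
      proof (rule run_conseq)
        fix s2
        assume a: "trees (insert j (visited ?q)) s2 \<and>
            arrays s2 ''out'' = (arrays ?s ''out'')(int j := max_coverage A j)"
          and o2: "same_outside visit ?s s2"
        have pos: "regs s2 ''pos'' = ?q + 1" using o2 s(2) by (simp add: same_outside_def written_visit)
        have v: "visited (?q + 1) = insert j (visited ?q)" using step[OF q] lt by (simp add: j_def)
        show "I (n - 1) s2"
          unfolding I_def pos v using a i n s(6) by (auto simp: I_def of_nat_diff)
      qed simp
    next
      assume "\<not> test_val (Less (Reg ''cur'') (Reg ''n'')) ?s"
      then have "visited (?q + 1) = visited ?q" using s step[OF q] by simp
      then have "I (n - 1) ?s" using i n s unfolding I_def by (simp add: of_nat_diff)
      then show "run Skip ?s ?T (I (n - 1))" by (intro run_loop_free) auto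
    qed simp
    then have "run ?body s' (?T + 20) (I (n - 1))" by (rule run_loop_free_seq[rotated]) auto
    then show "\<exists>m<n. run ?body s' (?T + 20) (I m)" using n by (intro exI[of _ "n - 1"]) auto
  next
    fix n and s' :: state
    assume i: "I n s'" and te: "\<not> test_val (Less (Reg ''pos'') (Reg ''m'')) s'"
      and o: "same_outside ?body (result ?i0 s) s'"
    have "regs s' ''m'' = int (5 * ?N)"
      using o r by (simp add: same_outside_def written_visit ready_def)
    then have "regs s' ''pos'' = int (5 * ?N)" using i te by (simp add: I_def)
    moreover have "i \<in> visited (int (5 * ?N))" if "i < ?N" for i
    proof -
      have "int i \<in> {0..<int (5 * ?N)}" using that by simp
      then have "int i \<in> p ` {0..<int (5 * ?N)}" using sorts unfolding sorts_def by metis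
      then show ?thesis using that by (simp add: visited_def)
    qed
    ultimately show "\<forall>i<?N. arrays s' ''out'' (int i) = max_coverage A i" using i by (simp add: I_def)
  next
    have "max_cost ?i0 + (5 * ?N * (?T + 24) + 4) \<le> (5 * ?N + 1) * (?T + 24)"
      by (simp add: algebra_simps)
    also have "\<dots> \<le> (5 * ?N + 1) * (4400 * (L + 2) * (L + 2))" by (intro mult_le_mono2) (simp add: algebra_simps)
    finally show "max_cost ?i0 + (5 * ?N * (?T + 24) + 4) \<le> (5 * ?N + 1) * (4400 * (L + 2) * (L + 2))" .
  qed simp
qed

end


section \<open>The complete program\<close>

text \<open>The least height of a tree with more than \<open>5 * N\<close> leaves. Strictness leaves
  room for the largest possible rank, \<open>5 * N\<close>.\<close>

definition level :: "nat \<Rightarrow> nat" where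
  "level N = (LEAST L. int (5 * N) < 2 ^ L)"

lemma level_exists: "\<exists>L. int (5 * N) < 2 ^ L"
  using of_nat_less_two_power[of "5 * N"] by blast

lemma less_level: "int (5 * N) < 2 ^ level N"
  unfolding level_def by (rule LeastI_ex[OF level_exists])

lemma level_le: "int (5 * N) < 2 ^ L \<Longrightarrow> level N \<le> L"
  unfolding level_def by (rule Least_le)

text \<open>By minimality, half of the power is at most \<open>5 * N\<close>. The summand 1 is for
  height 0.\<close>

lemma power_level_le: "(2::nat) ^ level N \<le> 10 * N + 1"
proof (cases "level N")
  case (Suc k)
  then have "\<not> int (5 * N) < 2 ^ k" using level_le[of N k] by auto
  then have "int (2 ^ k) \<le> int (5 * N)" by simp
  then have "(2::nat) ^ k \<le> 5 * N" by (simp only: of_nat_le_iff)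
  then show ?thesis using Suc by simp
qed simp

section \<open>Preparing sizes, tables and keys\<close>

definition size_setup :: prog where
  "size_setup =
     (Assign ''n2'' (Plus (Reg ''n'') (Reg ''n'')) ;; Assign ''n3'' (Plus (Reg ''n2'') (Reg ''n'')) ;;
      Assign ''n4'' (Plus (Reg ''n3'') (Reg ''n'')) ;; Assign ''m'' (Plus (Reg ''n4'') (Reg ''n'')) ;;
      Assign ''z'' (Const 1)) ;;
     While (Less (Reg ''z'') (Plus (Reg ''m'') (Const 1))) (Assign ''z'' (Plus (Reg ''z'') (Reg ''z'')))"

lemma written_size_setup [simp]:
  "regs_of size_setup = {''n2'', ''n3'', ''n4'', ''m'', ''z''}" "arrays_of size_setup = {}"
  by (auto simp: size_setup_def)

lemma run_size_setup:
  assumes n: "regs s ''n'' = int N"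
  shows "run size_setup s (20 * (level N + 2)) (\<lambda>s'. regs s' ''z'' = 2 ^ level N \<and>
    regs s' ''n2'' = int (2 * N) \<and> regs s' ''n3'' = int (3 * N) \<and> regs s' ''n4'' = int (4 * N) \<and>
    regs s' ''m'' = int (5 * N))"
proof -
  let ?a = "Assign ''n2'' (Plus (Reg ''n'') (Reg ''n'')) ;; Assign ''n3'' (Plus (Reg ''n2'') (Reg ''n'')) ;;
      Assign ''n4'' (Plus (Reg ''n3'') (Reg ''n'')) ;; Assign ''m'' (Plus (Reg ''n4'') (Reg ''n'')) ;;
      Assign ''z'' (Const 1)"
  define I where "I k s' \<longleftrightarrow> k \<le> level N \<and> regs s' ''z'' = 2 ^ (level N - k)" for k and s' :: state
  show ?thesis
    unfolding size_setup_def
  proof (rule run_loop_free_seq, simp, rule run_while_inv[where I = I and n = "level N" and t = 4])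
    show "I (level N) (result ?a s)" by (simp add: I_def)
  next
    fix k and s' :: state
    assume i: "I k s'" and t: "test_val (Less (Reg ''z'') (Plus (Reg ''m'') (Const 1))) s'"
      and o: "same_outside (Assign ''z'' (Plus (Reg ''z'') (Reg ''z''))) (result ?a s) s'"
    have "regs s' ''m'' = int (5 * N)" using o n by (simp add: same_outside_def)
    then have "2 ^ (level N - k) \<le> int (5 * N)" using i t by (simp add: I_def)
    then have "k \<noteq> 0" using less_level[of N] by (metis diff_zero linorder_not_less)
    then obtain k' where "k = Suc k'" "level N - k' = Suc (level N - k)"
      using i by (cases k) (auto simp: I_def)
    then show "\<exists>k'<k. run (Assign ''z'' (Plus (Reg ''z'') (Reg ''z''))) s' 4 (I k')"
      using i by (intro exI[of _ k'] conjI run_loop_free) (auto simp: I_def)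
  next
    fix k and s' :: state
    assume i: "I k s'" and t: "\<not> test_val (Less (Reg ''z'') (Plus (Reg ''m'') (Const 1))) s'"
      and o: "same_outside (Assign ''z'' (Plus (Reg ''z'') (Reg ''z''))) (result ?a s) s'"
    have r: "regs s' ''m'' = int (5 * N)" "regs s' ''n2'' = int (2 * N)" "regs s' ''n3'' = int (3 * N)"
      "regs s' ''n4'' = int (4 * N)"
      using o n by (simp_all add: same_outside_def)
    then have "int (5 * N) < 2 ^ (level N - k)" using i t by (simp add: I_def)
    then have "level N \<le> level N - k" by (rule level_le)
    then have "level N - k = level N" by simp
    then show "regs s' ''z'' = 2 ^ level N \<and> regs s' ''n2'' = int (2 * N) \<and> regs s' ''n3'' = int (3 * N) \<and>
      regs s' ''n4'' = int (4 * N) \<and> regs s' ''m'' = int (5 * N)"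
      using i r by (simp add: I_def)
  qed (rule order_refl, simp)
qed

text \<open>Two entries per round, at \<open>2 * h\<close> and \<open>2 * h + 1\<close>, both have
  half \<open>h\<close>, so no division takes place. \<open>t\<close> runs through the multiples of
  the row width by repeated addition.\<close>

definition table_setup :: prog where
  "table_setup =
     (Assign ''h'' (Const 0) ;; Assign ''t'' (Const 0)) ;;
     While (Less (Reg ''h'') (Plus (Reg ''z'') (Const 1)))
       (Store ''half'' (Plus (Reg ''h'') (Reg ''h'')) (Reg ''h'') ;;
        Store ''half'' (Plus (Plus (Reg ''h'') (Reg ''h'')) (Const 1)) (Reg ''h'') ;;
        Store ''row'' (Plus (Reg ''h'') (Reg ''h'')) (Reg ''t'') ;;
        Assign ''t'' (Plus (Plus (Reg ''t'') (Reg ''z'')) (Reg ''z'')) ;;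
        Store ''row'' (Plus (Plus (Reg ''h'') (Reg ''h'')) (Const 1)) (Reg ''t'') ;;
        Assign ''t'' (Plus (Plus (Reg ''t'') (Reg ''z'')) (Reg ''z'')) ;;
        Assign ''h'' (Plus (Reg ''h'') (Const 1)))"

lemma written_table_setup [simp]:
  "regs_of table_setup = {''h'', ''t''}" "arrays_of table_setup = {''half'', ''row''}"
  by (auto simp: table_setup_def)

lemma run_table_setup:
  assumes z: "regs s ''z'' = 2 ^ L"
  shows "run table_setup s (60 * (2 ^ L + 2)) (tables L)"
proof -
  let ?a = "Assign ''h'' (Const 0) ;; Assign ''t'' (Const 0)"
  define c where "c = Store ''half'' (Plus (Reg ''h'') (Reg ''h'')) (Reg ''h'') ;;
        Store ''half'' (Plus (Plus (Reg ''h'') (Reg ''h'')) (Const 1)) (Reg ''h'') ;;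
        Store ''row'' (Plus (Reg ''h'') (Reg ''h'')) (Reg ''t'') ;;
        Assign ''t'' (Plus (Plus (Reg ''t'') (Reg ''z'')) (Reg ''z'')) ;;
        Store ''row'' (Plus (Plus (Reg ''h'') (Reg ''h'')) (Const 1)) (Reg ''t'') ;;
        Assign ''t'' (Plus (Plus (Reg ''t'') (Reg ''z'')) (Reg ''z'')) ;;
        Assign ''h'' (Plus (Reg ''h'') (Const 1))"
  define I where "I n s' \<longleftrightarrow> 0 \<le> regs s' ''h'' \<and> regs s' ''h'' + int n = 2 ^ L + 1 \<and>
    regs s' ''t'' = 2 * regs s' ''h'' * (2 * 2 ^ L) \<and>
    (\<forall>u. 0 \<le> u \<and> u < 2 * regs s' ''h'' \<longrightarrow>
       arrays s' ''half'' u = u div 2 \<and> arrays s' ''row'' u = u * (2 * 2 ^ L))" for n and s' :: state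
  show ?thesis
    unfolding table_setup_def c_def[symmetric]
  proof (rule run_loop_free_seq, simp, rule run_while_inv[where I = I and n = "2 ^ L + 1" and t = 50])
    show "I (2 ^ L + 1) (result ?a s)" by (simp add: I_def)
  next
    fix n and s' :: state
    assume i: "I n s'" and t: "test_val (Less (Reg ''h'') (Plus (Reg ''z'') (Const 1))) s'"
      and o: "same_outside c (result ?a s) s'"
    have z': "regs s' ''z'' = 2 ^ L" using o z by (simp add: same_outside_def c_def)
    have n: "0 < n" using i t z' by (cases n) (auto simp: I_def)
    let ?h = "regs s' ''h''" and ?s = "result c s'"
    have h: "regs ?s ''h'' = ?h + 1" by (simp add: c_def)
    have tt: "regs ?s ''t'' = 2 * (?h + 1) * (2 * 2 ^ L)"
      using i z' by (simp add: c_def I_def algebra_simps)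
    have half: "arrays ?s ''half'' = (arrays s' ''half'')(2 * ?h := ?h, 2 * ?h + 1 := ?h)"
      by (simp add: c_def)
    have row: "arrays ?s ''row'' = (arrays s' ''row'')
      (2 * ?h := 2 * ?h * (2 * 2 ^ L), 2 * ?h + 1 := (2 * ?h + 1) * (2 * 2 ^ L))"
      using i z' by (simp add: c_def I_def algebra_simps)
    have "I (n - 1) ?s"
      unfolding I_def h tt half row
    proof (intro conjI allI impI)
      fix u assume u: "0 \<le> u \<and> u < 2 * (?h + 1)"
      have "u < 2 * ?h \<or> u = 2 * ?h \<or> u = 2 * ?h + 1" using u by arith
      then consider "u < 2 * ?h" | "u = 2 * ?h" | "u = 2 * ?h + 1" by blast
      then show "((arrays s' ''half'')(2 * ?h := ?h, 2 * ?h + 1 := ?h)) u = u div 2"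
        "((arrays s' ''row'')(2 * ?h := 2 * ?h * (2 * 2 ^ L), 2 * ?h + 1 := (2 * ?h + 1) * (2 * 2 ^ L))) u
          = u * (2 * 2 ^ L)"
        using i u by (cases; auto simp: I_def)+
    qed (use i n in \<open>auto simp: I_def of_nat_diff\<close>)
    then have "run c s' 50 (I (n - 1))" by (intro run_loop_free) (simp_all add: c_def)
    then show "\<exists>m<n. run c s' 50 (I m)" using n by (intro exI[of _ "n - 1"]) auto
  next
    fix n and s' :: state
    assume i: "I n s'" and t: "\<not> test_val (Less (Reg ''h'') (Plus (Reg ''z'') (Const 1))) s'"
      and o: "same_outside c (result ?a s) s'"
    have z': "regs s' ''z'' = 2 ^ L" using o z by (simp add: same_outside_def c_def)
    have "regs s' ''h'' = 2 ^ L + 1" using i t z' by (simp add: I_def)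
    then show "tables L s'" using i z' by (simp add: I_def tables_def)
  qed (rule order_refl, simp)
qed

definition key_setup :: prog where
  "key_setup =
     Assign ''h'' (Const 0) ;;
     While (Less (Reg ''h'') (Reg ''n''))
       (Store ''K'' (Reg ''h'') (Load ''b'' (Reg ''h'')) ;;
        Store ''K'' (Plus (Reg ''n'') (Reg ''h'')) (Load ''a'' (Reg ''h'')) ;;
        Store ''K'' (Plus (Reg ''n2'') (Reg ''h'')) (Load ''d'' (Reg ''h'')) ;;
        Store ''K'' (Plus (Reg ''n3'') (Reg ''h'')) (Load ''c'' (Reg ''h'')) ;;
        Store ''K'' (Plus (Reg ''n4'') (Reg ''h'')) (Minus (Load ''a'' (Reg ''h'')) (Load ''c'' (Reg ''h''))) ;;
        Assign ''h'' (Plus (Reg ''h'') (Const 1)))"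

lemma written_key_setup [simp]:
  "regs_of key_setup = {''h''}" "arrays_of key_setup = {''K''}"
  by (auto simp: key_setup_def)

lemma run_key_setup:
  assumes n: "regs s ''n'' = int N" "regs s ''n2'' = int (2 * N)" "regs s ''n3'' = int (3 * N)"
    "regs s ''n4'' = int (4 * N)"
  shows "run key_setup s (60 * (N + 1)) (\<lambda>s'. \<forall>i<N.
    arrays s' ''K'' (int i) = arrays s ''b'' (int i) \<and> arrays s' ''K'' (int (N + i)) = arrays s ''a'' (int i) \<and>
    arrays s' ''K'' (int (2 * N + i)) = arrays s ''d'' (int i) \<and>
    arrays s' ''K'' (int (3 * N + i)) = arrays s ''c'' (int i) \<and>
    arrays s' ''K'' (int (4 * N + i)) = arrays s ''a'' (int i) - arrays s ''c'' (int i))"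
proof -
  let ?a = "Assign ''h'' (Const 0)"
  define c where "c = Store ''K'' (Reg ''h'') (Load ''b'' (Reg ''h'')) ;;
        Store ''K'' (Plus (Reg ''n'') (Reg ''h'')) (Load ''a'' (Reg ''h'')) ;;
        Store ''K'' (Plus (Reg ''n2'') (Reg ''h'')) (Load ''d'' (Reg ''h'')) ;;
        Store ''K'' (Plus (Reg ''n3'') (Reg ''h'')) (Load ''c'' (Reg ''h'')) ;;
        Store ''K'' (Plus (Reg ''n4'') (Reg ''h'')) (Minus (Load ''a'' (Reg ''h'')) (Load ''c'' (Reg ''h''))) ;;
        Assign ''h'' (Plus (Reg ''h'') (Const 1))"
  define Q where "Q k F \<longleftrightarrow> (\<forall>i<k. F (int i) = arrays s ''b'' (int i) \<and> F (int (N + i)) = arrays s ''a'' (int i) \<and>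
    F (int (2 * N + i)) = arrays s ''d'' (int i) \<and> F (int (3 * N + i)) = arrays s ''c'' (int i) \<and>
    F (int (4 * N + i)) = arrays s ''a'' (int i) - arrays s ''c'' (int i))" for k and F :: "int \<Rightarrow> int"
  define I where "I n s' \<longleftrightarrow> (\<exists>k. regs s' ''h'' = int k \<and> k + n = N \<and> Q k (arrays s' ''K''))"
    for n and s' :: state
  show ?thesis
    unfolding key_setup_def c_def[symmetric]
  proof (rule run_loop_free_seq, simp, rule run_while_inv[where I = I and n = N and t = 50])
    show "I N (result ?a s)" by (simp add: I_def Q_def)
  next
    fix m and s' :: state
    assume i: "I m s'" and t: "test_val (Less (Reg ''h'') (Reg ''n'')) s'"
      and o: "same_outside c (result ?a s) s'"
    have r: "regs s' ''n'' = int N" "regs s' ''n2'' = int (2 * N)" "regs s' ''n3'' = int (3 * N)"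
      "regs s' ''n4'' = int (4 * N)" "arrays s' ''a'' = arrays s ''a''" "arrays s' ''b'' = arrays s ''b''"
      "arrays s' ''c'' = arrays s ''c''" "arrays s' ''d'' = arrays s ''d''"
      using o n by (simp_all add: same_outside_def c_def)
    obtain k where k: "regs s' ''h'' = int k" "k + m = N" "Q k (arrays s' ''K'')"
      using i by (auto simp: I_def)
    have kN: "k < N" using t k r by simp
    have "arrays (result c s') ''K'' = (arrays s' ''K'')(int k := arrays s ''b'' (int k),
        int (N + k) := arrays s ''a'' (int k), int (2 * N + k) := arrays s ''d'' (int k),
        int (3 * N + k) := arrays s ''c'' (int k),
        int (4 * N + k) := arrays s ''a'' (int k) - arrays s ''c'' (int k))"
      using r k(1) by (simp add: c_def)
    \<comment> \<open>As \<open>k < N\<close>, the five cells lie in different blocks, and none of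
      them is an entry written in an earlier round.\<close>
    then have "Q (Suc k) (arrays (result c s') ''K'')"
      using k(3) kN unfolding Q_def by (simp del: of_nat_add of_nat_mult add: less_Suc_eq)
    then have "I (m - 1) (result c s')"
      using k kN unfolding I_def by (intro exI[of _ "Suc k"]) (auto simp: c_def)
    then have "run c s' 50 (I (m - 1))" by (intro run_loop_free) (simp_all add: c_def)
    then show "\<exists>m'<m. run c s' 50 (I m')" using k kN by (intro exI[of _ "m - 1"]) auto
  next
    fix m and s' :: state
    assume i: "I m s'" and t: "\<not> test_val (Less (Reg ''h'') (Reg ''n'')) s'"
      and o: "same_outside c (result ?a s) s'"
    have "regs s' ''n'' = int N" using o n by (simp add: same_outside_def c_def)
    then have "Q N (arrays s' ''K'')" using i t by (auto simp: I_def)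
    then show "\<forall>i<N. arrays s' ''K'' (int i) = arrays s ''b'' (int i) \<and>
      arrays s' ''K'' (int (N + i)) = arrays s ''a'' (int i) \<and>
      arrays s' ''K'' (int (2 * N + i)) = arrays s ''d'' (int i) \<and>
      arrays s' ''K'' (int (3 * N + i)) = arrays s ''c'' (int i) \<and>
      arrays s' ''K'' (int (4 * N + i)) = arrays s ''a'' (int i) - arrays s ''c'' (int i)"
      by (simp only: Q_def)
  qed (rule order_refl, simp)
qed

definition chaining :: prog where
  "chaining = size_setup ;; table_setup ;; key_setup ;; enter_all ;; extract_all ;;
     Assign ''big'' (Load ''K'' (Load ''p'' (Minus (Reg ''m'') (Const 1)))) ;; sweep"

text \<open>The phases add up to at most 24310 times the product, of which the sweep accounts for
  22000: five keys per anchor at a cost of 4400 each. The constant is rounded up generously.\<close>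

definition chaining_time :: "nat \<Rightarrow> nat" where
  "chaining_time N = 50000 * (N + 1) * (level N + 2) * (level N + 2)"

lemma chaining_time_bound:
  assumes "L = level N"
  shows "20 * (L + 2) + (60 * (2 ^ L + 2) + (60 * (N + 1) + ((5 * N + 1) * (100 * (L + 2)) +
    ((5 * N + 1) * (200 * (L + 2)) + (10 + (5 * N + 1) * (4400 * (L + 2) * (L + 2))))))) \<le> chaining_time N"
proof -
  define X where "X = (N + 1) * ((L + 2) * (L + 2))"
  have "1 * (L + 2) \<le> (L + 2) * (L + 2)" by (intro mult_le_mono1) simp
  then have L2: "L + 2 \<le> (L + 2) * (L + 2)" "1 \<le> (L + 2) * (L + 2)" by auto
  have 1: "L + 2 \<le> X" unfolding X_def using mult_le_mono[of 1 "N + 1" "L + 2" "(L + 2) * (L + 2)"] L2 by simp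
  have 2: "N + 1 \<le> X" unfolding X_def using mult_le_mono2[OF L2(2), of "N + 1"] by simp
  have 3: "(N + 1) * (L + 2) \<le> X" unfolding X_def by (intro mult_le_mono2 L2)
  \<comment> \<open>Filling the tables takes time proportional to \<open>2 ^ L\<close>, which
    minimality of the height makes linear in \<open>N\<close>.\<close>
  have 4: "2 ^ L \<le> 10 * X" using power_level_le[of N] 2 assms by simp
  have "(5 * N + 1) * (100 * (L + 2)) \<le> 500 * ((N + 1) * (L + 2))"
    "(5 * N + 1) * (200 * (L + 2)) \<le> 1000 * ((N + 1) * (L + 2))"
    by (simp_all add: algebra_simps)
  then have 5: "(5 * N + 1) * (100 * (L + 2)) \<le> 500 * X" "(5 * N + 1) * (200 * (L + 2)) \<le> 1000 * X"
    using mult_le_mono2[OF 3, of 500] mult_le_mono2[OF 3, of 1000] by (simp_all only: order_trans)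
  have 6: "(5 * N + 1) * (4400 * (L + 2) * (L + 2)) \<le> 22000 * X"
    unfolding X_def by (simp add: algebra_simps)
  have 7: "20 * (L + 2) \<le> 20 * X" "60 * (N + 1) \<le> 60 * X" "60 * (2 ^ L + 2) \<le> 720 * X" "10 \<le> 10 * X"
    using 1 2 4 by simp_all
  have "20 * (L + 2) + (60 * (2 ^ L + 2) + (60 * (N + 1) + ((5 * N + 1) * (100 * (L + 2)) +
    ((5 * N + 1) * (200 * (L + 2)) + (10 + (5 * N + 1) * (4400 * (L + 2) * (L + 2))))))) \<le>
    20 * X + (720 * X + (60 * X + (500 * X + (1000 * X + (10 * X + 22000 * X)))))"
    by (intro add_mono 5 6 7)
  also have "\<dots> \<le> 50000 * X" by simp
  also have "50000 * X = chaining_time N" by (simp add: chaining_time_def X_def assms algebra_simps)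
  finally show ?thesis .
qed

context equal_length_anchors begin

text \<open>\<open>input\<close> and \<open>sizes\<close> collect what later phases rely on and pass
  through each phase by the frame condition. In particular the tree memory is still all 0 when the
  sweep begins.\<close>

lemma run_chaining:
  "run chaining (input_state A) (chaining_time (length A))
    (\<lambda>s'. \<forall>i<length A. arrays s' ''out'' (int i) = max_coverage A i)"
proof -
  let ?N = "length A" and ?s0 = "input_state A"
  define L where "L = level ?N"
  have size: "int (5 * ?N) < 2 ^ L" unfolding L_def by (rule less_level)
  let ?R = "\<lambda>s'. \<forall>i<length A. arrays s' ''out'' (int i) = max_coverage A i"
  let ?T = "(5 * ?N + 1) * (4400 * (L + 2) * (L + 2))"
  define input where "input s \<longleftrightarrow> regs s ''n'' = int ?N \<and> arrays s ''a'' = endpoint_array end_a A \<and>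
    arrays s ''b'' = endpoint_array end_b A \<and> arrays s ''c'' = endpoint_array end_c A \<and>
    arrays s ''d'' = endpoint_array end_d A \<and> arrays s ''t1'' = (\<lambda>_. 0) \<and> arrays s ''t2'' = (\<lambda>_. 0) \<and>
    arrays s ''t3'' = (\<lambda>_. 0)" for s :: state
  define sizes where "sizes s \<longleftrightarrow> regs s ''z'' = 2 ^ L \<and> regs s ''n2'' = int (2 * ?N) \<and>
    regs s ''n3'' = int (3 * ?N) \<and> regs s ''n4'' = int (4 * ?N) \<and> regs s ''m'' = int (5 * ?N)" for s :: state
  have i0: "input ?s0" "arrays ?s0 ''w'' = (\<lambda>_. 0)" by (simp_all add: input_def input_state_def)
  have "run chaining ?s0 (20 * (L + 2) + (60 * (2 ^ L + 2) + (60 * (?N + 1) + ((5 * ?N + 1) * (100 * (L + 2)) +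
    ((5 * ?N + 1) * (200 * (L + 2)) + (10 + ?T)))))) ?R"
    unfolding chaining_def
  proof (rule run_seq, rule run_conseq[OF run_size_setup[of ?s0 ?N]])
    show "regs ?s0 ''n'' = int ?N" using i0 by (simp add: input_def)
    fix s1
    assume "regs s1 ''z'' = 2 ^ level ?N \<and> regs s1 ''n2'' = int (2 * ?N) \<and>
      regs s1 ''n3'' = int (3 * ?N) \<and> regs s1 ''n4'' = int (4 * ?N) \<and> regs s1 ''m'' = int (5 * ?N)"
      and o: "same_outside size_setup ?s0 s1"
    then have s1: "sizes s1" "input s1" "arrays s1 ''w'' = (\<lambda>_. 0)"
      using i0 by (simp_all add: sizes_def L_def input_def same_outside_def)
    show "run (table_setup ;; key_setup ;; enter_all ;; extract_all ;;
        Assign ''big'' (Load ''K'' (Load ''p'' (Minus (Reg ''m'') (Const 1)))) ;; sweep) s1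
      (60 * (2 ^ L + 2) + (60 * (?N + 1) + ((5 * ?N + 1) * (100 * (L + 2)) +
        ((5 * ?N + 1) * (200 * (L + 2)) + (10 + ?T))))) ?R"
    proof (rule run_seq, rule run_conseq[OF run_table_setup[of s1 L] _ order_refl])
      show "regs s1 ''z'' = 2 ^ L" using s1 by (simp add: sizes_def)
      fix s2
      assume T2: "tables L s2" and o: "same_outside table_setup s1 s2"
      have s2: "sizes s2" "input s2" "arrays s2 ''w'' = (\<lambda>_. 0)"
        using s1 o by (simp_all add: sizes_def input_def same_outside_def)
      show "run (key_setup ;; enter_all ;; extract_all ;;
        Assign ''big'' (Load ''K'' (Load ''p'' (Minus (Reg ''m'') (Const 1)))) ;; sweep) s2
        (60 * (?N + 1) + ((5 * ?N + 1) * (100 * (L + 2)) + ((5 * ?N + 1) * (200 * (L + 2)) + (10 + ?T)))) ?R"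
      proof (rule run_seq, rule run_conseq[OF run_key_setup[of s2 ?N] _ order_refl])
        fix s3
        assume "\<forall>i<?N. arrays s3 ''K'' (int i) = arrays s2 ''b'' (int i) \<and>
          arrays s3 ''K'' (int (?N + i)) = arrays s2 ''a'' (int i) \<and>
          arrays s3 ''K'' (int (2 * ?N + i)) = arrays s2 ''d'' (int i) \<and>
          arrays s3 ''K'' (int (3 * ?N + i)) = arrays s2 ''c'' (int i) \<and>
          arrays s3 ''K'' (int (4 * ?N + i)) = arrays s2 ''a'' (int i) - arrays s2 ''c'' (int i)"
          and o: "same_outside key_setup s2 s3"
        then have K: "\<And>i. i < ?N \<Longrightarrow> arrays s3 ''K'' (int i) = \<beta> i \<and>
          arrays s3 ''K'' (int (?N + i)) = \<alpha> i \<and> arrays s3 ''K'' (int (2 * ?N + i)) = \<delta> i \<and>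
          arrays s3 ''K'' (int (3 * ?N + i)) = \<gamma> i \<and> arrays s3 ''K'' (int (4 * ?N + i)) = \<alpha> i - \<gamma> i"
          using s2(2) by (simp add: input_def endpoint_array_def)
        have s3: "sizes s3" "input s3" "arrays s3 ''w'' = (\<lambda>_. 0)" "tables L s3"
          using s2 T2 o by (simp_all add: sizes_def input_def same_outside_def tables_def)
        have m3: "regs s3 ''m'' = int (5 * ?N)" using s3 by (simp add: sizes_def)
        show "run (enter_all ;; extract_all ;;
          Assign ''big'' (Load ''K'' (Load ''p'' (Minus (Reg ''m'') (Const 1)))) ;; sweep) s3
          ((5 * ?N + 1) * (100 * (L + 2)) + ((5 * ?N + 1) * (200 * (L + 2)) + (10 + ?T))) ?R"
        proof (rule run_seq, rule run_conseq[OF run_enter_all[OF s3(4,3) m3 size] _ order_refl])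
          fix s4
          assume t: "tournament L (arrays s3 ''K'') (arrays s4 ''w'') {0..<int (5 * ?N)}"
            and o: "same_outside enter_all s3 s4"
          have K4: "arrays s4 ''K'' = arrays s3 ''K''" using o by (simp add: same_outside_def)
          have s4: "sizes s4" "input s4" "tables L s4"
            using s3 o by (simp_all add: sizes_def input_def same_outside_def tables_def)
          show "run (extract_all ;;
            Assign ''big'' (Load ''K'' (Load ''p'' (Minus (Reg ''m'') (Const 1)))) ;; sweep) s4
            ((5 * ?N + 1) * (200 * (L + 2)) + (10 + ?T)) ?R"
          proof (rule run_seq, rule run_conseq[OF run_extract_all[OF s4(3) t[folded K4] size] _ order_refl])
            fix s5
            assume srt: "sorts (5 * ?N) (arrays s4 ''K'') (arrays s5 ''p'') (arrays s5 ''rk'')"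
              and o: "same_outside extract_all s4 s5"
            have K5: "arrays s5 ''K'' = arrays s3 ''K''" using o K4 by (simp add: same_outside_def)
            have s5: "sizes s5" "input s5" "tables L s5"
              using s4 o by (simp_all add: sizes_def input_def same_outside_def tables_def)
            \<comment> \<open>The parameters are the concrete arrays of keys, order and ranks left
              by the sort; they remain unchanged during the sweep.\<close>
            interpret sorted_anchors A L "arrays s3 ''K''" "arrays s5 ''p''" "arrays s5 ''rk''"
              by unfold_locales (use srt K4 size K in auto)
            let ?a = "Assign ''big'' (Load ''K'' (Load ''p'' (Minus (Reg ''m'') (Const 1))))"
            have "ready (result ?a s5)"
              using s5 K5 by (simp add: ready_def tables_def sizes_def input_def endpoint_array_def big_def)
            moreover have "trees {} (result ?a s5)"
              using s5 stores_empty by (simp add: trees_def input_def points1_def points2_def points3_def)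
            ultimately have "run sweep (result ?a s5) ?T ?R" by (rule run_sweep)
            then show "run (?a ;; sweep) s5 (10 + ?T) ?R"
              by (rule run_loop_free_seq[rotated]) auto
          qed
        qed
      qed (use s2 in \<open>auto simp: sizes_def input_def\<close>)
    qed
  qed (simp add: L_def)
  then show ?thesis by (rule run_conseq) (use chaining_time_bound[OF L_def] in auto)
qed

end

lemma level_le_log:
  assumes "2 \<le> N" shows "real (level N) \<le> log 2 (real N) + 4"
proof -
  have "real (level N) = log 2 (2 ^ level N)" by simp
  also have "\<dots> \<le> log 2 (16 * real N)"
  proof (rule log_mono)
    \<comment> \<open>Enlarging \<open>10 * N + 1\<close> to \<open>16 * N\<close> makes the factor
      a power of two, whose logarithm is the additive 4.\<close>
    have "real (2 ^ level N) \<le> real (10 * N + 1)" using power_level_le by (simp only: of_nat_le_iff)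
    then show "2 ^ level N \<le> 16 * real N" using assms by simp
  qed auto
  also have "\<dots> = log 2 (2 ^ 4) + log 2 (real N)" using assms by (simp add: log_mult)
  also have "log 2 (2 ^ 4 :: real) = 4" by (subst log_nat_power) auto
  finally show ?thesis by simp
qed

text \<open>For \<open>N \<ge> 2\<close> the logarithm is at least 1, so the height plus 2 is at
  most the logarithm plus 6, hence at most 7 times the logarithm, and
  \<open>N + 1 \<le> 2 * N\<close>. The constant is 50000 * 2 * 49.\<close>

lemma chaining_time_bigo:
  "(\<lambda>N. real (chaining_time N)) \<in> O(\<lambda>N. real N * (log 2 (real N))\<^sup>2)"
proof (rule bigoI[where c = 4900000])
  show "\<forall>\<^sub>F N in sequentially. norm (real (chaining_time N)) \<le> 4900000 * norm (real N * (log 2 (real N))\<^sup>2)"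
    using eventually_ge_at_top[of 2]
  proof eventually_elim
    fix N :: nat assume N: "2 \<le> N"
    let ?l = "log 2 (real N)"
    have l: "1 \<le> ?l" using N by (simp add: le_log_iff)
    then have "real (level N) + 2 \<le> 7 * ?l" using level_le_log[OF N] by simp
    then have "(real (level N) + 2)\<^sup>2 \<le> (7 * ?l)\<^sup>2" by (intro power_mono) auto
    moreover have "real N + 1 \<le> 2 * real N" using N by simp
    ultimately have "(real N + 1) * (real (level N) + 2)\<^sup>2 \<le> 2 * real N * (7 * ?l)\<^sup>2"
      by (intro mult_mono) auto
    then have "50000 * ((real N + 1) * (real (level N) + 2)\<^sup>2) \<le> 4900000 * (real N * ?l\<^sup>2)"
      by (simp add: power_mult_distrib)
    then show "norm (real (chaining_time N)) \<le> 4900000 * norm (real N * ?l\<^sup>2)"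
      by (simp add: chaining_time_def power2_eq_square algebra_simps)
  qed
qed

theorem theorem1:
  "\<exists>(P :: prog) (T :: nat \<Rightarrow> nat).
     (\<lambda>N. real (T N)) \<in> O(\<lambda>N. real N * (log 2 (real N))\<^sup>2) \<and>
     (\<forall>A :: anchor list.
        (\<forall>I \<in> set A. valid_anchor I \<and> equal_match_length I) \<longrightarrow>
        (\<exists>t s'. exec P (input_state A) t s' \<and> t \<le> T (length A) \<and>
           (\<forall>i < length A. arrays s' ''out'' (int i) = max_coverage A i)))"
proof (intro exI[of _ chaining] exI[of _ chaining_time] conjI allI impI)
  fix A :: "anchor list" assume "\<forall>I \<in> set A. valid_anchor I \<and> equal_match_length I"
  then interpret equal_length_anchors A by unfold_locales auto
  show "\<exists>t s'. exec chaining (input_state A) t s' \<and> t \<le> chaining_time (length A) \<and>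
      (\<forall>i < length A. arrays s' ''out'' (int i) = max_coverage A i)"
    using run_chaining unfolding run_def .
qed (rule chaining_time_bigo)

end
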